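(* For every schema $\mathcal{S}$ and every $k\geq0$, the class of c-acyclic $k$-ary CQs over $\mathcal{S}$ is efficiently exactly learnable with membership queries: there is an algorithm that takes no input, has access to a membership oracle for an unknown goal query $q_{goal}$ that is a c-acyclic $k$-ary CQ over $\mathcal{S}$, always terminates and outputs a c-acyclic $k$-ary CQ logically equivalent to $q_{goal}$, and whose running time (counting each oracle call as one step) is bounded by $p(n)$ for a fixed polynomial $p$, where $n$ is the size of $q_{goal}$.
   Context: A schema is a finite set of relation symbols with arities $\geq1$. A structure with $k$ distinguished elements is a pair $(A,\mathbf{a})$ of a finite relational structure $A$ over $\mathcal{S}$ and a $k$-tuple $\mathbf{a}$ of its elements. A homomorphism $(A,\mathbf{a})\to(B,\mathbf{b})$ maps elements to elements, facts to facts, and $a_i$ to $b_i$. A $k$-ary CQ is $q(x_1,\dots,x_k)\text{ :- }\alpha_1\wedge\dots\wedge\alpha_n$ with atoms $\alpha_i$ over $\mathcal{S}$, without constants, in which every $x_i$ occurs in some atom; its canonical structure $\widehat{q}$ has the variables as elements, the atoms as facts, and $(x_1,\dots,x_k)$ as distinguished tuple. $\mathbf{a}\in q(A)$ iff $\widehat{q}\to(A,\mathbf{a})$; two CQs are logically equivalent if they return the same answers on every structure. The incidence graph of a structure is the bipartite multigraph on elements and facts with one edge per occurrence of an element in a fact; a structure (and a CQ, via its canonical structure) is c-acyclic if every cycle of the incidence graph (including length-2 cycles from parallel edges) contains a distinguished element. The membership oracle for $q_{goal}$ receives a structure $(A,\mathbf{a})$ over $\mathcal{S}$ with $k$ distinguished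 elements and answers whether $\mathbf{a}\in q_{goal}(A)$. The size of a CQ is the length of its representation (polynomially related to the size of its canonical structure); the size of $q_{goal}$ means that of its smallest representation. *)

theory Defs
  imports Main "HOL-Computational_Algebra.Polynomial"
begin

section \<open>Schemas, structures and homomorphisms\<close>

text \<open>Relation symbols are named by natural numbers; \<open>arity\<close> is only relevant on \<open>symbols\<close>.\<close>

record schema =
  symbols :: "nat set"
  arity :: "nat \<Rightarrow> nat"

definition is_schema :: "schema \<Rightarrow> bool" where
  "is_schema S \<longleftrightarrow> finite (symbols S) \<and> (\<forall>r \<in> symbols S. 1 \<le> arity S r)"

type_synonym 'a fact = "nat \<times> 'a list"

record 'a struct =
  universe :: "'a set"
  facts :: "'a fact set"

definition is_structure :: "schema \<Rightarrow> 'a struct \<Rightarrow> bool" where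
  "is_structure S A \<longleftrightarrow> finite (universe A) \<and>
     (\<forall>(r, as) \<in> facts A. r \<in> symbols S \<and> length as = arity S r \<and> set as \<subseteq> universe A)"

definition is_pointed :: "schema \<Rightarrow> nat \<Rightarrow> 'a struct \<times> 'a list \<Rightarrow> bool" where
  "is_pointed S k = (\<lambda>(A, a). is_structure S A \<and> length a = k \<and> set a \<subseteq> universe A)"

definition is_hom :: "('a \<Rightarrow> 'b) \<Rightarrow> 'a struct \<times> 'a list \<Rightarrow> 'b struct \<times> 'b list \<Rightarrow> bool" where
  "is_hom h = (\<lambda>(A, a) (B, b). h ` universe A \<subseteq> universe B \<and>
     (\<forall>(r, as) \<in> facts A. (r, map h as) \<in> facts B) \<and> map h a = b)"

definition hom_to :: "'a struct \<times> 'a list \<Rightarrow> 'b struct \<times> 'b list \<Rightarrow> bool" where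
  "hom_to P Q \<longleftrightarrow> (\<exists>h. is_hom h P Q)"


section \<open>Conjunctive queries\<close>

text \<open>Variables are natural numbers. The answer variables may repeat, and for
  \<open>k = 0\<close> the body may be empty.\<close>

record cq =
  head :: "nat list"
  body :: "nat fact list"

definition is_cq :: "schema \<Rightarrow> nat \<Rightarrow> cq \<Rightarrow> bool" where
  "is_cq S k q \<longleftrightarrow> length (head q) = k \<and>
     (\<forall>(r, xs) \<in> set (body q). r \<in> symbols S \<and> length xs = arity S r) \<and>
     (\<forall>x \<in> set (head q). \<exists>(r, xs) \<in> set (body q). x \<in> set xs)"

definition canonical :: "cq \<Rightarrow> nat struct \<times> nat list" where
  "canonical q =
     (\<lparr>universe = (\<Union>(r, xs) \<in> set (body q). set xs), facts = set (body q)\<rparr>, head q)"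

definition answers :: "cq \<Rightarrow> 'a struct \<Rightarrow> 'a list set" where
  "answers q A = {a. hom_to (canonical q) (A, a)}"

text \<open>Structures are finite, so it suffices to let structures over natural numbers
  represent all isomorphism types.\<close>

definition logically_equivalent :: "schema \<Rightarrow> cq \<Rightarrow> cq \<Rightarrow> bool" where
  "logically_equivalent S q q' \<longleftrightarrow>
     (\<forall>A :: nat struct. is_structure S A \<longrightarrow> answers q A = answers q' A)"

text \<open>Length of the query as a string in which relation symbols and variables are single tokens.\<close>

definition cq_size :: "cq \<Rightarrow> nat" where
  "cq_size q = length (head q) + (\<Sum>(r, xs) \<leftarrow> body q. 1 + length xs)"


section \<open>Incidence graphs and c-acyclicity\<close>

text \<open>The edge \<open>(f, i)\<close> of the incidence multigraph is the occurrence of an element at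
  position \<open>i\<close> of the fact \<open>f\<close>; vertices are elements (\<open>Inl\<close>) and facts (\<open>Inr\<close>).\<close>

definition inc_edges :: "'a struct \<Rightarrow> ('a fact \<times> nat) set" where
  "inc_edges A = {(f, i). f \<in> facts A \<and> i < length (snd f)}"

definition inc_ends :: "'a fact \<times> nat \<Rightarrow> ('a + 'a fact) set" where
  "inc_ends = (\<lambda>(f, i). {Inl (snd f ! i), Inr f})"

text \<open>Edge \<open>es ! j\<close> joins vertex \<open>vs ! j\<close> to its cyclic successor. Vertices and edges are both
  required to be distinct; for length two this leaves exactly the pairs of parallel edges.\<close>

definition inc_cycle :: "'a struct \<Rightarrow> ('a + 'a fact) list \<Rightarrow> ('a fact \<times> nat) list \<Rightarrow> bool" where
  "inc_cycle A vs es \<longleftrightarrow>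
     2 \<le> length vs \<and> length es = length vs \<and> distinct vs \<and> distinct es \<and>
     set es \<subseteq> inc_edges A \<and>
     (\<forall>j < length vs. inc_ends (es ! j) = {vs ! j, vs ! (Suc j mod length vs)})"

definition c_acyclic :: "'a struct \<times> 'a list \<Rightarrow> bool" where
  "c_acyclic = (\<lambda>(A, a). \<forall>vs es. inc_cycle A vs es \<longrightarrow> (\<exists>x \<in> set a. Inl x \<in> set vs))"

definition c_acyclic_cqs :: "schema \<Rightarrow> nat \<Rightarrow> cq set" where
  "c_acyclic_cqs S k = {q. is_cq S k q \<and> c_acyclic (canonical q)}"


section \<open>Oracle algorithms\<close>

text \<open>Algorithms are programs of a first-order, call-by-value functional language whose data are
  binary trees. An oracle program consists of the bodies of its (mutually recursive,
  one-argument) functions and a closed main expression. Variables are de Bruijn indices;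
  truth values are \<open>Leaf\<close> (false) and \<open>Node Leaf Leaf\<close> (true).\<close>

datatype tree = Leaf | Node tree tree

datatype expr =
    Var nat
  | Empty
  | Pair expr expr
  | First expr
  | Second expr
  | Cond expr expr expr
  | LetIn expr expr
  | Call nat expr
  | Ask expr

type_synonym oracle_program = "expr list \<times> expr"

fun first :: "tree \<Rightarrow> tree" where
  "first Leaf = Leaf"
| "first (Node l r) = l"

fun second :: "tree \<Rightarrow> tree" where
  "second Leaf = Leaf"
| "second (Node l r) = r"

definition tree_of_bool :: "bool \<Rightarrow> tree" where
  "tree_of_bool b = (if b then Node Leaf Leaf else Leaf)"

text \<open>\<open>eval ora fs env e v t\<close>: evaluation of \<open>e\<close> terminates with value \<open>v\<close> in time \<open>t\<close>.
  Every step costs one unit, including an oracle call, except that building a pair costs the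
  number of nodes (\<open>size\<close>) of the new tree. With unit cost, subtree sharing would allow values,
  and in particular oracle queries, of size exponential in the running time; with the cost
  chosen here all values have size at most the running time (lemma \<open>eval_size\<close>),
  so polynomial time coincides with polynomial time on oracle Turing machines.
  There is no rule for unbound variables or undefined functions: such evaluations are stuck and
  do not count as terminating.\<close>

inductive eval ::
  "(tree \<Rightarrow> bool) \<Rightarrow> expr list \<Rightarrow> tree list \<Rightarrow> expr \<Rightarrow> tree \<Rightarrow> nat \<Rightarrow> bool"
  for ora :: "tree \<Rightarrow> bool" and fs :: "expr list" where
  eval_Var: "i < length env \<Longrightarrow> eval ora fs env (Var i) (env ! i) 1"
| eval_Empty: "eval ora fs env Empty Leaf 1"
| eval_Pair: "eval ora fs env e1 v1 t1 \<Longrightarrow> eval ora fs env e2 v2 t2 \<Longrightarrow>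
    eval ora fs env (Pair e1 e2) (Node v1 v2) (t1 + t2 + size (Node v1 v2))"
| eval_First: "eval ora fs env e v t \<Longrightarrow> eval ora fs env (First e) (first v) (t + 1)"
| eval_Second: "eval ora fs env e v t \<Longrightarrow> eval ora fs env (Second e) (second v) (t + 1)"
| eval_Cond_true: "eval ora fs env e0 v0 t0 \<Longrightarrow> v0 \<noteq> Leaf \<Longrightarrow> eval ora fs env e1 v1 t1 \<Longrightarrow>
    eval ora fs env (Cond e0 e1 e2) v1 (t0 + t1 + 1)"
| eval_Cond_false: "eval ora fs env e0 Leaf t0 \<Longrightarrow> eval ora fs env e2 v2 t2 \<Longrightarrow>
    eval ora fs env (Cond e0 e1 e2) v2 (t0 + t2 + 1)"
| eval_LetIn: "eval ora fs env e1 v1 t1 \<Longrightarrow> eval ora fs (v1 # env) e2 v2 t2 \<Longrightarrow>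
    eval ora fs env (LetIn e1 e2) v2 (t1 + t2 + 1)"
| eval_Call: "f < length fs \<Longrightarrow> eval ora fs env e v t \<Longrightarrow> eval ora fs [v] (fs ! f) w u \<Longrightarrow>
    eval ora fs env (Call f e) w (t + u + 1)"
| eval_Ask: "eval ora fs env e v t \<Longrightarrow>
    eval ora fs env (Ask e) (tree_of_bool (ora v)) (t + 1)"

definition runs :: "(tree \<Rightarrow> bool) \<Rightarrow> oracle_program \<Rightarrow> tree \<Rightarrow> nat \<Rightarrow> bool" where
  "runs ora P v t \<longleftrightarrow> eval ora (fst P) [] (snd P) v t"

lemma eval_deterministic:
  assumes "eval ora fs env e v t" and "eval ora fs env e v' t'"
  shows "v = v' \<and> t = t'"
  using assms
proof (induction arbitrary: v' t' rule: eval.induct)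
  case (eval_Var i env) from eval_Var.prems show ?case by cases simp_all
next
  case (eval_Empty env) from eval_Empty.prems show ?case by cases simp_all
next
  case (eval_Pair env e1 v1 t1 e2 v2 t2)
  from eval_Pair.prems show ?case by cases (use eval_Pair.IH in blast)
next
  case (eval_First env e v t)
  from eval_First.prems show ?case by cases (use eval_First.IH in blast)
next
  case (eval_Second env e v t)
  from eval_Second.prems show ?case by cases (use eval_Second.IH in blast)
next
  case (eval_Cond_true env e0 v0 t0 e1 v1 t1 e2)
  from eval_Cond_true.prems show ?case
    by cases (use eval_Cond_true.IH eval_Cond_true.hyps in blast)+
next
  case (eval_Cond_false env e0 t0 e2 v2 t2 e1)
  from eval_Cond_false.prems show ?case
    by cases (use eval_Cond_false.IH in blast)+
next
  case (eval_LetIn env e1 v1 t1 e2 v2 t2)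
  from eval_LetIn.prems show ?case by cases (use eval_LetIn.IH in blast)
next
  case (eval_Call f env e v t w u)
  from eval_Call.prems show ?case by cases (use eval_Call.IH in blast)
next
  case (eval_Ask env e v t)
  from eval_Ask.prems show ?case by cases (use eval_Ask.IH in blast)
qed

lemma eval_size:
  assumes "eval ora fs env e v t" and "\<forall>x \<in> set env. size x \<le> B"
  shows "size v \<le> B + t"
  using assms
proof (induction arbitrary: B rule: eval.induct)
  case (eval_Var i env)
  then have "size (env ! i) \<le> B" by simp
  then show ?case by simp
next
  case (eval_First env e v t)
  then show ?case by (cases v) (fastforce simp: tree.size)+
next
  case (eval_Second env e v t)
  then show ?case by (cases v) (fastforce simp: tree.size)+
next
  case (eval_LetIn env e1 v1 t1 e2 v2 t2)
  have "size v1 \<le> B + t1" using eval_LetIn by blast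
  then have "\<forall>x \<in> set (v1 # env). size x \<le> B + t1"
    using eval_LetIn.prems by (auto intro: trans_le_add1)
  then show ?case using eval_LetIn.IH(2) by fastforce
next
  case (eval_Call f env e v t w u)
  have "size v \<le> B + t" using eval_Call by blast
  then have "\<forall>x \<in> set [v]. size x \<le> B + t" by simp
  then show ?case using eval_Call.IH(2) by fastforce
qed (fastforce simp: tree_of_bool_def)+


section \<open>Representations of queries and structures as trees\<close>

definition enc_list :: "('a \<Rightarrow> tree) \<Rightarrow> 'a list \<Rightarrow> tree" where
  "enc_list enc xs = foldr (\<lambda>x. Node (enc x)) xs Leaf"

definition enc_nat :: "nat \<Rightarrow> tree" where
  "enc_nat n = enc_list (\<lambda>_. Leaf) (replicate n ())"

definition enc_tuple :: "nat list \<Rightarrow> tree" where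
  "enc_tuple = enc_list enc_nat"

definition enc_fact :: "nat fact \<Rightarrow> tree" where
  "enc_fact = (\<lambda>(r, xs). Node (enc_nat r) (enc_tuple xs))"

definition enc_cq :: "cq \<Rightarrow> tree" where
  "enc_cq q = Node (enc_tuple (head q)) (enc_list enc_fact (body q))"

text \<open>A finite structure is given by listing its universe and its facts (in any order, possibly
  with repetitions), followed by its distinguished tuple.\<close>

definition enc_pointed :: "nat list \<Rightarrow> nat fact list \<Rightarrow> nat list \<Rightarrow> tree" where
  "enc_pointed us gs a = Node (enc_tuple us) (Node (enc_list enc_fact gs) (enc_tuple a))"

text \<open>Trees that do not represent a structure over the schema with \<open>k\<close> distinguished
  elements are answered negatively, independently of the goal query.\<close>

definition membership_oracle :: "schema \<Rightarrow> nat \<Rightarrow> cq \<Rightarrow> tree \<Rightarrow> bool" where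
  "membership_oracle S k q v \<longleftrightarrow>
     (\<exists>us gs a. v = enc_pointed us gs a \<and>
        is_pointed S k (\<lparr>universe = set us, facts = set gs\<rparr>, a) \<and>
        a \<in> answers q \<lparr>universe = set us, facts = set gs\<rparr>)"

lemma enc_list_inj:
  assumes "\<And>x y. enc x = enc y \<Longrightarrow> x = y" and "enc_list enc xs = enc_list enc ys"
  shows "xs = ys"
  using assms(2)
proof (induction xs arbitrary: ys)
  case Nil
  then show ?case by (cases ys) (simp_all add: enc_list_def)
next
  case (Cons x xs)
  then show ?case using assms(1) by (cases ys) (auto simp: enc_list_def)
qed

lemma enc_nat_inj: "enc_nat m = enc_nat n \<Longrightarrow> m = n"
  unfolding enc_nat_def by (drule enc_list_inj[rotated]) simp_all

lemma enc_tuple_inj: "enc_tuple xs = enc_tuple ys \<Longrightarrow> xs = ys"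
  unfolding enc_tuple_def using enc_list_inj enc_nat_inj by blast

lemma enc_fact_inj: "enc_fact f = enc_fact g \<Longrightarrow> f = g"
  by (cases f; cases g) (auto simp: enc_fact_def dest: enc_nat_inj enc_tuple_inj)

lemma enc_cq_inj: "enc_cq q = enc_cq q' \<Longrightarrow> q = q'"
  by (cases q; cases q')
    (auto simp: enc_cq_def dest!: enc_tuple_inj intro: enc_list_inj enc_fact_inj)

lemma enc_pointed_inj:
  "enc_pointed us gs a = enc_pointed us' gs' a' \<Longrightarrow> us = us' \<and> gs = gs' \<and> a = a'"
  by (auto simp: enc_pointed_def dest: enc_tuple_inj intro: enc_list_inj enc_fact_inj)

lemma membership_oracle_enc_pointed:
  assumes "is_pointed S k (\<lparr>universe = set us, facts = set gs\<rparr>, a)"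
  shows "membership_oracle S k q (enc_pointed us gs a) \<longleftrightarrow>
    a \<in> answers q \<lparr>universe = set us, facts = set gs\<rparr>"
  using assms unfolding membership_oracle_def by (auto dest: enc_pointed_inj)


section \<open>Efficient exact learnability\<close>

text \<open>The size of a goal query is that of the smallest query of the class \<open>C\<close> expressing it.\<close>

definition goal_size :: "schema \<Rightarrow> cq set \<Rightarrow> cq \<Rightarrow> nat" where
  "goal_size S C q = (LEAST n. \<exists>q' \<in> C. logically_equivalent S q' q \<and> cq_size q' = n)"

text \<open>By \<open>eval_deterministic\<close>, the program has at most one run for each oracle, so the
  existence of a run with value \<open>enc_cq q\<close> and time \<open>t\<close> says that it terminates, that
  its output is \<open>q\<close>, and that \<open>t\<close> is its running time.\<close>

definition efficiently_exactly_learnable :: "schema \<Rightarrow> nat \<Rightarrow> cq set \<Rightarrow> bool" where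
  "efficiently_exactly_learnable S k C \<longleftrightarrow>
     (\<exists>(P :: oracle_program) (p :: nat poly).
        \<forall>q_goal \<in> C. \<exists>q \<in> C. \<exists>t.
          runs (membership_oracle S k q_goal) P (enc_cq q) t \<and>
          logically_equivalent S q q_goal \<and>
          t \<le> poly p (goal_size S C q_goal))"

end

theory Submission
  imports Defs
begin

text \<open>The learner maintains a \<^emph>\<open>critical\<close> positive instance \<open>A\<close>: the goal \<open>Q\<close> maps to \<open>A\<close>, but
  no longer does so when a fact of \<open>A\<close> is removed. Then \<open>Q\<close> maps onto the facts of \<open>A\<close>, so \<open>A\<close> is
  no larger than \<open>Q\<close>, and every endomorphism of \<open>A\<close> is an automorphism. If \<open>B\<close> is a positive
  instance that maps to \<open>A\<close> and to which \<open>A\<close> does not map, then every critical substructure of \<open>B\<close>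
  has more elements than \<open>A\<close>; so at most \<open>|Q|\<close> such replacements are possible.

  Candidates for \<open>B\<close> split the non-distinguished elements of \<open>A\<close> into labelled copies. The first kind
  consists of double covers, which flip the sheet at one occurrence of an element in a fact. The
  c-acyclic \<open>Q\<close> lifts to all of them, but \<open>A\<close> does not lift to the cover flipping an edge of a cycle
  without distinguished elements; hence if no candidate makes progress, \<open>A\<close> is c-acyclic. The second
  kind plays the role of a frontier: elements are marked with incident facts, and a copy of a fact
  \<open>f\<close> is kept if one of its elements is marked with another fact. A c-acyclic \<open>A\<close> does not lift to
  these, whereas \<open>Q\<close> lifts to one of them unless \<open>A\<close> maps to \<open>Q\<close>. So the learner stops only when
  \<open>A\<close> is a c-acyclic query equivalent to \<open>Q\<close>.

  Polynomial time is established by closure properties of the class of functions that programs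
  compute in time polynomial in the size of their input.\<close>

section \<open>Polynomial-time programs\<close>

text \<open>No efficient test is available for whether \<open>A\<close> maps to a candidate
  \<open>B\<close>, and the oracle only answers questions about the goal. The learner never makes
  this test: it minimises every positive \<open>B\<close> with the oracle and compares numbers of
  elements. A result that is not larger certifies that \<open>A\<close> maps to \<open>B\<close>. No
  bound on the goal is needed either, since every critical instance is an image of the goal and
  hence small. As the oracle depends only on the equivalence class of the goal, the goal may be
  taken to be its smallest representation.

  The head needs separate care. A positive instance may identify answer variables that the goal
  keeps apart, and as candidates preserve the equalities within the distinguished tuple, this could
  not be undone. So the start is a positive instance with as many distinct distinguished elements as
  possible.

  Candidates have polynomial size because the schema is fixed: with arities at most
  \<open>n\<close>, a fact has at most \<open>(|F| + 1)^n\<close> labelled copies. The degree of the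
  final polynomial thus depends on the arities.\<close>

definition poly_bounded :: "(nat \<Rightarrow> nat) \<Rightarrow> bool" where
  "poly_bounded g \<longleftrightarrow> (\<exists>p. \<forall>n. g n \<le> poly p n)"

text \<open>Coefficients are natural numbers, so no term decreases. Monotonicity is what lets a size
  bound be substituted into a time bound.\<close>

lemma poly_nat_mono: "m \<le> n \<Longrightarrow> poly (p :: nat poly) m \<le> poly p n"
  by (induction p) (auto intro: add_mono mult_mono)

lemma poly_bounded_poly [intro]: "poly_bounded (poly p)"
  by (auto simp: poly_bounded_def)

lemma poly_bounded_const [intro]: "poly_bounded (\<lambda>n. c)"
  unfolding poly_bounded_def by (rule exI[of _ "[:c:]"]) simp

lemma poly_bounded_id [intro]: "poly_bounded (\<lambda>n. n)"
  unfolding poly_bounded_def by (rule exI[of _ "[:0, 1:]"]) simp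

lemma poly_bounded_add [intro]:
  "poly_bounded f \<Longrightarrow> poly_bounded g \<Longrightarrow> poly_bounded (\<lambda>n. f n + g n)"
  unfolding poly_bounded_def by (metis add_mono poly_add)

lemma poly_bounded_mult [intro]:
  "poly_bounded f \<Longrightarrow> poly_bounded g \<Longrightarrow> poly_bounded (\<lambda>n. f n * g n)"
  unfolding poly_bounded_def by (metis mult_le_mono poly_mult)

lemma poly_bounded_comp [intro]: "poly_bounded f \<Longrightarrow> poly_bounded (\<lambda>n. poly p (f n))"
  unfolding poly_bounded_def by (metis poly_nat_mono poly_pcompose)

lemma poly_bounded_Suc [intro]: "poly_bounded f \<Longrightarrow> poly_bounded (\<lambda>n. Suc (f n))"
  using poly_bounded_add[OF poly_bounded_const[of 1]] by simp

lemma poly_boundedE: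
  assumes "poly_bounded f" obtains p where "\<And>n. f n \<le> poly p n"
  using assms unfolding poly_bounded_def by blast


definition enc_pair :: "('a \<Rightarrow> tree) \<Rightarrow> ('b \<Rightarrow> tree) \<Rightarrow> 'a \<times> 'b \<Rightarrow> tree" where
  "enc_pair ea eb z = Node (ea (fst z)) (eb (snd z))"

text \<open>The quantification over a prefix \<open>fs\<close> and a suffix \<open>hs\<close> of the function table lets
  programs be linked without renumbering their calls; the one over \<open>env\<close> lets them be
  composed by \<open>LetIn\<close>.\<close>

definition ptime ::
  "('a \<Rightarrow> tree) \<Rightarrow> ('b \<Rightarrow> tree) \<Rightarrow> ((tree \<Rightarrow> bool) \<Rightarrow> 'a \<Rightarrow> 'b) \<Rightarrow> bool" where
  "ptime ea eb f \<longleftrightarrow> (\<exists>p. \<forall>fs. \<exists>gs e. \<forall>hs ora x env. \<exists>t \<le> poly p (size (ea x)).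
     eval ora (fs @ gs @ hs) (ea x # env) e (eb (f ora x)) t)"

lemma ptimeI:
  assumes "poly_bounded T"
    and "\<And>fs. \<exists>gs e. \<forall>hs ora x env. \<exists>t \<le> T (size (ea x)).
      eval ora (fs @ gs @ hs) (ea x # env) e (eb (f ora x)) t"
  shows "ptime ea eb f"
  using assms unfolding ptime_def poly_bounded_def by (meson le_trans)

text \<open>Values never exceed the environment plus the running time, because pairs are charged by
  size. The bound is used whenever one program consumes the result of another.\<close>

lemma ptime_size:
  assumes "ptime ea eb f"
  obtains p where "\<And>ora x. size (eb (f ora x)) \<le> poly p (size (ea x))"
proof -
  obtain p where "\<forall>fs. \<exists>gs e. \<forall>hs ora x env. \<exists>t \<le> poly p (size (ea x)).
      eval ora (fs @ gs @ hs) (ea x # env) e (eb (f ora x)) t"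
    using assms unfolding ptime_def by blast
  then obtain gs e where *: "\<forall>ora x. \<exists>t \<le> poly p (size (ea x)).
      eval ora ([] @ gs @ []) [ea x] e (eb (f ora x)) t" by meson
  have "size (eb (f ora x)) \<le> size (ea x) + poly p (size (ea x))" for ora x
  proof -
    obtain t where "t \<le> poly p (size (ea x))" "eval ora gs [ea x] e (eb (f ora x)) t"
      using * by auto
    then show ?thesis using eval_size[of ora gs "[ea x]" e "eb (f ora x)" t "size (ea x)"] by simp
  qed
  moreover have "poly_bounded (\<lambda>n. n + poly p n)" by auto
  ultimately show ?thesis using that by (meson le_trans poly_boundedE)
qed

section \<open>Basic programs, composition and branching\<close>

lemma ptime_id: "ptime ea ea (\<lambda>ora x. x)"
proof (rule ptimeI[of "\<lambda>_. 1"])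
  fix fs
  show "\<exists>gs e. \<forall>hs ora x env. \<exists>t\<le>1. eval ora (fs @ gs @ hs) (ea x # env) e (ea x) t"
    using eval_Var[of 0] by (intro exI[of _ "[]"] exI[of _ "Var 0"]) fastforce
qed auto

text \<open>Constants are written into the program text. Even the list of starting instances, which
  depends on the schema and \<open>k\<close> but not on the goal, is supplied in this way.\<close>

fun quote_tree :: "tree \<Rightarrow> expr" where
  "quote_tree Leaf = Empty"
| "quote_tree (Node l r) = Pair (quote_tree l) (quote_tree r)"

lemma eval_quote_tree: "\<exists>n. \<forall>ora fs env. eval ora fs env (quote_tree v) v n"
proof (induction v)
  case Leaf
  then show ?case using eval_Empty by auto
next
  case (Node l r)
  then obtain m n where "\<forall>ora fs env. eval ora fs env (quote_tree l) l m"
    "\<forall>ora fs env. eval ora fs env (quote_tree r) r n" by blast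
  then show ?case by (auto intro!: exI[of _ "m + n + size (Node l r)"] eval_Pair)
qed

lemma ptime_const: "ptime ea eb (\<lambda>ora x. c)"
proof -
  obtain n where n: "\<forall>ora fs env. eval ora fs env (quote_tree (eb c)) (eb c) n"
    using eval_quote_tree by blast
  show ?thesis
    by (rule ptimeI[of "\<lambda>_. n"]) (use n in blast)+
qed

text \<open>The second program is generated for the table already extended by the functions of the
  first, and the first tolerates those of the second as a suffix; so all call indices stay valid in
  the joint table.\<close>

lemma ptime_2:
  assumes "ptime ea eb f" "ptime ec ed g"
  obtains p q where "\<And>fs. \<exists>gs e1 e2.
    (\<forall>hs ora x env. \<exists>t \<le> poly p (size (ea x)). eval ora (fs @ gs @ hs) (ea x # env) e1 (eb (f ora x)) t) \<and>
    (\<forall>hs ora x env. \<exists>t \<le> poly q (size (ec x)). eval ora (fs @ gs @ hs) (ec x # env) e2 (ed (g ora x)) t)"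
proof -
  obtain p where p: "\<And>fs. \<exists>gs e. \<forall>hs ora x env. \<exists>t \<le> poly p (size (ea x)).
     eval ora (fs @ gs @ hs) (ea x # env) e (eb (f ora x)) t"
    using assms(1) unfolding ptime_def by blast
  obtain q where q: "\<And>fs. \<exists>gs e. \<forall>hs ora x env. \<exists>t \<le> poly q (size (ec x)).
     eval ora (fs @ gs @ hs) (ec x # env) e (ed (g ora x)) t"
    using assms(2) unfolding ptime_def by blast
  show ?thesis
  proof (rule that[of p q])
    fix fs
    obtain gs1 e1 where 1: "\<forall>hs ora x env. \<exists>t \<le> poly p (size (ea x)).
      eval ora (fs @ gs1 @ hs) (ea x # env) e1 (eb (f ora x)) t" using p by blast
    obtain gs2 e2 where 2: "\<forall>hs ora x env. \<exists>t \<le> poly q (size (ec x)).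
      eval ora ((fs @ gs1) @ gs2 @ hs) (ec x # env) e2 (ed (g ora x)) t" using q by blast
    show "\<exists>gs e1 e2.
    (\<forall>hs ora x env. \<exists>t \<le> poly p (size (ea x)). eval ora (fs @ gs @ hs) (ea x # env) e1 (eb (f ora x)) t) \<and>
    (\<forall>hs ora x env. \<exists>t \<le> poly q (size (ec x)). eval ora (fs @ gs @ hs) (ec x # env) e2 (ed (g ora x)) t)"
      using 1 2 by (intro exI[of _ "gs1 @ gs2"] exI[of _ e1] exI[of _ e2]) simp
  qed
qed

lemma ptime_comp:
  assumes "ptime eb ec g" "ptime ea eb f"
  shows "ptime ea ec (\<lambda>ora x. g ora (f ora x))"
proof -
  obtain r where r: "\<And>ora x. size (eb (f ora x)) \<le> poly r (size (ea x))"
    using ptime_size[OF assms(2)] by blast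
  obtain p q where pq: "\<And>fs. \<exists>gs e1 e2.
    (\<forall>hs ora x env. \<exists>t \<le> poly p (size (ea x)). eval ora (fs @ gs @ hs) (ea x # env) e1 (eb (f ora x)) t) \<and>
    (\<forall>hs ora x env. \<exists>t \<le> poly q (size (eb x)). eval ora (fs @ gs @ hs) (eb x # env) e2 (ec (g ora x)) t)"
    using ptime_2[OF assms(2,1)] by blast
  show ?thesis
  proof (rule ptimeI[of "\<lambda>n. poly p n + poly q (poly r n) + 1"])
    fix fs
    obtain gs e1 e2 where 1: "\<And>hs ora x env. \<exists>t \<le> poly p (size (ea x)).
        eval ora (fs @ gs @ hs) (ea x # env) e1 (eb (f ora x)) t"
      and 2: "\<And>hs ora x env. \<exists>t \<le> poly q (size (eb x)).
        eval ora (fs @ gs @ hs) (eb x # env) e2 (ec (g ora x)) t"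
      using pq[of fs] by blast
    have "\<exists>t\<le>poly p (size (ea x)) + poly q (poly r (size (ea x))) + 1.
          eval ora (fs @ gs @ hs) (ea x # env) (LetIn e1 e2) (ec (g ora (f ora x))) t" for hs ora x env
    proof -
      obtain s where s: "s \<le> poly p (size (ea x))"
        "eval ora (fs @ gs @ hs) (ea x # env) e1 (eb (f ora x)) s" using 1 by blast
      obtain t where t: "t \<le> poly q (size (eb (f ora x)))"
        "eval ora (fs @ gs @ hs) (eb (f ora x) # ea x # env) e2 (ec (g ora (f ora x))) t" using 2 by blast
      have "t \<le> poly q (poly r (size (ea x)))" using t(1) poly_nat_mono[OF r] le_trans by blast
      then show ?thesis using s t eval_LetIn[OF s(2) t(2)]
        by (intro exI[of _ "s + t + 1"]) simp
    qed
    then show "\<exists>gs e. \<forall>hs ora x env. \<exists>t\<le>poly p (size (ea x)) + poly q (poly r (size (ea x))) + 1.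
          eval ora (fs @ gs @ hs) (ea x # env) e (ec (g ora (f ora x))) t" by blast
  qed (intro poly_bounded_add poly_bounded_comp poly_bounded_const poly_bounded_poly)
qed

lemma ptime_pair:
  assumes "ptime ea eb f" "ptime ea ec g"
  shows "ptime ea (enc_pair eb ec) (\<lambda>ora x. (f ora x, g ora x))"
proof -
  obtain r where r: "\<And>ora x. size (eb (f ora x)) \<le> poly r (size (ea x))"
    using ptime_size[OF assms(1)] by blast
  obtain r' where r': "\<And>ora x. size (ec (g ora x)) \<le> poly r' (size (ea x))"
    using ptime_size[OF assms(2)] by blast
  obtain p q where pq: "\<And>fs. \<exists>gs e1 e2.
    (\<forall>hs ora x env. \<exists>t \<le> poly p (size (ea x)). eval ora (fs @ gs @ hs) (ea x # env) e1 (eb (f ora x)) t) \<and>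
    (\<forall>hs ora x env. \<exists>t \<le> poly q (size (ea x)). eval ora (fs @ gs @ hs) (ea x # env) e2 (ec (g ora x)) t)"
    using ptime_2[OF assms] by blast
  let ?T = "\<lambda>n. poly p n + poly q n + (poly r n + poly r' n + 1)"
  show ?thesis
  proof (rule ptimeI[of ?T])
    fix fs
    obtain gs e1 e2 where 1: "\<And>hs ora x env. \<exists>t \<le> poly p (size (ea x)).
        eval ora (fs @ gs @ hs) (ea x # env) e1 (eb (f ora x)) t"
      and 2: "\<And>hs ora x env. \<exists>t \<le> poly q (size (ea x)).
        eval ora (fs @ gs @ hs) (ea x # env) e2 (ec (g ora x)) t"
      using pq[of fs] by blast
    have "\<exists>t\<le>?T (size (ea x)).
          eval ora (fs @ gs @ hs) (ea x # env) (Pair e1 e2) (enc_pair eb ec (f ora x, g ora x)) t"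
      for hs ora x env
    proof -
      obtain s where s: "s \<le> poly p (size (ea x))"
        "eval ora (fs @ gs @ hs) (ea x # env) e1 (eb (f ora x)) s" using 1 by blast
      obtain t where t: "t \<le> poly q (size (ea x))"
        "eval ora (fs @ gs @ hs) (ea x # env) e2 (ec (g ora x)) t" using 2 by blast
      show ?thesis using s t r[of ora x] r'[of ora x] eval_Pair[OF s(2) t(2)]
        by (intro exI[of _ "s + t + size (Node (eb (f ora x)) (ec (g ora x)))"])
          (simp add: enc_pair_def)
    qed
    then show "\<exists>gs e. \<forall>hs ora x env. \<exists>t\<le>?T (size (ea x)).
          eval ora (fs @ gs @ hs) (ea x # env) e (enc_pair eb ec (f ora x, g ora x)) t" by blast
  qed (intro poly_bounded_add poly_bounded_const poly_bounded_poly)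
qed

text \<open>Common form of \<open>First\<close>, \<open>Second\<close> and \<open>Ask\<close>;
  \<open>c\<close> takes the oracle for the sake of \<open>Ask\<close>.\<close>

lemma ptime_unary:
  assumes "ptime ea eb f"
    and "\<And>ora fs env e v t. eval ora fs env e v t \<Longrightarrow> eval ora fs env (C e) (c ora v) (t + 1)"
    and "\<And>ora x. c ora (eb (f ora x)) = ec (g ora x)"
  shows "ptime ea ec g"
proof -
  obtain p where p: "\<And>fs. \<exists>gs e. \<forall>hs ora x env. \<exists>t \<le> poly p (size (ea x)).
     eval ora (fs @ gs @ hs) (ea x # env) e (eb (f ora x)) t"
    using assms(1) unfolding ptime_def by blast
  show ?thesis
  proof (rule ptimeI[of "\<lambda>n. poly p n + 1"])
    fix fs
    obtain gs e where 1: "\<And>hs ora x env. \<exists>t \<le> poly p (size (ea x)).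
        eval ora (fs @ gs @ hs) (ea x # env) e (eb (f ora x)) t"
      using p[of fs] by blast
    have "\<exists>t\<le>poly p (size (ea x)) + 1. eval ora (fs @ gs @ hs) (ea x # env) (C e) (ec (g ora x)) t"
      for hs ora x env
    proof -
      obtain t where t: "t \<le> poly p (size (ea x))"
        "eval ora (fs @ gs @ hs) (ea x # env) e (eb (f ora x)) t" using 1 by blast
      show ?thesis using t(1) assms(2)[OF t(2)] assms(3) by (intro exI[of _ "t + 1"]) simp
    qed
    then show "\<exists>gs e. \<forall>hs ora x env. \<exists>t\<le>poly p (size (ea x)) + 1.
        eval ora (fs @ gs @ hs) (ea x # env) e (ec (g ora x)) t" by blast
  qed auto
qed

lemma ptime_fst:
  assumes "ptime ea (enc_pair eb ec) f" shows "ptime ea eb (\<lambda>ora x. fst (f ora x))"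
  by (rule ptime_unary[OF assms, where C = First and c = "\<lambda>_. first"])
    (erule eval_First, simp add: enc_pair_def)

lemma ptime_snd:
  assumes "ptime ea (enc_pair eb ec) f" shows "ptime ea ec (\<lambda>ora x. snd (f ora x))"
  by (rule ptime_unary[OF assms, where C = Second and c = "\<lambda>_. second"])
    (erule eval_Second, simp add: enc_pair_def)

lemma ptime_oracle:
  assumes "ptime ea eb f" shows "ptime ea tree_of_bool (\<lambda>ora x. ora (eb (f ora x)))"
  by (rule ptime_unary[OF assms, where C = Ask and c = "\<lambda>ora v. tree_of_bool (ora v)"])
    (erule eval_Ask, rule refl)

lemma enc_list_simps [simp]:
  "enc_list e [] = Leaf" "enc_list e (x # xs) = Node (e x) (enc_list e xs)"
  by (simp_all add: enc_list_def)

text \<open>\<open>second Leaf = Leaf\<close> matches \<open>tl [] = []\<close>, so no case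
  distinction has to be programmed.\<close>

lemma ptime_tl:
  assumes "ptime ea (enc_list eb) f" shows "ptime ea (enc_list eb) (\<lambda>ora x. tl (f ora x))"
proof (rule ptime_unary[OF assms, where C = Second and c = "\<lambda>_. second"])
  fix ora x
  show "second (enc_list eb (f ora x)) = enc_list eb (tl (f ora x))"
    by (cases "f ora x") simp_all
qed (rule eval_Second)

text \<open>Only encoded values matter to \<open>ptime\<close>; this allows changing the result type
  or the definition of a function as long as its output tree is the same.\<close>

lemma ptime_recode:
  assumes "ptime ea eb f" "\<And>ora x. ec (g ora x) = eb (f ora x)"
  shows "ptime ea ec g"
  using assms unfolding ptime_def by simp

text \<open>The program builds a truth value instead of returning the list, because
  \<open>ptime_if\<close> expects exactly the encoding \<open>tree_of_bool\<close>.\<close>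

lemma ptime_not_Nil:
  assumes "ptime ea (enc_list eb) f" shows "ptime ea tree_of_bool (\<lambda>ora x. f ora x \<noteq> [])"
proof -
  obtain p where p: "\<And>fs. \<exists>gs e. \<forall>hs ora x env. \<exists>t \<le> poly p (size (ea x)).
     eval ora (fs @ gs @ hs) (ea x # env) e (enc_list eb (f ora x)) t"
    using assms(1) unfolding ptime_def by blast
  show ?thesis
  proof (rule ptimeI[of "\<lambda>n. poly p n + 5"])
    fix fs
    obtain gs e where 1: "\<And>hs ora x env. \<exists>t \<le> poly p (size (ea x)).
        eval ora (fs @ gs @ hs) (ea x # env) e (enc_list eb (f ora x)) t"
      using p[of fs] by blast
    let ?e = "Cond e (Pair Empty Empty) Empty"
    have "\<exists>t\<le>poly p (size (ea x)) + 5.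
      eval ora (fs @ gs @ hs) (ea x # env) ?e (tree_of_bool (f ora x \<noteq> [])) t"
      for hs ora x env
    proof -
      obtain t where t: "t \<le> poly p (size (ea x))"
        "eval ora (fs @ gs @ hs) (ea x # env) e (enc_list eb (f ora x)) t" using 1 by blast
      show ?thesis
      proof (cases "f ora x = []")
        case True
        then have "eval ora (fs @ gs @ hs) (ea x # env) ?e Leaf (t + 1 + 1)"
          using t by (intro eval_Cond_false eval_Empty) auto
        then show ?thesis using t True by (intro exI[of _ "t + 2"]) (simp add: tree_of_bool_def)
      next
        case False
        then have "enc_list eb (f ora x) \<noteq> Leaf" by (cases "f ora x") simp_all
        then have "eval ora (fs @ gs @ hs) (ea x # env) ?e (Node Leaf Leaf)
          (t + (1 + 1 + size (Node Leaf Leaf)) + 1)"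
          using t by (intro eval_Cond_true eval_Pair eval_Empty) auto
        then show ?thesis using t False by (intro exI[of _ "Suc (Suc (Suc (Suc t)))"]) (simp add: tree_of_bool_def)
      qed
    qed
    then show "\<exists>gs e. \<forall>hs ora x env. \<exists>t\<le>poly p (size (ea x)) + 5.
      eval ora (fs @ gs @ hs) (ea x # env) e (tree_of_bool (f ora x \<noteq> [])) t" by blast
  qed auto
qed

lemma ptime_if:
  assumes "ptime ea tree_of_bool b" "ptime ea eb f" "ptime ea eb g"
  shows "ptime ea eb (\<lambda>ora x. if b ora x then f ora x else g ora x)"
proof -
  obtain r where r: "\<And>fs. \<exists>gs e. \<forall>hs ora x env. \<exists>t \<le> poly r (size (ea x)).
     eval ora (fs @ gs @ hs) (ea x # env) e (tree_of_bool (b ora x)) t"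
    using assms(1) unfolding ptime_def by blast
  obtain p q where pq: "\<And>fs. \<exists>gs e1 e2.
    (\<forall>hs ora x env. \<exists>t \<le> poly p (size (ea x)). eval ora (fs @ gs @ hs) (ea x # env) e1 (eb (f ora x)) t) \<and>
    (\<forall>hs ora x env. \<exists>t \<le> poly q (size (ea x)). eval ora (fs @ gs @ hs) (ea x # env) e2 (eb (g ora x)) t)"
    using ptime_2[OF assms(2,3)] by blast
  let ?T = "\<lambda>n. poly p n + poly q n + poly r n + 1"
  show ?thesis
  proof (rule ptimeI[of ?T])
    fix fs
    obtain gs0 e0 where 0: "\<And>hs ora x env. \<exists>t \<le> poly r (size (ea x)).
        eval ora (fs @ gs0 @ hs) (ea x # env) e0 (tree_of_bool (b ora x)) t"
      using r[of fs] by blast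
    obtain gs1 e1 e2 where 1: "\<And>hs ora x env. \<exists>t \<le> poly p (size (ea x)).
        eval ora ((fs @ gs0) @ gs1 @ hs) (ea x # env) e1 (eb (f ora x)) t"
      and 2: "\<And>hs ora x env. \<exists>t \<le> poly q (size (ea x)).
        eval ora ((fs @ gs0) @ gs1 @ hs) (ea x # env) e2 (eb (g ora x)) t"
      using pq[of "fs @ gs0"] by blast
    have "\<exists>t\<le>?T (size (ea x)). eval ora (fs @ (gs0 @ gs1) @ hs) (ea x # env) (Cond e0 e1 e2)
          (eb (if b ora x then f ora x else g ora x)) t"
      for hs ora x env
    proof -
      obtain s where s: "s \<le> poly r (size (ea x))"
        "eval ora (fs @ (gs0 @ gs1) @ hs) (ea x # env) e0 (tree_of_bool (b ora x)) s"
        using 0[of x ora "gs1 @ hs" env] by auto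
      show ?thesis
      proof (cases "b ora x")
        case True
        obtain t where t: "t \<le> poly p (size (ea x))"
          "eval ora (fs @ (gs0 @ gs1) @ hs) (ea x # env) e1 (eb (f ora x)) t" using 1[of x ora hs env] by auto
        have "eval ora (fs @ (gs0 @ gs1) @ hs) (ea x # env) (Cond e0 e1 e2) (eb (f ora x)) (s + t + 1)"
          using s t True by (intro eval_Cond_true[of ora _ _ e0 "tree_of_bool True"]) (auto simp: tree_of_bool_def)
        then show ?thesis using s t True by (intro exI[of _ "s + t + 1"]) simp
      next
        case False
        obtain t where t: "t \<le> poly q (size (ea x))"
          "eval ora (fs @ (gs0 @ gs1) @ hs) (ea x # env) e2 (eb (g ora x)) t" using 2[of x ora hs env] by auto
        have "eval ora (fs @ (gs0 @ gs1) @ hs) (ea x # env) (Cond e0 e1 e2) (eb (g ora x)) (s + t + 1)"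
          using s t False by (intro eval_Cond_false) (auto simp: tree_of_bool_def)
        then show ?thesis using s t False by (intro exI[of _ "s + t + 1"]) simp
      qed
    qed
    then show "\<exists>gs e. \<forall>hs ora x env. \<exists>t\<le>?T (size (ea x)). eval ora (fs @ gs @ hs) (ea x # env) e
          (eb (if b ora x then f ora x else g ora x)) t" by blast
  qed (intro poly_bounded_add poly_bounded_const poly_bounded_poly)
qed

lemma ptime_conj:
  assumes "ptime ea tree_of_bool f" "ptime ea tree_of_bool g"
  shows "ptime ea tree_of_bool (\<lambda>ora x. f ora x \<and> g ora x)"
  by (rule ptime_recode[OF ptime_if[OF assms(1) assms(2) ptime_const[where eb = tree_of_bool and c = False]]]) auto

lemma ptime_disj:
  assumes "ptime ea tree_of_bool f" "ptime ea tree_of_bool g"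
  shows "ptime ea tree_of_bool (\<lambda>ora x. f ora x \<or> g ora x)"
  by (rule ptime_recode[OF ptime_if[OF assms(1) ptime_const[where eb = tree_of_bool and c = True] assms(2)]]) auto

lemma ptime_not:
  assumes "ptime ea tree_of_bool f"
  shows "ptime ea tree_of_bool (\<lambda>ora x. \<not> f ora x)"
  by (rule ptime_recode[OF ptime_if[OF assms(1) ptime_const[where eb = tree_of_bool and c = False] ptime_const[where eb = tree_of_bool and c = True]]]) auto

lemma ptime_Cons:
  assumes "ptime ea eb f" "ptime ea (enc_list eb) g"
  shows "ptime ea (enc_list eb) (\<lambda>ora x. f ora x # g ora x)"
  by (rule ptime_recode[OF ptime_pair[OF assms]]) (auto simp: enc_pair_def)

section \<open>Recursion over lists\<close>

lemma size_enc_list: "size (enc_list e xs) = sum_list (map (\<lambda>x. size (e x) + 1) xs)"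
  by (induction xs) auto

lemma length_le_size_enc_list: "length xs \<le> size (enc_list e xs)"
  by (induction xs) auto

lemma size_le_size_enc_list: "x \<in> set xs \<Longrightarrow> size (e x) \<le> size (enc_list e xs)"
  by (induction xs) auto

lemma size_enc_list_le:
  "(\<And>x. x \<in> set xs \<Longrightarrow> size (e x) \<le> b) \<Longrightarrow> size (enc_list e xs) \<le> length xs * (b + 1)"
proof (induction xs)
  case (Cons x xs)
  then have "size (e x) \<le> b" "size (enc_list e xs) \<le> length xs * (b + 1)" by auto
  then show ?case by simp
qed simp

text \<open>A polynomial step does not suffice: it could square the accumulator in every round.
  Therefore \<open>bound\<close> controls the accumulator on every suffix \<open>ys\<close> of the
  list, by a polynomial in the size of the context alone.\<close>

lemma ptime_foldr:
  assumes xs: "ptime ea (enc_list eb) xs"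
    and init: "ptime ea ec init"
    and step: "ptime (enc_pair ea (enc_pair eb ec)) ec
      (\<lambda>ora z. step ora (fst z) (fst (snd z)) (snd (snd z)))"
    and bound: "\<And>ora c ys zs. xs ora c = zs @ ys \<Longrightarrow>
      size (ec (foldr (step ora c) ys (init ora c))) \<le> b (size (ea c))"
    and b: "poly_bounded b"
  shows "ptime ea ec (\<lambda>ora c. foldr (step ora c) (xs ora c) (init ora c))"
proof -
  obtain r where r: "\<And>n. b n \<le> poly r n" using poly_boundedE[OF b] by blast
  obtain q where q: "\<And>fs. \<exists>gs e. \<forall>hs ora c env. \<exists>t \<le> poly q (size (ea c)).
     eval ora (fs @ gs @ hs) (ea c # env) e (ec (init ora c)) t"
    using init unfolding ptime_def by blast
  obtain s where s: "\<And>fs. \<exists>gs e. \<forall>hs ora z env.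
     \<exists>t \<le> poly s (size (enc_pair ea (enc_pair eb ec) z)).
     eval ora (fs @ gs @ hs) (enc_pair ea (enc_pair eb ec) z # env) e
       (ec (step ora (fst z) (fst (snd z)) (snd (snd z)))) t"
    using step unfolding ptime_def by blast
  obtain l where l: "\<And>ora c. size (enc_list eb (xs ora c)) \<le> poly l (size (ea c))"
    using ptime_size[OF xs] by blast
  \<comment> \<open>\<open>w n\<close> bounds the size of an argument of \<open>step\<close>, \<open>k n\<close> the time of one iteration.\<close>
  define w where "w n = n + poly l n + poly r n + 2" for n
  define k where "k n = poly q n + poly s (w n) + 3 * w n + 40" for n
  define T where "T n = (poly l n + 1) * k n" for n
  have pw: "poly_bounded w" unfolding w_def
    by (intro poly_bounded_add poly_bounded_mult poly_bounded_const poly_bounded_id poly_bounded_poly)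
  have pk: "poly_bounded k" unfolding k_def
    by (intro poly_bounded_add poly_bounded_mult poly_bounded_comp pw poly_bounded_const poly_bounded_poly)
  have pT: "poly_bounded T" unfolding T_def
    by (intro poly_bounded_add poly_bounded_mult poly_bounded_const pk poly_bounded_poly)
  \<comment> \<open>The value on a remaining list; the compiled function receives context and
    remaining list as one pair.\<close>
  define F where "F ora z = foldr (step ora (fst z)) (snd z) (init ora (fst z))" for ora z
  have main: "\<exists>f gs. \<forall>hs ora c ys zs. xs ora c = zs @ ys \<longrightarrow> (\<exists>t \<le> (length ys + 1) * k (size (ea c)).
     f < length (fs @ gs @ hs) \<and>
     eval ora (fs @ gs @ hs) [enc_pair ea (enc_list eb) (c, ys)] ((fs @ gs @ hs) ! f)
       (ec (F ora (c, ys))) t)" for fs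
  proof -
    obtain gs1 e1 where e1: "\<And>hs ora c env. \<exists>t \<le> poly q (size (ea c)).
       eval ora (fs @ gs1 @ hs) (ea c # env) e1 (ec (init ora c)) t"
      using q[of fs] by blast
    obtain gs2 e2 where e2: "\<And>hs ora z env. \<exists>t \<le> poly s (size (enc_pair ea (enc_pair eb ec) z)).
       eval ora (fs @ gs1 @ gs2 @ hs) (enc_pair ea (enc_pair eb ec) z # env) e2
       (ec (step ora (fst z) (fst (snd z)) (snd (snd z)))) t"
      using s[of "fs @ gs1"] unfolding append_assoc by blast
    \<comment> \<open>The new function is placed right after the tables of \<open>init\<close> and
      \<open>step\<close>, so this is its own index, used in the recursive call.\<close>
    let ?f = "length (fs @ gs1 @ gs2)"
    let ?arg = "Pair (First (Var 0)) (Second (Second (Var 0)))"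
    let ?stp = "LetIn (Pair (First (Var 0)) (Pair (First (Second (Var 0))) (Call ?f ?arg))) e2"
    let ?body = "Cond (Second (Var 0)) ?stp (LetIn (First (Var 0)) e1)"
    let ?gs = "gs1 @ gs2 @ [?body]"
    have "\<exists>t \<le> (length ys + 1) * k (size (ea c)).
       eval ora (fs @ ?gs @ hs) [enc_pair ea (enc_list eb) (c, ys)] ?body (ec (F ora (c, ys))) t"
      if "xs ora c = zs @ ys" for hs ora c ys zs
      using that
    proof (induction ys arbitrary: zs)
      case Nil
      let ?env = "[Node (ea c) Leaf]"
      have v: "eval ora (fs @ ?gs @ hs) ?env (Var 0) (Node (ea c) Leaf) 1"
        using eval_Var[of 0 ?env] by simp
      obtain t where t: "t \<le> poly q (size (ea c))"
        "eval ora (fs @ ?gs @ hs) (ea c # ?env) e1 (ec (init ora c)) t"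
        using e1[of c ora "gs2 @ [?body] @ hs" ?env] by auto
      have "eval ora (fs @ ?gs @ hs) ?env ?body (ec (init ora c)) ((1 + 1) + ((1 + 1) + t + 1) + 1)"
        using eval_First[OF v] eval_Second[OF v] t(2)
        by (intro eval_Cond_false eval_LetIn) simp_all
      then show ?case using t(1)
        by (intro exI[of _ "(1 + 1) + ((1 + 1) + t + 1) + 1"]) (simp add: k_def F_def enc_pair_def)
    next
      case (Cons y ys)
      let ?C = "ea c" and ?A = "ec (F ora (c, ys))"
      let ?n = "size ?C"
      let ?z = "Node ?C (Node (eb y) (enc_list eb ys))"
      let ?G = "fs @ ?gs @ hs"
      let ?a = "Node ?C (enc_list eb ys)"
      have v: "eval ora ?G [?z] (Var 0) ?z 1" using eval_Var[of 0 "[?z]"] by simp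
      obtain t where t: "t \<le> (length ys + 1) * k ?n"
        "eval ora ?G [?a] ?body ?A t"
        using Cons.IH[of "zs @ [y]"] Cons.prems by (auto simp: enc_pair_def)
      let ?z2 = "(c, (y, F ora (c, ys)))"
      let ?z2e = "Node ?C (Node (eb y) ?A)"
      have z2e: "enc_pair ea (enc_pair eb ec) ?z2 = ?z2e" by (simp add: enc_pair_def)
      obtain u where u: "u \<le> poly s (size ?z2e)"
        "eval ora ?G (?z2e # [?z]) e2 (ec (step ora c y (F ora (c, ys)))) u"
        using e2[of ?z2 ora "[?body] @ hs" "[?z]"] z2e by auto
      have sA: "size ?A \<le> poly r ?n"
        using bound[of ora c "zs @ [y]" ys] Cons.prems r[of ?n] by (simp add: F_def)
      have ly: "size (enc_list eb (y # ys)) \<le> poly l ?n"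
        using l[of ora c] Cons.prems by (simp add: size_enc_list)
      have sz: "size ?z2e \<le> w ?n" "size ?a \<le> w ?n" "size (Node (eb y) ?A) \<le> w ?n"
        using sA ly by (simp_all add: w_def)
      have u': "u \<le> poly s (w ?n)" using u(1) sz(1) poly_nat_mono le_trans by blast
      have f: "?f < length ?G" "?G ! ?f = ?body" by (simp_all add: nth_append)
      let ?t1 = "1 + 1 + (1 + 1 + 1) + size ?a"
      have arg: "eval ora ?G [?z] ?arg ?a ?t1"
        using eval_Pair[OF eval_First[OF v] eval_Second[OF eval_Second[OF v]]] by simp
      have call: "eval ora ?G [?z] (Call ?f ?arg) ?A (?t1 + t + 1)"
        by (rule eval_Call[OF f(1) arg]) (use t(2) f(2) in simp)
      let ?t2 = "1 + 1 + (1 + 1 + 1 + (?t1 + t + 1) + size (Node (eb y) ?A)) + size ?z2e"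
      have p2: "eval ora ?G [?z] (Pair (First (Var 0)) (Pair (First (Second (Var 0))) (Call ?f ?arg))) ?z2e ?t2"
        using eval_Pair[OF eval_First[OF v] eval_Pair[OF eval_First[OF eval_Second[OF v]] call]] by simp
      have "eval ora ?G [?z] ?body (ec (step ora c y (F ora (c, ys)))) (1 + 1 + (?t2 + u + 1) + 1)"
        by (rule eval_Cond_true[OF eval_Second[OF v] _ eval_LetIn[OF p2 u(2)]]) simp
      moreover have "1 + 1 + (?t2 + u + 1) + 1 \<le> (length (y # ys) + 1) * k ?n"
        using t(1) u' sz by (simp add: k_def)
      ultimately show ?case
        unfolding F_def enc_pair_def fst_conv snd_conv foldr.simps comp_apply enc_list_simps by blast
    qed
    then show ?thesis
      by (intro exI[of _ ?f] exI[of _ ?gs]) (simp add: nth_append)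
  qed
  obtain px where px: "\<And>fs. \<exists>gs e. \<forall>hs ora c env. \<exists>t \<le> poly px (size (ea c)).
     eval ora (fs @ gs @ hs) (ea c # env) e (enc_list eb (xs ora c)) t"
    using xs unfolding ptime_def by blast
  define U where "U n = poly px n + T n + n + poly l n + 10" for n
  show ?thesis
  proof (rule ptimeI[of U])
    show "poly_bounded U" unfolding U_def
      by (intro poly_bounded_add pT poly_bounded_id poly_bounded_const poly_bounded_poly)
    fix fs
    obtain f gs1 where 1: "\<And>hs ora c ys zs. xs ora c = zs @ ys \<Longrightarrow>
      (\<exists>t \<le> (length ys + 1) * k (size (ea c)). f < length (fs @ gs1 @ hs) \<and>
       eval ora (fs @ gs1 @ hs) [enc_pair ea (enc_list eb) (c, ys)] ((fs @ gs1 @ hs) ! f)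
         (ec (F ora (c, ys))) t)"
      using main[of fs] by blast
    obtain gs2 e where 2: "\<And>hs ora c env. \<exists>t \<le> poly px (size (ea c)).
      eval ora (fs @ gs1 @ gs2 @ hs) (ea c # env) e (enc_list eb (xs ora c)) t"
      using px[of "fs @ gs1"] unfolding append_assoc by blast
    have "\<exists>t\<le>U (size (ea c)). eval ora (fs @ (gs1 @ gs2) @ hs) (ea c # env)
        (Call f (Pair (Var 0) e)) (ec (foldr (step ora c) (xs ora c) (init ora c))) t"
      for hs ora c env
    proof -
      let ?G = "fs @ (gs1 @ gs2) @ hs"
      let ?a = "enc_pair ea (enc_list eb) (c, xs ora c)"
      obtain t where t: "t \<le> (length (xs ora c) + 1) * k (size (ea c))" "f < length ?G"
        "eval ora ?G [?a] (?G ! f) (ec (F ora (c, xs ora c))) t"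
        using 1[of ora c "[]" "xs ora c" "gs2 @ hs"] by auto
      obtain u where u: "u \<le> poly px (size (ea c))"
        "eval ora ?G (ea c # env) e (enc_list eb (xs ora c)) u"
        using 2[where ora = ora and c = c and hs = hs and env = env] by auto
      have v: "eval ora ?G (ea c # env) (Var 0) (ea c) 1" using eval_Var[of 0 "ea c # env"] by simp
      have arg: "eval ora ?G (ea c # env) (Pair (Var 0) e) ?a (1 + u + size ?a)"
        using eval_Pair[OF v u(2)] by (simp add: enc_pair_def)
      have "length (xs ora c) \<le> poly l (size (ea c))"
        using l[of ora c] length_le_size_enc_list le_trans by blast
      then have "t \<le> T (size (ea c))" using t(1) unfolding T_def
        by (meson add_le_mono1 le_trans mult_le_mono1)
      moreover have "size ?a \<le> size (ea c) + poly l (size (ea c)) + 1"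
        using l[of ora c] by (simp add: enc_pair_def)
      ultimately show ?thesis using u(1) eval_Call[OF t(2) arg t(3)]
        by (intro exI[of _ "1 + u + size ?a + t + 1"]) (simp add: U_def F_def)
    qed
    then show "\<exists>gs e. \<forall>hs ora c env. \<exists>t\<le>U (size (ea c)). eval ora (fs @ gs @ hs) (ea c # env)
        e (ec (foldr (step ora c) (xs ora c) (init ora c))) t" by blast
  qed
qed

lemma ptime_map:
  assumes xs: "ptime ea (enc_list eb) xs"
    and f: "ptime (enc_pair ea eb) ec (\<lambda>ora z. f ora (fst z) (snd z))"
  shows "ptime ea (enc_list ec) (\<lambda>ora c. map (f ora c) (xs ora c))"
proof -
  obtain l where l: "\<And>ora c. size (enc_list eb (xs ora c)) \<le> poly l (size (ea c))"
    using ptime_size[OF xs] by blast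
  obtain r where r: "\<And>ora z. size (ec (f ora (fst z) (snd z))) \<le> poly r (size (enc_pair ea eb z))"
    using ptime_size[OF f] by blast
  let ?ez = "enc_pair ea (enc_pair eb (enc_list ec))"
  have arg: "ptime ?ez (enc_pair ea eb) (\<lambda>ora z. (fst z, fst (snd z)))"
    by (rule ptime_pair ptime_fst ptime_snd ptime_id)+
  have "ptime ?ez ec (\<lambda>ora z. f ora (fst z) (fst (snd z)))"
    using ptime_comp[OF f arg] by simp
  then have step: "ptime ?ez (enc_list ec) (\<lambda>ora z. f ora (fst z) (fst (snd z)) # snd (snd z))"
    by (rule ptime_Cons) (rule ptime_snd ptime_id)+
  let ?b = "\<lambda>n. poly l n * (poly r (n + poly l n + 1) + 1)"
  have cons: "foldr (\<lambda>x acc. h x # acc) ys [] = map h ys" for h :: "'b \<Rightarrow> 'c" and ys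
    by (induction ys) auto
  have "ptime ea (enc_list ec)
    (\<lambda>ora c. foldr (\<lambda>x acc. f ora c x # acc) (xs ora c) [])"
  proof (rule ptime_foldr[OF xs ptime_const step, where b = ?b])
    fix ora c ys zs assume *: "xs ora c = zs @ ys"
    have lx: "length ys \<le> poly l (size (ea c))"
      using * l[of ora c] length_le_size_enc_list[of "xs ora c" eb] by simp
    have "size (ec (f ora c y)) \<le> poly r (size (ea c) + poly l (size (ea c)) + 1)" if "y \<in> set ys" for y
    proof -
      have "size (eb y) \<le> poly l (size (ea c))"
        using that * l[of ora c] size_le_size_enc_list[of y "xs ora c" eb] by simp
      then have "size (enc_pair ea eb (c, y)) \<le> size (ea c) + poly l (size (ea c)) + 1"
        by (simp add: enc_pair_def)
      from poly_nat_mono[OF this, of r] r[of ora "(c, y)"] show ?thesis by simp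
    qed
    then have "size (enc_list ec (map (f ora c) ys))
        \<le> length ys * (poly r (size (ea c) + poly l (size (ea c)) + 1) + 1)"
      using size_enc_list_le[of "map (f ora c) ys" ec] by auto
    also have "\<dots> \<le> ?b (size (ea c))" using lx by (intro mult_le_mono) auto
    finally show "size (enc_list ec (foldr (\<lambda>x acc. f ora c x # acc) ys [])) \<le> ?b (size (ea c))"
      by (simp add: cons)
  qed (intro poly_bounded_mult poly_bounded_comp poly_bounded_add poly_bounded_const poly_bounded_id poly_bounded_poly)
  then show ?thesis by (simp add: cons)
qed

lemma ptime_append:
  assumes f: "ptime ea (enc_list eb) f" and g: "ptime ea (enc_list eb) g"
  shows "ptime ea (enc_list eb) (\<lambda>ora x. f ora x @ g ora x)"
proof -
  obtain l where l: "\<And>ora c. size (enc_list eb (f ora c)) \<le> poly l (size (ea c))"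
    using ptime_size[OF f] by blast
  obtain r where r: "\<And>ora c. size (enc_list eb (g ora c)) \<le> poly r (size (ea c))"
    using ptime_size[OF g] by blast
  have *: "foldr (#) ys zs = ys @ zs" for ys zs :: "'b list" by (induction ys) auto
  have "ptime ea (enc_list eb) (\<lambda>ora c. foldr (\<lambda>x acc. x # acc) (f ora c) (g ora c))"
  proof (rule ptime_foldr[OF f g, where b = "\<lambda>n. poly l n + poly r n"])
    show "ptime (enc_pair ea (enc_pair eb (enc_list eb))) (enc_list eb)
       (\<lambda>ora z. fst (snd z) # snd (snd z))"
      by (rule ptime_Cons ptime_fst ptime_snd ptime_id)+
    fix ora c ys zs assume "f ora c = zs @ ys"
    then show "size (enc_list eb (foldr (#) ys (g ora c))) \<le> poly l (size (ea c)) + poly r (size (ea c))"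
      using l[of ora c] r[of ora c] by (simp add: * size_enc_list)
  qed (intro poly_bounded_add poly_bounded_poly)
  then show ?thesis by (simp add: *)
qed

lemma ptime_concat:
  assumes f: "ptime ea (enc_list (enc_list eb)) f"
  shows "ptime ea (enc_list eb) (\<lambda>ora x. concat (f ora x))"
proof -
  obtain l where l: "\<And>ora c. size (enc_list (enc_list eb) (f ora c)) \<le> poly l (size (ea c))"
    using ptime_size[OF f] by blast
  have sz: "size (enc_list eb (concat ys)) \<le> size (enc_list (enc_list eb) ys)" for ys
    by (induction ys) (auto simp: size_enc_list)
  have "ptime ea (enc_list eb) (\<lambda>ora c. foldr (\<lambda>x acc. x @ acc) (f ora c) [])"
  proof (rule ptime_foldr[OF f ptime_const, where b = "poly l"])
    show "ptime (enc_pair ea (enc_pair (enc_list eb) (enc_list eb))) (enc_list eb)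
       (\<lambda>ora z. fst (snd z) @ snd (snd z))"
      by (rule ptime_append ptime_fst ptime_snd ptime_id)+
    fix ora c ys zs assume "f ora c = zs @ ys"
    then show "size (enc_list eb (foldr (@) ys [])) \<le> poly l (size (ea c))"
      using l[of ora c] sz[of ys] by (simp add: size_enc_list concat_conv_foldr[symmetric])
  qed auto
  then show ?thesis by (simp add: concat_conv_foldr)
qed

lemma size_tree_of_bool: "size (tree_of_bool b) \<le> 1"
  by (simp add: tree_of_bool_def)

lemma ptime_Ball:
  assumes xs: "ptime ea (enc_list eb) xs"
    and P: "ptime (enc_pair ea eb) tree_of_bool (\<lambda>ora z. P ora (fst z) (snd z))"
  shows "ptime ea tree_of_bool (\<lambda>ora c. \<forall>x\<in>set (xs ora c). P ora c x)"
proof -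
  let ?ez = "enc_pair ea (enc_pair eb tree_of_bool)"
  have arg: "ptime ?ez (enc_pair ea eb) (\<lambda>ora z. (fst z, fst (snd z)))"
    by (rule ptime_pair ptime_fst ptime_snd ptime_id)+
  have "ptime ?ez tree_of_bool (\<lambda>ora z. P ora (fst z) (fst (snd z)))"
    using ptime_comp[OF P arg] by simp
  then have step: "ptime ?ez tree_of_bool (\<lambda>ora z. P ora (fst z) (fst (snd z)) \<and> snd (snd z))"
    by (rule ptime_conj) (rule ptime_snd ptime_id)+
  have *: "foldr (\<lambda>x acc. Q x \<and> acc) ys True \<longleftrightarrow> (\<forall>x\<in>set ys. Q x)" for Q and ys :: "'b list"
    by (induction ys) auto
  have "ptime ea tree_of_bool (\<lambda>ora c. foldr (\<lambda>x acc. P ora c x \<and> acc) (xs ora c) True)"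
    by (rule ptime_foldr[OF xs ptime_const step, where b = "\<lambda>_. 1"])
      (rule size_tree_of_bool poly_bounded_const)+
  then show ?thesis by (simp add: *)
qed

lemma ptime_Bex:
  assumes xs: "ptime ea (enc_list eb) xs"
    and P: "ptime (enc_pair ea eb) tree_of_bool (\<lambda>ora z. P ora (fst z) (snd z))"
  shows "ptime ea tree_of_bool (\<lambda>ora c. \<exists>x\<in>set (xs ora c). P ora c x)"
  using ptime_not[OF ptime_Ball[OF xs ptime_not[OF P]]] by simp

lemma ptime_filter:
  assumes xs: "ptime ea (enc_list eb) xs"
    and P: "ptime (enc_pair ea eb) tree_of_bool (\<lambda>ora z. P ora (fst z) (snd z))"
  shows "ptime ea (enc_list eb) (\<lambda>ora c. filter (P ora c) (xs ora c))"
proof -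
  have m: "ptime ea (enc_list (enc_list eb))
      (\<lambda>ora c. map (\<lambda>x. if P ora c x then [x] else []) (xs ora c))"
    by (rule ptime_map[OF xs], rule ptime_if[OF P], rule ptime_Cons)
      (rule ptime_snd ptime_id ptime_const)+
  have "concat (map (\<lambda>x. if Q x then [x] else []) ys) = filter Q ys" for Q and ys :: "'b list"
    by (induction ys) auto
  then show ?thesis using ptime_concat[OF m] by simp
qed

text \<open>The language has no comparison, so a recursive function walks through both trees. Every
  call pays for building a pair of subtrees, which makes the bound quadratic; the summand 30 leaves
  room for the constant costs per node.\<close>

lemma ptime_tree_eq: "ptime (enc_pair id id) tree_of_bool (\<lambda>ora z. fst z = snd z)"
proof (rule ptimeI[of "\<lambda>n. n * (n + 30) + 30"])
  fix fs :: "expr list"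
  let ?f = "length fs"
  let ?l = "First (Var 0)" and ?r = "Second (Var 0)" and ?tt = "Pair Empty Empty"
  let ?e = "Cond ?l (Cond ?r (Cond (Call ?f (Pair (First ?l) (First ?r)))
    (Call ?f (Pair (Second ?l) (Second ?r))) Empty) Empty) (Cond ?r Empty ?tt)"
  have bnd: "31 \<le> size (Node a b) * (size (Node a b) + 30)" for a b :: tree
    using mult_le_mono[of 1 "size (Node a b)" 31 "size (Node a b) + 30"] by simp
  have main: "\<exists>t \<le> size (Node a b) * (size (Node a b) + 30) .
      eval ora (fs @ [?e] @ hs) (Node a b # env) ?e (tree_of_bool (a = b)) t" for a b ora hs env
  proof (induction a arbitrary: b env)
    case Leaf
    let ?G = "fs @ [?e] @ hs"
    have v: "eval ora ?G (Node Leaf b # env) (Var 0) (Node Leaf b) 1"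
      using eval_Var[of 0 "Node Leaf b # env"] by simp
    have l: "eval ora ?G (Node Leaf b # env) ?l Leaf (1 + 1)"
      and r: "eval ora ?G (Node Leaf b # env) ?r b (1 + 1)"
      using eval_First[OF v] eval_Second[OF v] by simp_all
    show ?case
    proof (cases b)
      case Leaf
      then have "eval ora ?G (Node Leaf b # env) ?e (Node Leaf Leaf)
          ((1 + 1) + ((1 + 1) + (1 + 1 + size (Node Leaf Leaf)) + 1) + 1)" (is "eval _ _ _ _ _ ?t")
        using l r by (intro eval_Cond_false eval_Pair eval_Empty) auto
      moreover have "?t \<le> size (Node Leaf b) * (size (Node Leaf b) + 30)"
        by (rule le_trans[OF _ bnd]) simp
      moreover have "tree_of_bool (Leaf = b) = Node Leaf Leaf" using Leaf by (simp add: tree_of_bool_def)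
      ultimately show ?thesis by metis
    next
      case (Node b1 b2)
      then have "eval ora ?G (Node Leaf b # env) ?e Leaf
          ((1 + 1) + ((1 + 1) + 1 + 1) + 1)" (is "eval _ _ _ _ _ ?t")
        using l r by (intro eval_Cond_false[OF l] eval_Cond_true[OF r] eval_Empty) auto
      moreover have "?t \<le> size (Node Leaf b) * (size (Node Leaf b) + 30)"
        by (rule le_trans[OF _ bnd]) simp
      moreover have "tree_of_bool (Leaf = b) = Leaf" using Node by (simp add: tree_of_bool_def)
      ultimately show ?thesis by metis
    qed
  next
    case (Node a1 a2)
    let ?G = "fs @ [?e] @ hs"
    let ?v = "Node (Node a1 a2) b"
    have v: "eval ora ?G (?v # env) (Var 0) ?v 1"
      using eval_Var[of 0 "?v # env"] by simp
    have l: "eval ora ?G (?v # env) ?l (Node a1 a2) (1 + 1)"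
      and r: "eval ora ?G (?v # env) ?r b (1 + 1)"
      using eval_First[OF v] eval_Second[OF v] by simp_all
    show ?case
    proof (cases b)
      case Leaf
      then have "eval ora ?G (?v # env) ?e Leaf
          ((1 + 1) + ((1 + 1) + 1 + 1) + 1)" (is "eval _ _ _ _ _ ?t")
        using r by (intro eval_Cond_true[OF l] eval_Cond_false eval_Empty) auto
      moreover have "?t \<le> size ?v * (size ?v + 30)"
        by (rule le_trans[OF _ bnd]) simp
      moreover have "tree_of_bool (Node a1 a2 = b) = Leaf" using Leaf by (simp add: tree_of_bool_def)
      ultimately show ?thesis by metis
    next
      case b: (Node b1 b2)
      let ?s1 = "size (Node a1 b1)" and ?s2 = "size (Node a2 b2)"
      obtain t1 where t1: "t1 \<le> ?s1 * (?s1 + 30) "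
        "eval ora ?G [Node a1 b1] ?e (tree_of_bool (a1 = b1)) t1" using Node.IH(1)[of b1 "[]"] by blast
      obtain t2 where t2: "t2 \<le> ?s2 * (?s2 + 30) "
        "eval ora ?G [Node a2 b2] ?e (tree_of_bool (a2 = b2)) t2" using Node.IH(2)[of b2 "[]"] by blast
      have f: "?f < length ?G" "?G ! ?f = ?e" by (simp_all add: nth_append)
      let ?c1 = "1 + 1 + 1 + (1 + 1 + 1) + ?s1 + t1 + 1" and ?c2 = "1 + 1 + 1 + (1 + 1 + 1) + ?s2 + t2 + 1"
      have c1: "eval ora ?G (?v # env) (Call ?f (Pair (First ?l) (First ?r))) (tree_of_bool (a1 = b1)) ?c1"
        by (rule eval_Call[OF f(1)])
          (use eval_Pair[OF eval_First[OF l] eval_First[OF r]] b t1(2) f(2) in simp_all)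
      have c2: "eval ora ?G (?v # env) (Call ?f (Pair (Second ?l) (Second ?r))) (tree_of_bool (a2 = b2)) ?c2"
        by (rule eval_Call[OF f(1)])
          (use eval_Pair[OF eval_Second[OF l] eval_Second[OF r]] b t2(2) f(2) in simp_all)
      have bn: "b \<noteq> Leaf" using b by simp
      have "\<exists>t \<le> ?c1 + ?c2 + 1. eval ora ?G (?v # env)
        (Cond (Call ?f (Pair (First ?l) (First ?r)))
    (Call ?f (Pair (Second ?l) (Second ?r))) Empty) (tree_of_bool (Node a1 a2 = b)) t"
      proof (cases "a1 = b1")
        case True
        then have "eval ora ?G (?v # env) (Cond (Call ?f (Pair (First ?l) (First ?r)))
    (Call ?f (Pair (Second ?l) (Second ?r))) Empty) (tree_of_bool (a2 = b2)) (?c1 + ?c2 + 1)"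
          by (intro eval_Cond_true[OF c1 _ c2]) (simp add: tree_of_bool_def)
        then show ?thesis using True b by auto
      next
        case False
        then have "eval ora ?G (?v # env) (Cond (Call ?f (Pair (First ?l) (First ?r)))
    (Call ?f (Pair (Second ?l) (Second ?r))) Empty) Leaf (?c1 + 1 + 1)"
          using c1 by (intro eval_Cond_false eval_Empty) (simp add: tree_of_bool_def)
        then show ?thesis using False b by (intro exI[of _ "?c1 + 1 + 1"]) (auto simp: tree_of_bool_def)
      qed
      then obtain t where t: "t \<le> ?c1 + ?c2 + 1" "eval ora ?G (?v # env)
        (Cond (Call ?f (Pair (First ?l) (First ?r)))
    (Call ?f (Pair (Second ?l) (Second ?r))) Empty) (tree_of_bool (Node a1 a2 = b)) t" by blast
      have "eval ora ?G (?v # env) ?e (tree_of_bool (Node a1 a2 = b)) ((1 + 1) + ((1 + 1) + t + 1) + 1)"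
        by (rule eval_Cond_true[OF l _ eval_Cond_true[OF r bn t(2)]]) simp
      moreover have "(1 + 1) + ((1 + 1) + t + 1) + 1 \<le> size ?v * (size ?v + 30) "
      proof -
        have s: "size ?v = ?s1 + ?s2 + 1" using b by simp
        have "(1 + 1) + ((1 + 1) + t + 1) + 1 \<le> ?s1 * (?s1 + 30) + ?s2 * (?s2 + 30) + ?s1 + ?s2 + 21"
          using t(1) t1(1) t2(1) by linarith
        also have "\<dots> \<le> (?s1 + ?s2 + 1) * ((?s1 + ?s2 + 1) + 30) "
          by (simp add: algebra_simps)
        finally show ?thesis unfolding s .
      qed
      ultimately show ?thesis by blast
    qed
  qed
  have "\<exists>t\<le>size (enc_pair id id z) * (size (enc_pair id id z) + 30) + 30.
     eval ora (fs @ [?e] @ hs) (enc_pair id id z # env) ?e (tree_of_bool (fst z = snd z)) t"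
    for hs ora z env
  proof -
    obtain t where "t \<le> size (enc_pair id id z) * (size (enc_pair id id z) + 30) "
      "eval ora (fs @ [?e] @ hs) (enc_pair id id z # env) ?e (tree_of_bool (fst z = snd z)) t"
      using main[of "fst z" "snd z" ora hs env] unfolding enc_pair_def id_apply by blast
    then show ?thesis by (intro exI[of _ t]) linarith
  qed
  then show "\<exists>gs e. \<forall>hs ora z env. \<exists>t\<le>size (enc_pair id id z) * (size (enc_pair id id z) + 30) + 30.
     eval ora (fs @ gs @ hs) (enc_pair id id z # env) e (tree_of_bool (fst z = snd z)) t"
    by blast
qed (intro poly_bounded_mult poly_bounded_add poly_bounded_const poly_bounded_id)

lemma ptime_eq:
  assumes f: "ptime ea eb f" and g: "ptime ea eb g" and inj: "inj eb"
  shows "ptime ea tree_of_bool (\<lambda>ora x. f ora x = g ora x)"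
proof -
  have "ptime ea (enc_pair id id) (\<lambda>ora x. (eb (f ora x), eb (g ora x)))"
    by (rule ptime_recode[OF ptime_pair[OF f g]]) (simp add: enc_pair_def)
  from ptime_comp[OF ptime_tree_eq this] show ?thesis using inj by (simp add: inj_eq)
qed


section \<open>Critical structures\<close>

definition map_fact :: "('a \<Rightarrow> 'b) \<Rightarrow> 'a fact \<Rightarrow> 'b fact" where
  "map_fact h f = (fst f, map h (snd f))"

definition elems :: "'a fact set \<Rightarrow> 'a set" where
  "elems F = (\<Union>f\<in>F. set (snd f))"

text \<open>A pair \<open>(a, F)\<close> stands for the structure with facts \<open>F\<close>, distinguished tuple \<open>a\<close>
  and no further elements.\<close>

definition phom :: "('a \<Rightarrow> 'b) \<Rightarrow> 'a list \<times> 'a fact set \<Rightarrow> 'b list \<times> 'b fact set \<Rightarrow> bool" where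
  "phom h A B \<longleftrightarrow> map h (fst A) = fst B \<and> map_fact h ` snd A \<subseteq> snd B"

definition maps_to :: "'a list \<times> 'a fact set \<Rightarrow> 'b list \<times> 'b fact set \<Rightarrow> bool" where
  "maps_to A B \<longleftrightarrow> (\<exists>h. phom h A B)"

text \<open>Deleting single facts is enough: homomorphisms survive the addition of facts, so no
  proper subset of the facts receives \<open>Q\<close> either. This makes criticality reachable by
  greedy deletion with the oracle.\<close>

definition critical :: "'b list \<times> 'b fact set \<Rightarrow> 'a list \<times> 'a fact set \<Rightarrow> bool" where
  "critical Q A \<longleftrightarrow> maps_to Q A \<and> (\<forall>f\<in>snd A. \<not> maps_to Q (fst A, snd A - {f}))"

lemma map_fact_simps [simp]:
  "fst (map_fact h f) = fst f" "snd (map_fact h f) = map h (snd f)"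
  by (simp_all add: map_fact_def)

lemma map_fact_comp: "map_fact g (map_fact h f) = map_fact (g \<circ> h) f"
  by (simp add: map_fact_def)

lemma map_fact_idI: "(\<And>u. u \<in> set (snd f) \<Longrightarrow> h u = u) \<Longrightarrow> map_fact h f = f"
  by (simp add: map_fact_def map_idI)

lemma elems_image: "elems (map_fact h ` F) = h ` elems F"
  by (auto simp: elems_def)

lemma elemsI: "f \<in> F \<Longrightarrow> u \<in> set (snd f) \<Longrightarrow> u \<in> elems F"
  by (auto simp: elems_def)

lemma finite_elems: "finite F \<Longrightarrow> finite (elems F)"
  by (auto simp: elems_def)

lemma map_fact_inv_into:
  assumes "inj_on e (elems F)" "f \<in> F"
  shows "map_fact (inv_into (elems F) e) (map_fact e f) = f"
  unfolding map_fact_comp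
  by (rule map_fact_idI) (simp only: comp_apply inv_into_f_f[OF assms(1) elemsI[OF assms(2)]])

lemma phom_comp: "phom h A B \<Longrightarrow> phom g B C \<Longrightarrow> phom (g \<circ> h) A C"
  by (force simp: phom_def map_fact_comp[symmetric] simp flip: map_map)

lemma maps_to_trans: "maps_to A B \<Longrightarrow> maps_to B C \<Longrightarrow> maps_to A C"
  unfolding maps_to_def using phom_comp by blast

text \<open>A fact outside the image could be removed without disturbing \<open>h\<close>.\<close>

lemma critical_image:
  assumes "critical Q A" "phom h Q A" shows "map_fact h ` snd Q = snd A"
proof (rule ccontr)
  assume "map_fact h ` snd Q \<noteq> snd A"
  then obtain f where "f \<in> snd A" "f \<notin> map_fact h ` snd Q" using assms(2) by (auto simp: phom_def)
  then have "phom h Q (fst A, snd A - {f})" using assms(2) by (auto simp: phom_def)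
  then show False using \<open>f \<in> snd A\<close> assms(1) by (auto simp: critical_def maps_to_def)
qed

text \<open>Occurrences of answer variables are carried along by any homomorphism from
  \<open>Q\<close>; the learned structure must have them to be a CQ.\<close>

lemma critical_head_elems:
  assumes "critical Q A" "set (fst Q) \<subseteq> elems (snd Q)"
  shows "set (fst A) \<subseteq> elems (snd A)"
proof -
  obtain h where h: "phom h Q A" using assms(1) by (auto simp: critical_def maps_to_def)
  have "set (fst A) = h ` set (fst Q)" using h unfolding phom_def by (metis set_map)
  then show ?thesis using critical_image[OF assms(1) h] assms(2) elems_image[of h "snd Q"] by auto
qed

text \<open>An endomorphism of a critical structure is an automorphism, so it can be undone.\<close>

lemma critical_section:
  assumes A: "critical Q A" "finite (snd A)" "set (fst A) \<subseteq> elems (snd A)"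
    and s: "phom s A B" and p: "phom p B A"
  obtains s' where "phom s' A B" "\<And>u. u \<in> elems (snd A) \<Longrightarrow> p (s' u) = u"
proof -
  let ?e = "p \<circ> s"
  let ?i = "inv_into (elems (snd A)) ?e"
  have e: "phom ?e A A" using s p by (rule phom_comp)
  obtain h where h: "phom h Q A" using A(1) by (auto simp: critical_def maps_to_def)
  \<comment> \<open>Composing \<open>?e\<close> with \<open>h\<close> gives another homomorphism
    from \<open>Q\<close> to \<open>A\<close>, which is again onto the facts.\<close>
  have F: "map_fact ?e ` snd A = snd A"
    using critical_image[OF A(1) phom_comp[OF h e]]
    unfolding critical_image[OF A(1) h, symmetric] image_image map_fact_comp .
  then have sur: "?e ` elems (snd A) = elems (snd A)" using elems_image by metis
  then have inj: "inj_on ?e (elems (snd A))"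
    using finite_elems[OF A(2)] by (simp add: eq_card_imp_inj_on)
  have i1: "?i (?e u) = u" if "u \<in> elems (snd A)" for u using inj that by (rule inv_into_f_f)
  have i2: "?e (?i u) = u" if "u \<in> elems (snd A)" for u
    using sur that f_inv_into_f by metis
  have "phom ?i A A"
    unfolding phom_def
  proof (intro conjI subsetI)
    have "?i u = u" if "u \<in> set (fst A)" for u
    proof -
      have "map ?e (fst A) = map id (fst A)" using e by (simp add: phom_def)
      then have "?e u = u" using that unfolding map_eq_conv by auto
      then show ?thesis using i1 that A(3) by (metis subsetD)
    qed
    then show "map ?i (fst A) = fst A" by (simp add: map_idI)
    fix f assume "f \<in> map_fact ?i ` snd A"
    then obtain g where "g \<in> snd A" "f = map_fact ?i g" by blast
    moreover obtain g' where g': "g' \<in> snd A" "g = map_fact ?e g'"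
      using F \<open>g \<in> snd A\<close> by blast
    moreover have "map_fact ?i (map_fact ?e g') = g'"
      using inj g'(1) by (rule map_fact_inv_into)
    ultimately show "f \<in> snd A" by simp
  qed
  then have "phom (s \<circ> ?i) A B" using s by (rule phom_comp)
  then show ?thesis using that i2 by fastforce
qed

text \<open>\<open>p\<close> is onto, because \<open>Q\<close> covers the facts of \<open>A\<close>
  by way of \<open>B\<close>. If it were injective on elements as well, its inverse would be a
  homomorphism from \<open>A\<close> to \<open>B\<close>. So \<open>p\<close> identifies two
  elements.\<close>

lemma critical_card_elems_less:
  assumes A: "critical Q A" "finite (snd A)" "set (fst A) \<subseteq> elems (snd A)"
    and B: "critical Q B" "finite (snd B)" "set (fst B) \<subseteq> elems (snd B)"
    and p: "phom p B A" and AB: "\<not> maps_to A B"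
  shows "card (elems (snd A)) < card (elems (snd B))"
proof -
  obtain h where h: "phom h Q B" using B(1) by (auto simp: critical_def maps_to_def)
  have hF: "map_fact h ` snd Q = snd B" using B(1) h by (rule critical_image)
  have F: "map_fact p ` snd B = snd A"
    using critical_image[OF A(1) phom_comp[OF h p]] unfolding hF[symmetric] image_image map_fact_comp .
  then have sur: "p ` elems (snd B) = elems (snd A)" using elems_image by metis
  have "\<not> inj_on p (elems (snd B))"
  proof
    assume inj: "inj_on p (elems (snd B))"
    let ?i = "inv_into (elems (snd B)) p"
    have i1: "?i (p u) = u" if "u \<in> elems (snd B)" for u using inj that by (rule inv_into_f_f)
    have "phom ?i A B"
      unfolding phom_def
    proof (intro conjI)
      show "map ?i (fst A) = fst B"
      proof -
        have "fst A = map p (fst B)" using p by (simp add: phom_def)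
        moreover have "map ?i (map p (fst B)) = fst B"
          unfolding map_map by (rule map_idI) (simp only: comp_apply i1[OF subsetD[OF B(3)]])
        ultimately show ?thesis by simp
      qed
      show "map_fact ?i ` snd A \<subseteq> snd B"
        unfolding F[symmetric] image_image by (simp add: map_fact_inv_into[OF inj] image_subset_iff)
    qed
    then show False using AB by (auto simp: maps_to_def)
  qed
  then have "card (p ` elems (snd B)) \<noteq> card (elems (snd B))"
    using finite_elems[OF B(2)] eq_card_imp_inj_on by blast
  then show ?thesis
    using card_image_le[OF finite_elems[OF B(2)], of p] unfolding sur by simp
qed


text \<open>The label \<open>[f]\<close> marks a copy of \<open>u\<close> with \<open>f\<close>, and \<open>[]\<close> leaves it unmarked. Only the
  unmarked copy of a distinguished element is distinguished itself; in double covers, \<open>[]\<close> is one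
  sheet and all other labels together form the second one.\<close>

definition labels :: "'a fact set \<Rightarrow> 'a \<Rightarrow> 'a fact list set" where
  "labels F u = insert [] ((\<lambda>f. [f]) ` {f \<in> F. u \<in> set (snd f)})"

text \<open>Both kinds of candidates arise from this construction by the choice of
  \<open>acc\<close>, which decides which labelled copies of a fact are kept. Projection, lifting
  and sections are thus treated once.\<close>

definition labelling ::
  "'a list \<Rightarrow> 'a fact set \<Rightarrow> ('a fact \<Rightarrow> ('a \<times> 'a fact list) list \<Rightarrow> bool) \<Rightarrow>
    ('a \<times> 'a fact list) list \<times> ('a \<times> 'a fact list) fact set" where
  "labelling a F acc = (map (\<lambda>u. (u, [])) a,
     {g. map_fact fst g \<in> F \<and> (\<forall>x \<in> set (snd g). snd x \<in> labels F (fst x)) \<and>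
       acc (map_fact fst g) (snd g)})"

text \<open>The fact \<open>f0\<close> loses its unmarked copy; otherwise leaving everything
  unmarked would be a section. A non-empty label on a distinguished element always counts, as it
  says that the copy is not the distinguished one.\<close>

definition marked :: "'a set \<Rightarrow> 'a fact \<Rightarrow> 'a fact \<Rightarrow> ('a \<times> 'a fact list) list \<Rightarrow> bool" where
  "marked D f0 f xs \<longleftrightarrow> (\<exists>x \<in> set xs. snd x \<noteq> [] \<and> (fst x \<in> D \<or> snd x \<noteq> [f])) \<or>
     (\<forall>x \<in> set xs. snd x = []) \<and> f \<noteq> f0"

text \<open>\<open>b\<close> is the sheet of the fact itself: this is a double cover of the
  incidence graph in which only the edge \<open>(f0, i0)\<close> changes sheets. Occurrences of
  distinguished elements are left free.\<close>

definition doubled ::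
  "'a set \<Rightarrow> 'a fact \<Rightarrow> nat \<Rightarrow> 'a fact \<Rightarrow> ('a \<times> 'a fact list) list \<Rightarrow> bool" where
  "doubled D f0 i0 f xs \<longleftrightarrow> (\<exists>b. \<forall>j < length xs. fst (xs ! j) \<notin> D \<longrightarrow>
     (snd (xs ! j) \<noteq> []) = (b \<noteq> (f = f0 \<and> j = i0)))"

lemma phom_labelling_fst: "phom fst (labelling a F acc) (a, F)"
  by (auto simp: phom_def labelling_def comp_def)

lemma maps_to_labellingI:
  assumes h: "phom h (c, G) (a, F)"
    and "\<And>x. x \<in> set c \<Longrightarrow> l x = []"
    and "\<And>x. x \<in> elems G \<Longrightarrow> l x \<in> labels F (h x)"
    and "\<And>g. g \<in> G \<Longrightarrow> acc (map_fact h g) (map (\<lambda>x. (h x, l x)) (snd g))"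
  shows "maps_to (c, G) (labelling a F acc)"
proof -
  have "phom (\<lambda>x. (h x, l x)) (c, G) (labelling a F acc)"
    unfolding phom_def labelling_def fst_conv snd_conv
  proof (intro conjI subsetI CollectI)
    have "map h c = a" using h by (simp add: phom_def)
    then show "map (\<lambda>x. (h x, l x)) c = map (\<lambda>u. (u, [])) a" using assms(2) by auto
    fix g' assume "g' \<in> map_fact (\<lambda>x. (h x, l x)) ` G"
    then obtain g where g: "g \<in> G" "g' = map_fact (\<lambda>x. (h x, l x)) g" by blast
    have e: "map_fact fst g' = map_fact h g" unfolding g(2) map_fact_comp by (simp add: comp_def)
    show "map_fact fst g' \<in> F" using h g(1) unfolding e phom_def by auto
    show "acc (map_fact fst g') (snd g')" using assms(4)[OF g(1)] unfolding e by (simp add: g(2))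
    show "\<forall>x\<in>set (snd g'). snd x \<in> labels F (fst x)"
      using assms(3) elemsI[OF g(1)] unfolding g(2) by auto
  qed
  then show ?thesis by (auto simp: maps_to_def)
qed

lemma labelling_section:
  assumes s: "phom s (a, F) (labelling a F acc)" and id: "\<And>u. u \<in> elems F \<Longrightarrow> fst (s u) = u"
    and f: "f \<in> F"
  shows "acc f (map s (snd f))" and "u \<in> set (snd f) \<Longrightarrow> snd (s u) \<in> labels F u"
proof -
  have e: "map_fact fst (map_fact s f) = f"
    unfolding map_fact_comp by (rule map_fact_idI) (simp add: id elemsI[OF f])
  have "map_fact s f \<in> snd (labelling a F acc)" using s f by (auto simp: phom_def)
  then have *: "acc f (map s (snd f))" "\<forall>u\<in>set (snd f). snd (s u) \<in> labels F (fst (s u))"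
    unfolding labelling_def snd_conv mem_Collect_eq e by auto
  then show "acc f (map s (snd f))" by simp
  show "snd (s u) \<in> labels F u" if "u \<in> set (snd f)"
    using *(2) that id[OF elemsI[OF f that]] by metis
qed

lemma labelling_section_head:
  assumes s: "phom s (a, F) (labelling a F acc)" and "u \<in> set a"
  shows "snd (s u) = []"
proof -
  have "map s a = map (\<lambda>u. (u, [])) a" using s by (simp add: phom_def labelling_def)
  then show ?thesis using assms(2) by simp
qed


section \<open>Acyclicity as forests of free edges\<close>

definition free_edges :: "'a list \<Rightarrow> 'a fact set \<Rightarrow> ('a fact \<times> nat) set" where
  "free_edges a F = {(f, i). f \<in> F \<and> i < length (snd f) \<and> snd f ! i \<notin> set a}"

text \<open>Acyclicity in terms of leaves: every non-empty set of edges has a vertex that lies on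
  exactly one of them. Inductions over edges and contradictions by leafless sets use it in this
  form.\<close>

definition forest :: "('a fact \<times> nat) set \<Rightarrow> bool" where
  "forest E \<longleftrightarrow> (\<forall>E' \<subseteq> E. E' \<noteq> {} \<longrightarrow>
     (\<exists>e \<in> E'. \<exists>v \<in> inc_ends e. \<forall>e' \<in> E'. v \<in> inc_ends e' \<longrightarrow> e' = e))"

lemma inc_ends_simp [simp]: "inc_ends (f, i) = {Inl (snd f ! i), Inr f}"
  by (simp add: inc_ends_def)

lemma finite_free_edges: "finite F \<Longrightarrow> finite (free_edges a F)"
  by (rule finite_subset[of _ "SIGMA f:F. {..<length (snd f)}"]) (auto simp: free_edges_def)

text \<open>Cutting the walk at its first repeated vertex gives distinct vertices. The edges are
  then distinct as well, since an edge could only be reused by turning back at once, which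
  \<open>nb\<close> forbids.\<close>

lemma nonbacktracking_cycle:
  fixes v :: "nat \<Rightarrow> 'a + 'a fact"
  assumes fin: "finite (range v)"
    and ends: "\<And>n. inc_ends (e n) = {v n, v (Suc n)}"
    and nb: "\<And>n. e (Suc n) \<noteq> e n"
  obtains vs es where "2 \<le> length vs" "length es = length vs" "distinct vs" "distinct es"
    "set es \<subseteq> range e" "set vs \<subseteq> range v"
    "\<forall>j < length vs. inc_ends (es ! j) = {vs ! j, vs ! (Suc j mod length vs)}"
proof -
  \<comment> \<open>The graph is bipartite, so it has no loops.\<close>
  have vne: "v n \<noteq> v (Suc n)" for n
  proof
    assume eq: "v n = v (Suc n)"
    obtain f i where "e n = (f, i)" by (cases "e n")
    then have "Inl (snd f ! i) = v n" "Inr f = v n" using ends[of n] eq by auto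
    then show False by (metis sum.distinct(1))
  qed
  let ?P = "\<lambda>n. \<exists>m<n. v m = v n"
  have "\<not> inj v" using fin finite_imageD by blast
  then obtain i j where "i \<noteq> j" "v i = v j" by (auto simp: inj_def)
  then have ex: "\<exists>n. ?P n" by (metis nat_neq_iff)
  define n where "n = (LEAST n. ?P n)"
  have "?P n" unfolding n_def using ex by (rule LeastI_ex)
  then obtain m where m: "m < n" "v m = v n" by blast
  have min: "\<not> ?P k" if "k < n" for k using that unfolding n_def by (rule not_less_Least)
  have inj: "i = j" if "i < n" "j < n" "v i = v j" for i j
    using min that by (metis nat_neq_iff)
  have mn: "Suc m < n" using vne[of m] m by (cases "Suc m = n") auto
  define vs where "vs = map v [m..<n]"
  define es where "es = map e [m..<n]"
  have len: "length vs = n - m" "length es = n - m" by (simp_all add: vs_def es_def)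
  \<comment> \<open>As \<open>v i \<noteq> v j\<close>, a reused edge is traversed in the opposite
    direction, hence \<open>v (Suc i) = v j\<close> and \<open>j = Suc i\<close>.\<close>
  have key: False if "m \<le> i" "i < j" "j < n" "e i = e j" for i j
  proof -
    have eq: "{v i, v (Suc i)} = {v j, v (Suc j)}" using ends that(4) by metis
    have "v i \<noteq> v j" using inj[of i j] that by auto
    then have a: "v i = v (Suc j)" "v (Suc i) = v j" using eq by (auto simp: doubleton_eq_iff)
    have "j = Suc i" using inj[of "Suc i" j] a(2) that by auto
    then show False using nb[of i] that(4) by simp
  qed
  show ?thesis
  proof
    show "2 \<le> length vs" "length es = length vs" using len mn by auto
    show "distinct vs" unfolding vs_def by (auto simp: distinct_map inj_on_def intro: inj)
    show "distinct es" unfolding es_def distinct_map inj_on_def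
      using key by (auto) (metis nat_neq_iff)
    show "set es \<subseteq> range e" "set vs \<subseteq> range v" by (auto simp: es_def vs_def)
    show "\<forall>j<length vs. inc_ends (es ! j) = {vs ! j, vs ! (Suc j mod length vs)}"
    proof (intro allI impI)
      fix j assume j: "j < length vs"
      show "inc_ends (es ! j) = {vs ! j, vs ! (Suc j mod length vs)}"
      proof (cases "Suc j = length vs")
        case True
        then have "Suc (m + j) = n" using len(1) m(1) by simp
        then have "v (Suc (m + j)) = vs ! (Suc j mod length vs)"
          using True m(2) mn by (simp add: vs_def)
        then show ?thesis using ends[of "m + j"] j len by (simp add: vs_def es_def)
      next
        case False
        then show ?thesis using ends[of "m + j"] j len by (simp add: vs_def es_def)
      qed
    qed
  qed
qed

text \<open>In a set of edges without a leaf, a walk can leave every vertex by another edge than it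
  came by. The resulting cycle uses free edges only and so avoids distinguished elements.\<close>

lemma c_acyclic_imp_forest:
  assumes fin: "finite F" and ac: "c_acyclic (\<lparr>universe = U, facts = F\<rparr>, a)"
  shows "forest (free_edges a F)"
proof (rule ccontr)
  assume "\<not> forest (free_edges a F)"
  then obtain E where E: "E \<subseteq> free_edges a F" "E \<noteq> {}"
    and "\<not> (\<exists>e\<in>E. \<exists>v\<in>inc_ends e. \<forall>e'\<in>E. v \<in> inc_ends e' \<longrightarrow> e' = e)"
    unfolding forest_def not_all not_imp by (elim exE conjE)
  then have deg: "\<And>e v. e \<in> E \<Longrightarrow> v \<in> inc_ends e \<Longrightarrow> \<exists>e' \<in> E. v \<in> inc_ends e' \<and> e' \<noteq> e"
    by blast
  obtain e0 where e0: "e0 \<in> E" using E(2) by blast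
  have two: "\<exists>v'. inc_ends e = {v, v'}" if "v \<in> inc_ends e" for v :: "'a + 'a fact" and e
    using that by (cases e) auto
  obtain v0 where v0: "v0 \<in> inc_ends e0" by (cases e0) auto
  \<comment> \<open>A state is a vertex paired with the edge by which the walk leaves it.\<close>
  let ?P = "\<lambda>n (z :: ('a + 'a fact) \<times> 'a fact \<times> nat). snd z \<in> E \<and> fst z \<in> inc_ends (snd z)"
  let ?Q = "\<lambda>n (z :: ('a + 'a fact) \<times> 'a fact \<times> nat) z'.
    inc_ends (snd z) = {fst z, fst z'} \<and> snd z' \<noteq> snd z"
  have "\<exists>z. \<forall>n. ?P n (z n) \<and> ?Q n (z n) (z (Suc n))"
  proof (rule dependent_nat_choice)
    show "\<exists>z. ?P 0 z" using e0 v0 by (intro exI[of _ "(v0, e0)"]) simp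
    fix y :: "('a + 'a fact) \<times> 'a fact \<times> nat" and n assume y: "?P n y"
    obtain v' where v': "inc_ends (snd y) = {fst y, v'}" using two y by blast
    then obtain e' where "e' \<in> E" "v' \<in> inc_ends e'" "e' \<noteq> snd y" using deg[of "snd y" v'] y by auto
    then show "\<exists>x. ?P (Suc n) x \<and> ?Q n y x" using v' by (intro exI[of _ "(v', e')"]) simp
  qed
  then obtain z where z: "\<And>n. ?P n (z n) \<and> ?Q n (z n) (z (Suc n))" by blast
  have finE: "finite E" using E(1) finite_free_edges[OF fin] finite_subset by blast
  have "range (\<lambda>n. fst (z n)) \<subseteq> (\<Union>e\<in>E. inc_ends e)" using z by blast
  moreover have "finite (\<Union>e\<in>E. inc_ends e)" using finE by (auto simp: inc_ends_def)
  ultimately have r: "finite (range (\<lambda>n. fst (z n)))" using finite_subset by blast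
  obtain vs es where c: "2 \<le> length vs" "length es = length vs" "distinct vs" "distinct es"
    "set es \<subseteq> range (\<lambda>n. snd (z n))" "set vs \<subseteq> range (\<lambda>n. fst (z n))"
    "\<forall>j < length vs. inc_ends (es ! j) = {vs ! j, vs ! (Suc j mod length vs)}"
  proof (rule nonbacktracking_cycle[of "\<lambda>n. fst (z n)" "\<lambda>n. snd (z n)"])
    show "inc_ends (snd (z n)) = {fst (z n), fst (z (Suc n))}" "snd (z (Suc n)) \<noteq> snd (z n)" for n
      using z[of n] by blast+
  qed (use r in blast)+
  have "set es \<subseteq> E" using c(5) z by blast
  then have "inc_cycle \<lparr>universe = U, facts = F\<rparr> vs es"
    using c E(1) by (auto simp: inc_cycle_def inc_edges_def free_edges_def)
  then obtain x where x: "x \<in> set a" "Inl x \<in> set vs" using ac by (auto simp: c_acyclic_def)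
  then obtain n where "Inl x = fst (z n)" using c(6) by blast
  then have n: "Inl x \<in> inc_ends (snd (z n))" "snd (z n) \<in> free_edges a F" using z[of n] E(1) by auto
  then show False using x(1) by (cases "snd (z n)") (auto simp: free_edges_def)
qed

text \<open>Arc consistency solves constraints on forests. The variables are the elements and the
  facts, with domains \<open>X\<close> and \<open>Y\<close>, and every edge carries a constraint
  \<open>R\<close>. After removing a leaf edge and solving the rest, the value at the leaf vertex is
  chosen anew; no other constraint sees it.\<close>

lemma forest_csp:
  assumes "finite E" "forest E"
    and "\<And>u. X u \<noteq> {}" "\<And>f. Y f \<noteq> {}"
    and "\<And>f i x. (f, i) \<in> E \<Longrightarrow> x \<in> X (snd f ! i) \<Longrightarrow> \<exists>y \<in> Y f. R f i x y"
    and "\<And>f i y. (f, i) \<in> E \<Longrightarrow> y \<in> Y f \<Longrightarrow> \<exists>x \<in> X (snd f ! i). R f i x y"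
  shows "\<exists>\<sigma> \<tau>. (\<forall>u. \<sigma> u \<in> X u) \<and> (\<forall>f. \<tau> f \<in> Y f) \<and>
    (\<forall>(f, i) \<in> E. R f i (\<sigma> (snd f ! i)) (\<tau> f))"
  using assms
proof (induction "card E" arbitrary: E)
  case 0
  then have "E = {}" by simp
  moreover have "\<forall>u. (SOME x. x \<in> X u) \<in> X u" "\<forall>f. (SOME y. y \<in> Y f) \<in> Y f"
    using 0 by (simp_all add: some_in_eq)
  ultimately show ?case by (intro exI[of _ "\<lambda>u. SOME x. x \<in> X u"] exI[of _ "\<lambda>f. SOME y. y \<in> Y f"]) simp
next
  case (Suc n)
  then have "E \<noteq> {}" by auto
  then obtain e v where e: "e \<in> E" "v \<in> inc_ends e" "\<And>e'. e' \<in> E \<Longrightarrow> v \<in> inc_ends e' \<Longrightarrow> e' = e"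
    using \<open>forest E\<close> unfolding forest_def by (metis subset_refl)
  obtain f i where fi: "e = (f, i)" by (cases e)
  have "n = card (E - {e})" using Suc.hyps(2) Suc.prems(1) e(1) by simp
  moreover have "forest (E - {e})" using Suc.prems(2) unfolding forest_def by (meson Diff_subset subset_trans)
  ultimately obtain \<sigma> \<tau> where IH: "\<forall>u. \<sigma> u \<in> X u" "\<forall>f. \<tau> f \<in> Y f"
    "\<And>g j. (g, j) \<in> E \<Longrightarrow> (g, j) \<noteq> (f, i) \<Longrightarrow> R g j (\<sigma> (snd g ! j)) (\<tau> g)"
  proof -
    assume 1: "n = card (E - {e})" and 2: "forest (E - {e})"
    assume that: "\<And>\<sigma> \<tau>. \<forall>u. \<sigma> u \<in> X u \<Longrightarrow> \<forall>f. \<tau> f \<in> Y f \<Longrightarrow>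
      (\<And>g j. (g, j) \<in> E \<Longrightarrow> (g, j) \<noteq> (f, i) \<Longrightarrow> R g j (\<sigma> (snd g ! j)) (\<tau> g)) \<Longrightarrow> thesis"
    have "\<exists>\<sigma> \<tau>. (\<forall>u. \<sigma> u \<in> X u) \<and> (\<forall>f. \<tau> f \<in> Y f) \<and>
      (\<forall>(f, i) \<in> E - {e}. R f i (\<sigma> (snd f ! i)) (\<tau> f))"
      by (rule Suc.hyps(1)[OF 1 _ 2 Suc.prems(3,4)]) (use Suc.prems(1,5,6) in auto)
    then show thesis using that fi by blast
  qed
  have "v = Inl (snd f ! i) \<or> v = Inr f" using e(2) fi by simp
  then show ?case
  proof
    assume v: "v = Inl (snd f ! i)"
    obtain x where x: "x \<in> X (snd f ! i)" "R f i x (\<tau> f)"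
      using Suc.prems(6)[of f i "\<tau> f"] e(1) fi IH(2) by blast
    have "R g j ((\<sigma>(snd f ! i := x)) (snd g ! j)) (\<tau> g)" if "(g, j) \<in> E" for g j
      using e(3)[OF that] that v fi IH(3)[of g j] x(2) by (cases "(g, j) = (f, i)") auto
    then have "\<forall>(g, j)\<in>E. R g j ((\<sigma>(snd f ! i := x)) (snd g ! j)) (\<tau> g)" by blast
    moreover have "\<forall>u. (\<sigma>(snd f ! i := x)) u \<in> X u" using IH(1) x(1) by simp
    ultimately show ?thesis using IH(2) by blast
  next
    assume v: "v = Inr f"
    obtain y where y: "y \<in> Y f" "R f i (\<sigma> (snd f ! i)) y"
      using Suc.prems(5)[of f i "\<sigma> (snd f ! i)"] e(1) fi IH(1) by blast
    have "R g j (\<sigma> (snd g ! j)) ((\<tau>(f := y)) g)" if "(g, j) \<in> E" for g j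
      using e(3)[OF that] that v fi IH(3)[of g j] y(2) by (cases "(g, j) = (f, i)") auto
    then have "\<forall>(g, j)\<in>E. R g j (\<sigma> (snd g ! j)) ((\<tau>(f := y)) g)" by blast
    moreover have "\<forall>g. (\<tau>(f := y)) g \<in> Y g" using IH(2) y(1) by simp
    ultimately show ?thesis using IH(1) by blast
  qed
qed

section \<open>Double covers\<close>

text \<open>The sheets must solve one parity equation per free edge, and such equations are always
  solvable on a forest. All occurrences in \<open>G\<close> that lie over \<open>(f0, i0)\<close>
  switch sheets.\<close>

lemma maps_to_doubled:
  assumes h: "phom h (c, G) (a, F)" and G: "finite G" "forest (free_edges c G)" "set c \<subseteq> elems G"
  shows "maps_to (c, G) (labelling a F (doubled (set a) f0 i0))"
proof -
  have hc: "h ` set c = set a" using h unfolding phom_def by (metis fst_conv set_map)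
  have "\<exists>\<sigma> \<tau>. (\<forall>u. \<sigma> u \<in> (UNIV :: bool set)) \<and> (\<forall>f. \<tau> f \<in> (UNIV :: bool set)) \<and>
    (\<forall>(g, j) \<in> free_edges c G. \<sigma> (snd g ! j) = (\<tau> g \<noteq> (map_fact h g = f0 \<and> j = i0)))"
  proof (rule forest_csp[OF finite_free_edges[OF G(1)] G(2)])
    show "\<exists>y\<in>UNIV. x = (y \<noteq> (map_fact h g = f0 \<and> j = i0))" for g j x
      by (rule bexI[of _ "x \<noteq> (map_fact h g = f0 \<and> j = i0)"]) blast+
  qed blast+
  then obtain \<sigma> \<tau> where st0:
    "\<forall>(g, j) \<in> free_edges c G. \<sigma> (snd g ! j) = (\<tau> g \<noteq> (map_fact h g = f0 \<and> j = i0))"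
    by (elim exE conjE)
  have st: "\<sigma> (snd g ! j) = (\<tau> g \<noteq> (map_fact h g = f0 \<and> j = i0))"
    if "(g, j) \<in> free_edges c G" for g j
    using bspec[OF st0 that] unfolding split_conv .
  \<comment> \<open>Some fact incident with \<open>u\<close>. Any non-empty label denotes the second
    sheet, so the choice is immaterial.\<close>
  define w where "w u = (SOME f. f \<in> F \<and> u \<in> set (snd f))" for u
  have w: "w (h x) \<in> F \<and> h x \<in> set (snd (w (h x)))" if x: "x \<in> elems G" for x
  proof -
    obtain g where "g \<in> G" "x \<in> set (snd g)" using x unfolding elems_def by blast
    then have "map_fact h g \<in> F \<and> h x \<in> set (snd (map_fact h g))" using h unfolding phom_def by simp blast
    then show ?thesis unfolding w_def by (rule someI)
  qed
  \<comment> \<open>Elements outside the head of the source may also be mapped to distinguished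
    ones; there \<open>doubled\<close> demands nothing and \<open>[]\<close> will do.\<close>
  let ?l = "\<lambda>x. if h x \<in> set a \<or> \<not> \<sigma> x then [] else [w (h x)]"
  show ?thesis
  proof (rule maps_to_labellingI[OF h])
    show "?l x = []" if "x \<in> set c" for x using that hc by auto
    show "?l x \<in> labels F (h x)" if "x \<in> elems G" for x using w[OF that] by (simp add: labels_def)
    fix g assume g: "g \<in> G"
    have "\<sigma> (snd g ! j) = (\<tau> g \<noteq> (map_fact h g = f0 \<and> j = i0))"
      if "j < length (snd g)" "h (snd g ! j) \<notin> set a" for j
      using st[of g j] that g hc by (auto simp: free_edges_def)
    then show "doubled (set a) f0 i0 (map_fact h g) (map (\<lambda>x. (h x, ?l x)) (snd g))"
      unfolding doubled_def by (intro exI[of _ "\<tau> g"]) simp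
  qed
qed

text \<open>Along the cycle \<open>P\<close> changes exactly once, at \<open>e0\<close>, but a
  cyclic sequence of truth values changes an even number of times. In the sum of \<open>?p\<close>
  over both ends of all edges, every vertex is counted twice.\<close>

lemma cycle_parity:
  assumes len: "length es = length vs" and dist: "distinct es"
    and ends: "\<And>j. j < length vs \<Longrightarrow> inc_ends (es ! j) = {vs ! j, vs ! (Suc j mod length vs)}"
    and e0: "e0 \<in> set es"
    and P: "\<And>f i. (f, i) \<in> set es \<Longrightarrow> P (Inl (snd f ! i)) = (P (Inr f) \<noteq> ((f, i) = e0))"
  shows False
proof -
  let ?n = "length vs"
  let ?p = "\<lambda>j. if P (vs ! j) then 1 else 0 :: nat"
  obtain j0 where j0: "j0 < ?n" "es ! j0 = e0" using e0 len by (metis in_set_conv_nth)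
  have npos: "0 < ?n" using j0(1) by linarith
  have step: "P (vs ! j) = (P (vs ! (Suc j mod ?n)) \<noteq> (j = j0))" if j: "j < ?n" for j
  proof -
    obtain f i where fi: "es ! j = (f, i)" by (cases "es ! j")
    then have "(f, i) \<in> set es" using j len by (metis nth_mem)
    moreover have "(f, i) = e0 \<longleftrightarrow> j = j0"
      using fi j0 j len dist by (metis nth_eq_iff_index_eq)
    ultimately have "P (Inl (snd f ! i)) = (P (Inr f) \<noteq> (j = j0))" using P by metis
    moreover have "{Inl (snd f ! i), Inr f} = {vs ! j, vs ! (Suc j mod ?n)}"
      using ends[OF j] fi by simp
    \<comment> \<open>The relation between the two ends is symmetric, so the direction in which the
      edge is traversed does not matter.\<close>
    ultimately show ?thesis unfolding doubleton_eq_iff by metis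
  qed
  have bij: "bij_betw (\<lambda>j. Suc j mod ?n) {..<?n} {..<?n}"
  proof -
    have "inj_on (\<lambda>j. Suc j mod ?n) {..<?n}"
      by (rule inj_onI) (auto simp: mod_Suc split: if_splits)
    moreover have "(\<lambda>j. Suc j mod ?n) ` {..<?n} \<subseteq> {..<?n}" using npos by auto
    ultimately show ?thesis by (simp add: bij_betw_def endo_inj_surj)
  qed
  have "(\<Sum>j<?n. ?p j + ?p (Suc j mod ?n)) = (\<Sum>j<?n. ?p j) + (\<Sum>j<?n. ?p (Suc j mod ?n))"
    by (rule sum.distrib)
  also have "(\<Sum>j<?n. ?p (Suc j mod ?n)) = (\<Sum>j<?n. ?p j)"
    by (rule sum.reindex_bij_betw[OF bij])
  finally have ev: "even (\<Sum>j<?n. ?p j + ?p (Suc j mod ?n))" by simp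
  have "(\<Sum>j\<in>{..<?n} - {j0}. ?p j + ?p (Suc j mod ?n)) = (\<Sum>j\<in>{..<?n} - {j0}. 2 * ?p j)"
    by (rule sum.cong) (use step in auto)
  then have "even (\<Sum>j\<in>{..<?n} - {j0}. ?p j + ?p (Suc j mod ?n))" by (simp flip: sum_distrib_left)
  moreover have "odd (?p j0 + ?p (Suc j0 mod ?n))" using step[OF j0(1)] by auto
  moreover have "(\<Sum>j<?n. ?p j + ?p (Suc j mod ?n)) =
      (?p j0 + ?p (Suc j0 mod ?n)) + (\<Sum>j\<in>{..<?n} - {j0}. ?p j + ?p (Suc j mod ?n))"
    by (rule sum.remove) (use j0 in auto)
  ultimately show False using ev by (simp only: even_add)
qed

text \<open>A section selects a sheet for every element and, by the witness \<open>b\<close> of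
  \<open>doubled\<close>, for every fact. The ends of a free edge agree except at
  \<open>(f0, i0)\<close>, which is impossible around the cycle.\<close>

lemma no_section_doubled:
  assumes cyc: "inc_cycle \<lparr>universe = U, facts = F\<rparr> vs es"
    and free: "\<And>x. x \<in> set a \<Longrightarrow> Inl x \<notin> set vs"
    and e0: "(f0, i0) \<in> set es"
    and s: "phom s (a, F) (labelling a F (doubled (set a) f0 i0))"
    and id: "\<And>u. u \<in> elems F \<Longrightarrow> fst (s u) = u"
  shows False
proof -
  have c: "2 \<le> length vs" "length es = length vs" "distinct es"
    "set es \<subseteq> inc_edges \<lparr>universe = U, facts = F\<rparr>"
    "\<And>j. j < length vs \<Longrightarrow> inc_ends (es ! j) = {vs ! j, vs ! (Suc j mod length vs)}"
    using cyc by (auto simp: inc_cycle_def)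
  have "\<exists>b. \<forall>j<length (snd f). snd f ! j \<notin> set a \<longrightarrow>
      (snd (s (snd f ! j)) \<noteq> []) = (b \<noteq> (f = f0 \<and> j = i0))" if f: "f \<in> F" for f
  proof -
    have "fst (s (snd f ! j)) = snd f ! j" if "j < length (snd f)" for j
      using id[OF elemsI[OF f]] that by simp
    then show ?thesis using labelling_section(1)[OF s id f] by (simp add: doubled_def)
  qed
  then obtain b where b: "\<And>f j. f \<in> F \<Longrightarrow> j < length (snd f) \<Longrightarrow> snd f ! j \<notin> set a \<Longrightarrow>
      (snd (s (snd f ! j)) \<noteq> []) = (b f \<noteq> (f = f0 \<and> j = i0))" by metis
  let ?P = "\<lambda>v. case v of Inl u \<Rightarrow> snd (s u) \<noteq> [] | Inr f \<Rightarrow> b f"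
  show False
  proof (rule cycle_parity[OF c(2,3,5) e0, where P = ?P])
    fix f i assume fi: "(f, i) \<in> set es"
    then obtain j where j: "j < length vs" "es ! j = (f, i)" using c(2) by (metis in_set_conv_nth)
    then have "Inl (snd f ! i) \<in> {vs ! j, vs ! (Suc j mod length vs)}"
      using c(5)[OF j(1)] by auto
    moreover have "Suc j mod length vs < length vs"
      by (rule mod_less_divisor) (use c(1) in linarith)
    ultimately have "Inl (snd f ! i) \<in> set vs" using j(1) by auto
    then have "snd f ! i \<notin> set a" using free by blast
    moreover have "f \<in> F" "i < length (snd f)" using fi c(4) by (auto simp: inc_edges_def)
    ultimately show "?P (Inl (snd f ! i)) = (?P (Inr f) \<noteq> ((f, i) = (f0, i0)))"
      using b by simp
  qed
qed

section \<open>Marked labellings of a forest\<close>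

text \<open>Iterated images of \<open>S\<close> shrink to a set that \<open>\<phi>\<close> maps onto
  itself. Its members also have predecessors in it, which \<open>no_section_marked\<close> needs to
  exclude leaves at facts.\<close>

lemma finite_image_fixed_subset:
  assumes "finite S" "S \<noteq> {}" "\<phi> ` S \<subseteq> S"
  obtains X where "X \<subseteq> S" "X \<noteq> {}" "\<phi> ` X = X"
proof -
  have "\<exists>X \<subseteq> S. X \<noteq> {} \<and> \<phi> ` X = X"
    using assms
  proof (induction S rule: finite_psubset_induct)
    case (psubset S)
    show ?case
    proof (cases "\<phi> ` S = S")
      case False
      then have "\<phi> ` S \<subset> S" using psubset.prems by blast
      moreover have "\<phi> ` S \<noteq> {}" using psubset.prems(1) by simp
      moreover have "\<phi> ` \<phi> ` S \<subseteq> \<phi> ` S" using psubset.prems(2) by (rule image_mono)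
      ultimately have "\<exists>X \<subseteq> \<phi> ` S. X \<noteq> {} \<and> \<phi> ` X = X" by (rule psubset.IH)
      then show ?thesis using psubset.prems(2) subset_trans by metis
    qed (use psubset.prems in blast)
  qed
  then show ?thesis using that by blast
qed

text \<open>A section would assign to every element of the component of \<open>f0\<close> one of its facts so
  that no fact is chosen by all of its elements; leaving each fact through an element that
  chooses differently, one never stops.\<close>

lemma no_section_marked:
  assumes F: "finite F" "f0 \<in> F" and fo: "forest (free_edges a F)"
    and s: "phom s (a, F) (labelling a F (marked (set a) f0))"
    and id: "\<And>u. u \<in> elems F \<Longrightarrow> fst (s u) = u"
  shows False
proof -
  let ?m = "\<lambda>u. snd (s u)"
  \<comment> \<open>For these facts the second alternative of \<open>marked\<close> fails:
    \<open>f0\<close> is excluded explicitly, and the others have a marked element.\<close>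
  define S where "S = {f \<in> F. f = f0 \<or> (\<exists>u \<in> set (snd f). ?m u \<noteq> [])}"
  let ?next = "\<lambda>f u f'. u \<in> set (snd f) \<and> u \<notin> set a \<and> ?m u = [f'] \<and> f' \<noteq> f \<and>
    u \<in> set (snd f') \<and> f' \<in> S"
  have ex: "\<exists>z. ?next f (fst z) (snd z)" if f: "f \<in> S" for f
  proof -
    have fF: "f \<in> F" using f by (simp add: S_def)
    have i: "fst (s u) = u" if "u \<in> set (snd f)" for u using id elemsI[OF fF that] by blast
    have "\<exists>u\<in>set (snd f). ?m u \<noteq> [] \<and> (u \<in> set a \<or> ?m u \<noteq> [f])"
      using labelling_section(1)[OF s id fF] f i unfolding marked_def S_def by auto
    then obtain u where u: "u \<in> set (snd f)" "?m u \<noteq> []" "u \<in> set a \<or> ?m u \<noteq> [f]" by blast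
    then have "u \<notin> set a" using labelling_section_head[OF s] by blast
    moreover obtain f' where f': "f' \<in> F" "u \<in> set (snd f')" "?m u = [f']"
      using labelling_section(2)[OF s id fF u(1)] u(2) unfolding labels_def by blast
    moreover have "f' \<in> S" using f' u(2) unfolding S_def by blast
    moreover have "f' \<noteq> f" using u(3) f'(3) \<open>u \<notin> set a\<close> by blast
    ultimately have "?next f u f'" using u(1) by blast
    then show ?thesis by (intro exI[of _ "(u, f')"]) simp
  qed
  define z where "z f = (SOME z. ?next f (fst z) (snd z))" for f
  define \<nu> where "\<nu> f = fst (z f)" for f
  define \<phi> where "\<phi> f = snd (z f)" for f
  have nu: "?next f (\<nu> f) (\<phi> f)" if "f \<in> S" for f
    unfolding \<nu>_def \<phi>_def z_def by (rule someI_ex[OF ex[OF that]])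
  have "finite S" using F(1) unfolding S_def by simp
  moreover have "S \<noteq> {}" using F(2) unfolding S_def by blast
  moreover have "\<phi> ` S \<subseteq> S" using nu by blast
  ultimately obtain X where X: "X \<subseteq> S" "X \<noteq> {}" "\<phi> ` X = X"
    by (rule finite_image_fixed_subset)
  have SF: "S \<subseteq> F" by (auto simp: S_def)
  \<comment> \<open>The edges by which a fact \<open>f\<close> in \<open>X\<close> is left, and
    those by which \<open>\<phi> g\<close> is entered from \<open>g\<close>. They form a leafless
    set.\<close>
  define E where "E = {(f, i) \<in> free_edges a F. f \<in> X \<and>
    (snd f ! i = \<nu> f \<or> (\<exists>g\<in>X. \<phi> g = f \<and> snd f ! i = \<nu> g))}"
  have out: "\<exists>i. (f, i) \<in> E \<and> snd f ! i = \<nu> f" if "f \<in> X" for f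
  proof -
    have f: "f \<in> S" using that X(1) by blast
    have n: "\<nu> f \<in> set (snd f)" "\<nu> f \<notin> set a" using nu[OF f] by simp_all
    then obtain i where i: "i < length (snd f)" "snd f ! i = \<nu> f" unfolding in_set_conv_nth by blast
    have "f \<in> F" using f SF by blast
    then have "(f, i) \<in> E" unfolding E_def free_edges_def using i n(2) that by simp
    then show ?thesis using i(2) by blast
  qed
  have inn: "\<exists>i. (\<phi> g, i) \<in> E \<and> snd (\<phi> g) ! i = \<nu> g" if "g \<in> X" for g
  proof -
    have g: "g \<in> S" using that X(1) by blast
    have n: "\<nu> g \<in> set (snd (\<phi> g))" "\<nu> g \<notin> set a" using nu[OF g] by simp_all
    then obtain i where i: "i < length (snd (\<phi> g))" "snd (\<phi> g) ! i = \<nu> g"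
      unfolding in_set_conv_nth by blast
    have p: "\<phi> g \<in> X" "\<phi> g \<in> F" using that X SF by blast+
    have "\<exists>g'\<in>X. \<phi> g' = \<phi> g \<and> snd (\<phi> g) ! i = \<nu> g'" using that i(2) by blast
    then have "(\<phi> g, i) \<in> E" unfolding E_def free_edges_def using i(1) n(2) p
      by (simp add: i(2))
    then show ?thesis using i(2) by blast
  qed
  have "E \<noteq> {}" using out X(2) by blast
  moreover have "E \<subseteq> free_edges a F" by (auto simp: E_def)
  ultimately obtain e v where e: "e \<in> E" "v \<in> inc_ends e" "\<And>e'. e' \<in> E \<Longrightarrow> v \<in> inc_ends e' \<Longrightarrow> e' = e"
    using fo unfolding forest_def by meson
  obtain f i where fi: "e = (f, i)" by (cases e)
  have "v = Inl (snd f ! i) \<or> v = Inr f" using e(2) fi by simp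
  then show False
  proof
    \<comment> \<open>The element \<open>\<nu> g\<close> lies in the two distinct facts
      \<open>g\<close> and \<open>\<phi> g\<close>.\<close>
    assume v: "v = Inl (snd f ! i)"
    have "\<exists>g\<in>X. snd f ! i = \<nu> g" using e(1) unfolding fi E_def by blast
    then obtain g where g: "g \<in> X" "snd f ! i = \<nu> g" by blast
    obtain j where j: "(g, j) \<in> E" "snd g ! j = \<nu> g" using out[OF g(1)] by blast
    obtain k where k: "(\<phi> g, k) \<in> E" "snd (\<phi> g) ! k = \<nu> g" using inn[OF g(1)] by blast
    have "(g, j) = e" "(\<phi> g, k) = e" using e(3)[OF j(1)] e(3)[OF k(1)] v g(2) j(2) k(2) by simp_all
    then have "\<phi> g = g" by auto
    then show False using nu[OF subsetD[OF X(1) g(1)]] by simp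
  next
    \<comment> \<open>\<open>f\<close> is entered through an element marked with \<open>f\<close>
      and left through one marked otherwise.\<close>
    assume v: "v = Inr f"
    have fX: "f \<in> X" using e(1) unfolding fi E_def by blast
    then have "f \<in> \<phi> ` X" using X(3) by simp
    then obtain g where g: "g \<in> X" "\<phi> g = f" by (rule imageE) simp
    obtain j where j: "(f, j) \<in> E" "snd f ! j = \<nu> f" using out[OF fX] by blast
    obtain k where k: "(f, k) \<in> E" "snd f ! k = \<nu> g" using inn[OF g(1)] g(2) by blast
    have "(f, j) = e" "(f, k) = e" using e(3)[OF j(1)] e(3)[OF k(1)] v by simp_all
    then have "\<nu> f = \<nu> g" using j(2) k(2) by auto
    moreover have "?m (\<nu> f) = [\<phi> f]" "\<phi> f \<noteq> f" "?m (\<nu> g) = [f]"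
      using nu[OF subsetD[OF X(1) fX]] nu[OF subsetD[OF X(1) g(1)]] g(2) by simp_all
    ultimately show False by simp
  qed
qed


section \<open>Arc consistency and maps to the goal\<close>

text \<open>The elements \<open>x\<close> not deleted are the remaining possible images of
  \<open>h x\<close> under a section of \<open>h\<close>; for distinguished elements the image is
  prescribed by \<open>r\<close>. The stages are kept because \<open>maps_to_marked\<close> needs
  the order of deletions.\<close>

primrec dead :: "('b \<Rightarrow> 'a) \<Rightarrow> ('a \<Rightarrow> 'b) \<Rightarrow> 'a set \<Rightarrow> 'a fact set \<Rightarrow> 'b fact set \<Rightarrow> nat \<Rightarrow> 'b set" where
  "dead h r D F G 0 = {}"
| "dead h r D F G (Suc n) = dead h r D F G n \<union> {x \<in> elems G. h x \<notin> D \<and>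
     (\<exists>f \<in> F. h x \<in> set (snd f) \<and> (\<forall>g \<in> G. map_fact h g = f \<longrightarrow> x \<in> set (snd g) \<longrightarrow>
       \<not> (\<forall>y \<in> set (snd g). if h y \<in> D then y = r (h y) else y \<notin> dead h r D F G n)))}"

lemma dead_mono: "m \<le> n \<Longrightarrow> dead h r D F G m \<subseteq> dead h r D F G n"
  by (rule lift_Suc_mono_le) simp_all

lemma dead_subset: "dead h r D F G n \<subseteq> {x \<in> elems G. h x \<notin> D}"
  by (induction n) auto

lemma dead_stable:
  assumes "finite G"
  obtains n where "dead h r D F G (Suc n) = dead h r D F G n"
proof -
  let ?d = "dead h r D F G"
  have fin: "finite (?d n)" for n
    using dead_subset[of h r D F G n] finite_elems[OF assms] finite_subset by fastforce
  have "\<exists>n. ?d (Suc n) = ?d n"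
  proof (rule ccontr)
    assume "\<not> (\<exists>n. ?d (Suc n) = ?d n)"
    then have "?d n \<subset> ?d (Suc n)" for n using dead_mono[of n "Suc n" h r D F G] by (simp add: psubset_eq eq_commute)
    then have lt: "card (?d n) < card (?d (Suc n))" for n by (intro psubset_card_mono fin)
    have "n \<le> card (?d n)" for n
    proof (induction n)
      case (Suc n)
      then show ?case using lt[of n] by linarith
    qed simp
    moreover have "card (?d n) \<le> card (elems G)" for n
      by (rule card_mono[OF finite_elems[OF assms]]) (use dead_subset[of h r D F G n] in blast)
    ultimately show False by (meson Suc_n_not_le_n le_trans)
  qed
  then show ?thesis using that by blast
qed

lemma not_in_dead:
  assumes "x \<notin> dead h r D F G (Suc n)" "x \<in> elems G" "h x \<notin> D" "f \<in> F" "h x \<in> set (snd f)"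
  shows "\<exists>g \<in> G. map_fact h g = f \<and> x \<in> set (snd g) \<and>
    (\<forall>y \<in> set (snd g). if h y \<in> D then y = r (h y) else y \<notin> dead h r D F G n)"
  using assms unfolding dead.simps by blast

lemma in_dead_mark:
  assumes "x \<in> dead h r D F G (Suc n)" "x \<notin> dead h r D F G n"
  shows "\<exists>f \<in> F. h x \<in> set (snd f) \<and> (\<forall>g \<in> G. map_fact h g = f \<longrightarrow> x \<in> set (snd g) \<longrightarrow>
       \<not> (\<forall>y \<in> set (snd g). if h y \<in> D then y = r (h y) else y \<notin> dead h r D F G n))"
  using assms unfolding dead.simps by blast

text \<open>Propagating arc consistency from \<open>A\<close> to the fibres of \<open>h\<close>, every deleted element is
  marked with the fact that caused its deletion. A fact of \<open>Q\<close> over \<open>f\<close> with a deleted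
  element is acceptable: when the first of its elements was deleted, it was still intact and
  hence \<open>f\<close> was not the cause.\<close>

lemma maps_to_marked:
  assumes h: "phom h (c, G) (a, F)" and r: "map r a = c"
    and n: "dead h r (set a) F G (Suc n) = dead h r (set a) F G n"
    and none: "\<And>g. g \<in> G \<Longrightarrow> map_fact h g = f0 \<Longrightarrow>
      \<not> (\<forall>y \<in> set (snd g). if h y \<in> set a then y = r (h y) else y \<notin> dead h r (set a) F G n)"
  shows "maps_to (c, G) (labelling a F (marked (set a) f0))"
proof -
  let ?d = "dead h r (set a) F G"
  have hc: "map h c = a" using h by (simp add: phom_def)
  have rh: "r (h x) = x" if "x \<in> set c" for x
  proof -
    have "map (r \<circ> h) c = map id c" using r unfolding hc[symmetric] by simp
    then show ?thesis using that unfolding map_eq_conv by simp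
  qed
  \<comment> \<open>For a deleted \<open>x\<close>, the last stage at which it is still
    alive.\<close>
  define rk where "rk x = (LEAST m. x \<in> ?d (Suc m))" for x
  have rk: "x \<in> ?d (Suc (rk x))" if "x \<in> ?d n" for x
    unfolding rk_def by (rule LeastI[of _ n]) (simp only: n that)
  have rk_less: "x \<notin> ?d m" if "m \<le> rk x" for x m
  proof (cases m)
    case (Suc k)
    then have "k < (LEAST m. x \<in> ?d (Suc m))" using that unfolding rk_def by linarith
    then show ?thesis unfolding Suc by (rule not_less_Least)
  qed simp
  let ?cause = "\<lambda>x f. f \<in> F \<and> h x \<in> set (snd f) \<and> (\<forall>g \<in> G. map_fact h g = f \<longrightarrow> x \<in> set (snd g) \<longrightarrow>
       \<not> (\<forall>y \<in> set (snd g). if h y \<in> set a then y = r (h y) else y \<notin> ?d (rk x)))"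
  define mk where "mk x = (SOME f. ?cause x f)" for x
  have mk: "?cause x (mk x)" if "x \<in> ?d n" for x
    unfolding mk_def
    by (rule someI_ex) (use in_dead_mark[OF rk[OF that] rk_less[OF le_refl]] in \<open>unfold Bex_def\<close>)
  define w where "w u = (SOME f. f \<in> F \<and> u \<in> set (snd f))" for u
  have w: "w (h x) \<in> F \<and> h x \<in> set (snd (w (h x)))" if x: "x \<in> elems G" for x
  proof -
    obtain g where "g \<in> G" "x \<in> set (snd g)" using x unfolding elems_def by blast
    then have "map_fact h g \<in> F \<and> h x \<in> set (snd (map_fact h g))" using h unfolding phom_def by simp blast
    then show ?thesis unfolding w_def by (rule someI)
  qed
  \<comment> \<open>Over a distinguished element only the prescribed preimage stays unmarked. The
    label of any other one is arbitrary, as \<open>marked\<close> accepts every mark there.\<close>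
  let ?l = "\<lambda>x. if h x \<in> set a then if x = r (h x) then [] else [w (h x)]
    else if x \<in> ?d n then [mk x] else []"
  show ?thesis
  proof (rule maps_to_labellingI[OF h])
    show "?l x = []" if "x \<in> set c" for x using that hc rh[OF that] by auto
    show "?l x \<in> labels F (h x)" if "x \<in> elems G" for x
      using w[OF that] mk[of x] by (simp add: labels_def)
    fix g assume g: "g \<in> G"
    let ?f = "map_fact h g"
    let ?xs = "map (\<lambda>x. (h x, ?l x)) (snd g)"
    show "marked (set a) f0 ?f ?xs"
    proof (cases "\<forall>y \<in> set (snd g). if h y \<in> set a then y = r (h y) else y \<notin> ?d n")
      case True
      then have "?f \<noteq> f0" using none[OF g] by blast
      moreover have "\<forall>x\<in>set ?xs. snd x = []" using True by simp
      ultimately show ?thesis unfolding marked_def by blast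
    next
      case bad: False
      have "\<exists>y\<in>set (snd g). ?l y \<noteq> [] \<and> (h y \<in> set a \<or> ?l y \<noteq> [?f])"
      proof (cases "\<exists>y \<in> set (snd g). h y \<in> set a \<and> y \<noteq> r (h y)")
        case True
        then show ?thesis by auto
      next
        case False
        define Z where "Z = {y \<in> set (snd g). y \<in> ?d n}"
        have "Z \<noteq> {}" using bad False unfolding Z_def by (auto split: if_splits)
        moreover have "finite Z" by (simp add: Z_def)
        \<comment> \<open>Among the deleted elements of \<open>g\<close>, one that was deleted
          first.\<close>
        ultimately obtain y where y: "y \<in> Z" "\<And>z. z \<in> Z \<Longrightarrow> rk y \<le> rk z"
          using ex_min_if_finite[of "rk ` Z"] by (auto simp: not_less)
        have yd: "y \<in> set (snd g)" "y \<in> ?d n" using y(1) by (auto simp: Z_def)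
        have ya: "h y \<notin> set a" using yd(2) dead_subset[of h r "set a" F G n] by blast
        have "z \<notin> ?d (rk y)" if "z \<in> set (snd g)" for z
        proof
          assume z: "z \<in> ?d (rk y)"
          have "z \<in> ?d n"
          proof (cases "rk y \<le> n")
            case True
            then show ?thesis using z dead_mono[of "rk y" n h r "set a" F G] by blast
          next
            case False
            then have "y \<notin> ?d n" by (intro rk_less) simp
            then show ?thesis using yd(2) by simp
          qed
          then have "z \<in> Z" using that by (simp add: Z_def)
          then show False using rk_less[OF y(2)] z by blast
        qed
        then have intact: "\<forall>z \<in> set (snd g). if h z \<in> set a then z = r (h z) else z \<notin> ?d (rk y)"
          using False by auto
        have "mk y \<noteq> ?f"
        proof
          assume "mk y = ?f"
          from mp[OF mp[OF bspec[OF conjunct2[OF conjunct2[OF mk[OF yd(2)]]] g] this[symmetric]] yd(1)]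
          show False using intact by contradiction
        qed
        then show ?thesis using yd ya by (intro bexI[of _ y]) simp_all
      qed
      then show ?thesis unfolding marked_def by auto
    qed
  qed
qed

text \<open>Two occurrences of the same free element in \<open>f\<close> are parallel edges, and
  neither of their ends is a leaf.\<close>

lemma forest_free_edges_inj:
  assumes fo: "forest (free_edges a F)" and f: "f \<in> F" "i < length (snd f)" "j < length (snd f)"
    and eq: "snd f ! i = snd f ! j" and na: "snd f ! i \<notin> set a"
  shows "i = j"
proof (rule ccontr)
  assume ne: "i \<noteq> j"
  have sub: "{(f, i), (f, j)} \<subseteq> free_edges a F" using f eq na by (simp add: free_edges_def)
  obtain e v where e: "e \<in> {(f, i), (f, j)}" "v \<in> inc_ends e"
    "\<forall>e' \<in> {(f, i), (f, j)}. v \<in> inc_ends e' \<longrightarrow> e' = e"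
    using mp[OF mp[OF spec[OF fo[unfolded forest_def]] sub] insert_not_empty] by (elim bexE)
  have "v \<in> {Inl (snd f ! j), Inr f}" using e(1,2) by (elim insertE emptyE) (simp_all add: eq)
  then have "(f, i) = e" "(f, j) = e" using e(3) by (simp_all add: eq)
  then show False using ne by auto
qed

text \<open>The domain of an element consists of the live part of its fibre, that of
  \<open>f\<close> of the intact facts over \<open>f\<close>. Stability of \<open>dead\<close> is
  arc consistency from elements to facts, so \<open>forest_csp\<close> provides images for the
  non-distinguished elements; \<open>r\<close> supplies the rest.\<close>

lemma maps_to_goal_if_alive:
  assumes h: "phom h (c, G) (a, F)" and r: "map r a = c"
    and fin: "finite F" and fo: "forest (free_edges a F)"
    and n: "dead h r (set a) F G (Suc n) = dead h r (set a) F G n"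
    and alive: "\<And>f. f \<in> F \<Longrightarrow> \<exists>g \<in> G. map_fact h g = f \<and>
      (\<forall>y \<in> set (snd g). if h y \<in> set a then y = r (h y) else y \<notin> dead h r (set a) F G n)"
  shows "maps_to (a, F) (c, G)"
proof -
  let ?ok = "\<lambda>g. \<forall>y \<in> set (snd g). if h y \<in> set a then y = r (h y) else y \<notin> dead h r (set a) F G n"
  \<comment> \<open>\<open>forest_csp\<close> asks for non-empty domains everywhere;
    \<open>UNIV\<close> serves where nothing is constrained.\<close>
  define X where "X u = (if u \<in> elems F - set a
    then {x \<in> elems G. h x = u \<and> x \<notin> dead h r (set a) F G n} else UNIV)" for u
  define Y where "Y f = (if f \<in> F then {g \<in> G. map_fact h g = f \<and> ?ok g} else UNIV)" for f
  let ?R = "\<lambda>(f :: 'b fact) i x g. snd g ! i = x"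
  have Yne: "Y f \<noteq> {}" for f
  proof (cases "f \<in> F")
    case True
    then show ?thesis using alive[OF True] unfolding Y_def by (simp only: if_True) blast
  qed (simp add: Y_def)
  have arc2: "\<exists>x \<in> X (snd f ! i). snd g ! i = x" if fi: "(f, i) \<in> free_edges a F" and g: "g \<in> Y f" for f i g
  proof -
    have f: "f \<in> F" "i < length (snd f)" "snd f ! i \<notin> set a" using fi by (auto simp: free_edges_def)
    have g': "g \<in> G" "map_fact h g = f" "?ok g" using g f(1) by (auto simp: Y_def)
    have l: "i < length (snd g)" "h (snd g ! i) = snd f ! i" using f(2) g'(2) by auto
    then have "snd g ! i \<in> set (snd g)" by simp
    then have "snd g ! i \<notin> dead h r (set a) F G n" "snd g ! i \<in> elems G"
      using g'(3) f(3) l(2) elemsI[OF g'(1)] by metis+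
    then show ?thesis using l f(3) unfolding X_def by simp
  qed
  have Xne: "X u \<noteq> {}" for u
  proof (cases "u \<in> elems F - set a")
    case True
    then obtain f where f: "f \<in> F" "u \<in> set (snd f)" unfolding elems_def by blast
    then obtain i where "i < length (snd f)" "snd f ! i = u" unfolding in_set_conv_nth by blast
    then have "(f, i) \<in> free_edges a F" using f(1) True by (simp add: free_edges_def)
    moreover obtain g where "g \<in> Y f" using Yne by blast
    ultimately show ?thesis using arc2 \<open>snd f ! i = u\<close> by blast
  next
    case False
    then have "X u = UNIV" unfolding X_def by (rule if_not_P)
    then show ?thesis by simp
  qed
  have arc1: "\<exists>g \<in> Y f. snd g ! i = x" if fi: "(f, i) \<in> free_edges a F" and x: "x \<in> X (snd f ! i)" for f i x
  proof -
    have f: "f \<in> F" "i < length (snd f)" "snd f ! i \<notin> set a" using fi by (auto simp: free_edges_def)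
    have "snd f ! i \<in> elems F" using elemsI[OF f(1)] f(2) by simp
    then have x': "x \<in> elems G" "h x = snd f ! i" "x \<notin> dead h r (set a) F G n"
      using x f(3) by (auto simp: X_def)
    obtain g where g: "g \<in> G" "map_fact h g = f" "x \<in> set (snd g)" "?ok g"
      using not_in_dead[of x h r "set a" F G n f] x' f unfolding n by auto
    obtain j where j: "j < length (snd g)" "snd g ! j = x" using g(3) unfolding in_set_conv_nth by blast
    have jf: "j < length (snd f)" "snd f ! j = snd f ! i" using g(2) j x'(2) by auto
    \<comment> \<open>\<open>x\<close> is only known to occur somewhere in \<open>g\<close>, while
      the constraint speaks of position \<open>i\<close>.\<close>
    have "i = j" by (rule forest_free_edges_inj[OF fo f(1,2) jf(1) jf(2)[symmetric] f(3)])
    moreover have "g \<in> Y f" using g f(1) unfolding Y_def by simp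
    ultimately show ?thesis using j(2) by blast
  qed
  have "\<exists>\<sigma> \<tau>. (\<forall>u. \<sigma> u \<in> X u) \<and> (\<forall>f. \<tau> f \<in> Y f) \<and>
    (\<forall>(f, i) \<in> free_edges a F. snd (\<tau> f) ! i = \<sigma> (snd f ! i))"
    by (rule forest_csp[OF finite_free_edges[OF fin] fo Xne Yne]) (erule (1) arc1, erule (1) arc2)
  then obtain \<sigma> \<tau> where st0: "\<forall>f. \<tau> f \<in> Y f"
    "\<forall>(f, i) \<in> free_edges a F. snd (\<tau> f) ! i = \<sigma> (snd f ! i)" by (elim exE conjE)
  have st: "snd (\<tau> f) ! i = \<sigma> (snd f ! i)" if "(f, i) \<in> free_edges a F" for f i
    using bspec[OF st0(2) that] unfolding split_conv .
  let ?t = "\<lambda>u. if u \<in> set a then r u else \<sigma> u"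
  have "map_fact ?t f = \<tau> f" if f: "f \<in> F" for f
  proof -
    have "\<tau> f \<in> Y f" using st0(1) by blast
    then have g: "\<tau> f \<in> G" "map_fact h (\<tau> f) = f" "?ok (\<tau> f)" using f by (auto simp: Y_def)
    have l: "length (snd (\<tau> f)) = length (snd f)" "fst (\<tau> f) = fst f" using g(2)
      by (metis length_map map_fact_simps(2), metis map_fact_simps(1))
    have "?t (snd f ! i) = snd (\<tau> f) ! i" if i: "i < length (snd f)" for i
    proof -
      have "h (snd (\<tau> f) ! i) = snd f ! i" using g(2) i l(1) by (metis map_fact_simps(2) nth_map)
      moreover have "snd (\<tau> f) ! i \<in> set (snd (\<tau> f))" using i l(1) by simp
      ultimately show ?thesis
        using g(3) st[of f i] f i by (auto simp: free_edges_def split: if_splits)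
    qed
    then have "map ?t (snd f) = snd (\<tau> f)" using l(1) by (intro nth_equalityI) simp_all
    then show ?thesis using l(2) by (intro prod_eqI) simp_all
  qed
  moreover have "\<tau> f \<in> G" if "f \<in> F" for f using st0(1) that unfolding Y_def by (metis (lifting) mem_Collect_eq)
  ultimately have "phom ?t (a, F) (c, G)"
    using r by (auto simp: phom_def)
  then show ?thesis by (auto simp: maps_to_def)
qed

text \<open>\<open>marked\<close> and \<open>doubled\<close> are what the learner knows when it
  stops: every candidate that receives \<open>Q\<close> receives \<open>A\<close>. As candidates
  project to the critical \<open>A\<close>, such a map can be turned into a section. Double covers
  come first, because excluding sections of marked labellings requires a forest.\<close>

theorem no_progress_imp_goal:
  assumes A: "critical (c, G) (a, F)" and fin: "finite F" "finite G"
    and c: "set c \<subseteq> elems G" and acG: "c_acyclic (\<lparr>universe = U, facts = G\<rparr>, c)"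
    and r: "map r a = c"
    and marked: "\<And>f. f \<in> F \<Longrightarrow> maps_to (c, G) (labelling a F (marked (set a) f)) \<Longrightarrow>
      maps_to (a, F) (labelling a F (marked (set a) f))"
    and doubled: "\<And>f i. f \<in> F \<Longrightarrow> i < length (snd f) \<Longrightarrow>
      maps_to (c, G) (labelling a F (doubled (set a) f i)) \<Longrightarrow>
      maps_to (a, F) (labelling a F (doubled (set a) f i))"
  shows "c_acyclic (\<lparr>universe = V, facts = F\<rparr>, a)" "maps_to (a, F) (c, G)"
proof -
  obtain h where h: "phom h (c, G) (a, F)" using A by (auto simp: critical_def maps_to_def)
  have sec: "\<exists>s. phom s (a, F) (labelling a F acc) \<and> (\<forall>u \<in> elems F. fst (s u) = u)"
    if "maps_to (a, F) (labelling a F acc)" for acc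
  proof -
    obtain s where s: "phom s (a, F) (labelling a F acc)"
      using \<open>maps_to (a, F) (labelling a F acc)\<close> by (auto simp: maps_to_def)
    obtain s' where "phom s' (a, F) (labelling a F acc)" "\<And>u. u \<in> elems (snd (a, F)) \<Longrightarrow> fst (s' u) = u"
      using critical_section[OF A _ _ s phom_labelling_fst] fin(1) critical_head_elems[OF A] c by auto
    then show ?thesis by auto
  qed
  show ac: "c_acyclic (\<lparr>universe = V, facts = F\<rparr>, a)"
    unfolding c_acyclic_def split_conv
  proof (intro allI impI, rule ccontr)
    fix vs es assume cyc: "inc_cycle \<lparr>universe = V, facts = F\<rparr> vs es"
      and free: "\<not> (\<exists>x\<in>set a. Inl x \<in> set vs)"
    have "es \<noteq> []" using cyc by (auto simp: inc_cycle_def)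
    then obtain e where "e \<in> set es" by (meson list.set_sel(1))
    moreover obtain f i where "e = (f, i)" by (cases e)
    ultimately have e: "(f, i) \<in> set es" by simp
    then have "f \<in> F" "i < length (snd f)" using cyc by (auto simp: inc_cycle_def inc_edges_def)
    moreover have "maps_to (c, G) (labelling a F (doubled (set a) f i))"
      using maps_to_doubled[OF h fin(2) c_acyclic_imp_forest[OF fin(2) acG] c] .
    ultimately obtain s where "phom s (a, F) (labelling a F (doubled (set a) f i))"
      "\<forall>u \<in> elems F. fst (s u) = u" using doubled sec by blast
    then show False using no_section_doubled[OF cyc _ e] free by blast
  qed
  then have fo: "forest (free_edges a F)" by (rule c_acyclic_imp_forest[OF fin(1)])
  obtain n where n: "dead h r (set a) F G (Suc n) = dead h r (set a) F G n"
    using dead_stable[OF fin(2)] .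
  show "maps_to (a, F) (c, G)"
  proof (rule maps_to_goal_if_alive[OF h r fin(1) fo n], rule ccontr)
    fix f assume f: "f \<in> F" and no: "\<not> (\<exists>g \<in> G. map_fact h g = f \<and>
      (\<forall>y \<in> set (snd g). if h y \<in> set a then y = r (h y) else y \<notin> dead h r (set a) F G n))"
    have "maps_to (c, G) (labelling a F (marked (set a) f))"
      by (rule maps_to_marked[OF h r n]) (use no in blast)
    then obtain s where "phom s (a, F) (labelling a F (marked (set a) f))"
      "\<forall>u \<in> elems F. fst (s u) = u" using marked[OF f] sec by blast
    then show False using no_section_marked[OF fin(1) f fo] by blast
  qed
qed


section \<open>The learning program\<close>

lemma inj_tree_of_bool: "inj tree_of_bool"
  by (auto simp: inj_def tree_of_bool_def)

lemma inj_enc_nat: "inj enc_nat"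
  by (simp add: inj_def enc_nat_inj)

lemma inj_enc_list: "inj e \<Longrightarrow> inj (enc_list e)"
  by (rule injI) (erule enc_list_inj[rotated], erule injD)

lemma inj_enc_pair: "inj ea \<Longrightarrow> inj eb \<Longrightarrow> inj (enc_pair ea eb)"
  by (auto simp: inj_def enc_pair_def)

lemma enc_nat_simps: "enc_nat 0 = Leaf" "enc_nat (Suc n) = Node Leaf (enc_nat n)"
  by (simp_all add: enc_nat_def)

lemma size_enc_nat: "size (enc_nat n) = n"
  by (induction n) (simp_all add: enc_nat_simps)

lemma ptime_Suc:
  assumes "ptime ea enc_nat f" shows "ptime ea enc_nat (\<lambda>ora x. Suc (f ora x))"
proof -
  have "ptime ea (enc_pair (\<lambda>_. Leaf) enc_nat) (\<lambda>ora x. ((), f ora x))"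
    by (rule ptime_pair[OF ptime_const assms])
  then show ?thesis by (rule ptime_recode) (simp add: enc_pair_def enc_nat_simps)
qed

lemma ptime_comp2:
  assumes "ptime (enc_pair eb ec) ed (\<lambda>ora z. g ora (fst z) (snd z))"
    and "ptime ea eb f1" "ptime ea ec f2"
  shows "ptime ea ed (\<lambda>ora x. g ora (f1 ora x) (f2 ora x))"
  using ptime_comp[OF assms(1) ptime_pair[OF assms(2,3)]] by simp

lemma ptime_mem:
  assumes "ptime ea eb f" "ptime ea (enc_list eb) g" "inj eb"
  shows "ptime ea tree_of_bool (\<lambda>ora x. f ora x \<in> set (g ora x))"
proof -
  have *: "ptime (enc_pair ea eb) eb (\<lambda>ora z. f ora (fst z))"
    by (rule ptime_comp[OF assms(1)]) (rule ptime_fst ptime_id)+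
  have "ptime ea tree_of_bool (\<lambda>ora x. \<exists>y\<in>set (g ora x). f ora x = y)"
    by (rule ptime_Bex[OF assms(2)], rule ptime_eq[OF * _ assms(3)], rule ptime_snd, rule ptime_id)
  then show ?thesis by simp
qed

text \<open>\<open>hd []\<close> is unspecified, so a default has to be supplied;
  \<open>label_tuples\<close> and \<open>initial\<close> are written in exactly this form.\<close>

lemma ptime_hd:
  assumes f: "ptime ea (enc_list eb) f" and g: "ptime ea eb g"
  shows "ptime ea eb (\<lambda>ora x. if f ora x \<noteq> [] then hd (f ora x) else g ora x)"
proof -
  obtain l where l: "\<And>ora c. size (enc_list eb (f ora c)) \<le> poly l (size (ea c))"
    using ptime_size[OF f] by blast
  obtain r where r: "\<And>ora c. size (eb (g ora c)) \<le> poly r (size (ea c))"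
    using ptime_size[OF g] by blast
  have *: "foldr (\<lambda>x _. x) ys y = (if ys \<noteq> [] then hd ys else y)" for y :: 'b and ys
    by (cases ys) simp_all
  have "ptime ea eb (\<lambda>ora c. foldr (\<lambda>x _. x) (f ora c) (g ora c))"
  proof (rule ptime_foldr[OF f g, where b = "\<lambda>n. poly l n + poly r n"])
    show "ptime (enc_pair ea (enc_pair eb eb)) eb (\<lambda>ora z. fst (snd z))"
      by (rule ptime_fst ptime_snd ptime_id)+
    fix ora c ys zs assume a: "f ora c = zs @ ys"
    show "size (eb (foldr (\<lambda>x _. x) ys (g ora c))) \<le> poly l (size (ea c)) + poly r (size (ea c))"
    proof (cases ys)
      case (Cons y ys')
      then have "size (eb y) \<le> size (enc_list eb (f ora c))" using a by (simp add: size_enc_list)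
      then show ?thesis using Cons l[of ora c] by simp
    qed (use r[of ora c] in simp)
  qed (intro poly_bounded_add poly_bounded_poly)
  then show ?thesis by (simp only: *)
qed

lemma ptime_length:
  assumes f: "ptime ea (enc_list eb) f"
  shows "ptime ea enc_nat (\<lambda>ora x. length (f ora x))"
proof -
  obtain l where l: "\<And>ora c. size (enc_list eb (f ora c)) \<le> poly l (size (ea c))"
    using ptime_size[OF f] by blast
  have *: "foldr (\<lambda>_. Suc) ys 0 = length ys" for ys :: "'b list" by (induction ys) simp_all
  have "ptime ea enc_nat (\<lambda>ora c. foldr (\<lambda>_. Suc) (f ora c) 0)"
  proof (rule ptime_foldr[OF f ptime_const, where b = "poly l"])
    show "ptime (enc_pair ea (enc_pair eb enc_nat)) enc_nat (\<lambda>ora z. Suc (snd (snd z)))"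
      by (rule ptime_Suc ptime_snd ptime_id)+
    fix ora c ys zs assume a: "f ora c = zs @ ys"
    show "size (enc_nat (foldr (\<lambda>_. Suc) ys 0)) \<le> poly l (size (ea c))"
      using length_le_size_enc_list[of "f ora c" eb] l[of ora c] a by (simp add: * size_enc_nat)
  qed auto
  then show ?thesis by (simp only: *)
qed

lemma ptime_remdups:
  assumes f: "ptime ea (enc_list eb) f" and inj: "inj eb"
  shows "ptime ea (enc_list eb) (\<lambda>ora x. remdups (f ora x))"
proof -
  obtain l where l: "\<And>ora c. size (enc_list eb (f ora c)) \<le> poly l (size (ea c))"
    using ptime_size[OF f] by blast
  let ?s = "\<lambda>x acc. if x \<in> set acc then acc else x # acc"
  have *: "foldr ?s ys [] = remdups ys" for ys :: "'b list" by (induction ys) simp_all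
  have sz: "size (enc_list eb (remdups ys)) \<le> size (enc_list eb ys)" for ys by (induction ys) auto
  have "ptime ea (enc_list eb) (\<lambda>ora c. foldr ?s (f ora c) [])"
  proof (rule ptime_foldr[OF f ptime_const, where b = "poly l"])
    show "ptime (enc_pair ea (enc_pair eb (enc_list eb))) (enc_list eb)
      (\<lambda>ora z. if fst (snd z) \<in> set (snd (snd z)) then snd (snd z) else fst (snd z) # snd (snd z))"
      by (rule ptime_if ptime_mem ptime_Cons inj ptime_fst ptime_snd ptime_id)+
    fix ora c ys zs assume a: "f ora c = zs @ ys"
    show "size (enc_list eb (foldr ?s ys [])) \<le> poly l (size (ea c))"
      using l[of ora c] sz[of ys] a by (simp add: * size_enc_list)
  qed auto
  then show ?thesis by (simp only: *)
qed


section \<open>Operations of the learner\<close>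

text \<open>Written as a fold to fit \<open>ptime_foldr\<close>. Without an occurrence, the result
  is the length of the list.\<close>

definition idx :: "'a list \<Rightarrow> 'a \<Rightarrow> nat" where
  "idx xs x = foldr (\<lambda>y n. if y = x then 0 else Suc n) xs 0"

definition occs :: "'a list \<times> 'a fact list \<Rightarrow> 'a list" where
  "occs q = fst q @ concat (map snd (snd q))"

text \<open>Labelled elements are turned back into numbers. As numbers are encoded in unary, using
  positions in \<open>occs q\<close> keeps every element below the number of occurrences.\<close>

definition rename :: "'a list \<times> 'a fact list \<Rightarrow> nat list \<times> nat fact list" where
  "rename q = (map (idx (occs q)) (fst q), map (\<lambda>f. (fst f, map (idx (occs q)) (snd f))) (snd q))"

definition positive :: "(tree \<Rightarrow> bool) \<Rightarrow> nat list \<times> nat fact list \<Rightarrow> bool" where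
  "positive ora q \<longleftrightarrow> ora (enc_pointed (occs q) (snd q) (fst q))"

definition minimise ::
  "(tree \<Rightarrow> bool) \<Rightarrow> nat list \<times> nat fact list \<Rightarrow> nat list \<times> nat fact list" where
  "minimise ora q = (fst q, foldr (\<lambda>f gs. if positive ora (fst q, filter (\<lambda>g. g \<noteq> f) gs)
     then filter (\<lambda>g. g \<noteq> f) gs else gs) (snd q) (remdups (snd q)))"

definition reduce ::
  "(tree \<Rightarrow> bool) \<Rightarrow> nat list \<times> nat fact list \<Rightarrow> nat list \<times> nat fact list" where
  "reduce ora q = rename (minimise ora q)"

definition label_list :: "'a fact list \<Rightarrow> 'a \<Rightarrow> 'a fact list list" where
  "label_list fs u = [] # map (\<lambda>f. [f]) (filter (\<lambda>f. u \<in> set (snd f)) fs)"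

text \<open>Only lists of length at most \<open>n\<close> are labelled completely; the number of labellings is then
  polynomial for fixed \<open>n\<close>.\<close>

fun label_tuples :: "nat \<Rightarrow> nat fact list \<Rightarrow> nat list \<Rightarrow> (nat \<times> nat fact list) list list" where
  "label_tuples 0 fs us = [[]]"
| "label_tuples (Suc n) fs us = (if us \<noteq> [] then concat (map (\<lambda>l. map (\<lambda>xs.
     (if us \<noteq> [] then hd us else 0, l) # xs) (label_tuples n fs (tl us)))
     (label_list fs (if us \<noteq> [] then hd us else 0))) else [[]])"

definition label_struct :: "nat \<Rightarrow> nat list \<times> nat fact list \<Rightarrow>
    (nat fact \<Rightarrow> (nat \<times> nat fact list) list \<Rightarrow> bool) \<Rightarrow>
    (nat \<times> nat fact list) list \<times> (nat \<times> nat fact list) fact list" where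
  "label_struct n q acc = (map (\<lambda>u. (u, [])) (fst q),
     concat (map (\<lambda>f. map (\<lambda>xs. (fst f, xs)) (filter (acc f) (label_tuples n (snd q) (snd f)))) (snd q)))"

text \<open>Positions are counted from the end of the list.\<close>

definition tag :: "'a list \<Rightarrow> (nat \<times> 'a) list" where
  "tag xs = foldr (\<lambda>x ys. (length ys, x) # ys) xs []"

text \<open>Program version of \<open>doubled\<close>: both quantifiers range over lists, and
  positions come from \<open>tag\<close>.\<close>

definition doubled_tag ::
  "'a set \<Rightarrow> 'a fact \<Rightarrow> nat \<Rightarrow> 'a fact \<Rightarrow> ('a \<times> 'a fact list) list \<Rightarrow> bool" where
  "doubled_tag D f0 t f xs \<longleftrightarrow> (\<exists>b \<in> set [False, True]. \<forall>z \<in> set (tag xs).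
     fst (snd z) \<in> D \<or> (snd (snd z) \<noteq> []) = (b \<noteq> (f = f0 \<and> fst z = t)))"

definition candidates :: "nat \<Rightarrow> nat list \<times> nat fact list \<Rightarrow> (nat list \<times> nat fact list) list" where
  "candidates n q =
     map (\<lambda>f. rename (label_struct n q (\<lambda>g xs. marked (set (fst q)) f g xs))) (snd q) @
     concat (map (\<lambda>f. map (\<lambda>z. rename (label_struct n q (\<lambda>g xs. doubled_tag (set (fst q)) f (fst z) g xs)))
       (tag (snd f))) (snd q))"

text \<open>One entry of the second list is cancelled for every entry of the first, so numbers of
  elements are compared without arithmetic. This replaces a homomorphism test for progress.\<close>

definition grows :: "nat list \<times> nat fact list \<Rightarrow> nat list \<times> nat fact list \<Rightarrow> bool" where
  "grows q q' \<longleftrightarrow> foldr (\<lambda>_. tl) (remdups (occs q)) (remdups (occs q')) \<noteq> []"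

definition improvements ::
  "nat \<Rightarrow> (tree \<Rightarrow> bool) \<Rightarrow> nat list \<times> nat fact list \<Rightarrow> (nat list \<times> nat fact list) list" where
  "improvements n ora q = filter (grows q) (map (reduce ora) (filter (positive ora) (candidates n q)))"


section \<open>Running times of the operations\<close>

abbreviation "enc_f e \<equiv> enc_pair enc_nat (enc_list e)"
abbreviation "enc_q e \<equiv> enc_pair (enc_list e) (enc_list (enc_f e))"
abbreviation "enc_le \<equiv> enc_pair enc_nat (enc_list (enc_f enc_nat))"

lemma enc_fact_conv: "enc_fact = enc_f enc_nat"
  by (rule ext) (simp add: enc_fact_def enc_pair_def enc_tuple_def split: prod.split)

lemmas inj_encs = inj_tree_of_bool inj_enc_nat inj_enc_list inj_enc_pair

lemmas ptime_intros = ptime_id ptime_fst ptime_snd ptime_pair ptime_Cons ptime_append ptime_concat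
  ptime_map ptime_filter ptime_Ball ptime_Bex ptime_hd ptime_if ptime_tl ptime_not_Nil ptime_conj ptime_disj
  ptime_not ptime_mem ptime_eq ptime_Suc ptime_length ptime_remdups inj_encs

lemma ptime_idx:
  assumes "inj e" "ptime ea (enc_list e) f" "ptime ea e g"
  shows "ptime ea enc_nat (\<lambda>ora x. idx (f ora x) (g ora x))"
proof -
  have le: "foldr (\<lambda>y n. if y = x then 0 else Suc n) ys 0 \<le> length ys" for x :: 'a and ys
    by (induction ys) auto
  have "ptime (enc_pair (enc_list e) e) enc_nat
    (\<lambda>ora z. foldr (\<lambda>y n. if y = snd z then 0 else Suc n) (fst z) 0)"
  proof (rule ptime_foldr[where b = "\<lambda>n. n" and eb = e])
    show "ptime (enc_pair (enc_pair (enc_list e) e) (enc_pair e enc_nat)) enc_nat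
     (\<lambda>ora z. if fst (snd z) = snd (fst z) then 0 else Suc (snd (snd z)))"
      by (rule ptime_if ptime_eq ptime_const ptime_intros assms(1))+
    fix ora and c :: "'a list \<times> 'a" and ys zs assume a: "fst c = zs @ ys"
    show "size (enc_nat (foldr (\<lambda>y n. if y = snd c then 0 else Suc n) ys 0))
        \<le> size (enc_pair (enc_list e) e c)"
      using le[of "snd c" ys] a length_le_size_enc_list[of "fst c" e] by (simp add: size_enc_nat enc_pair_def)
  qed (rule ptime_const ptime_intros poly_bounded_id)+
  then show ?thesis unfolding idx_def[symmetric] by (rule ptime_comp2) (rule assms)+
qed

lemma ptime_occs:
  assumes "ptime ea (enc_q e) f" shows "ptime ea (enc_list e) (\<lambda>ora x. occs (f ora x))"
  by (rule ptime_comp[OF _ assms, where g = "\<lambda>_. occs"]) (unfold occs_def, (rule ptime_intros)+)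

lemma ptime_rename:
  assumes "inj e" "ptime ea (enc_q e) f" shows "ptime ea (enc_q enc_nat) (\<lambda>ora x. rename (f ora x))"
  by (rule ptime_comp[OF _ assms(2), where g = "\<lambda>_. rename"])
    (unfold rename_def, (rule assms(1) ptime_idx ptime_occs ptime_intros)+)

lemma ptime_positive:
  assumes "ptime ea (enc_q enc_nat) f" shows "ptime ea tree_of_bool (\<lambda>ora x. positive ora (f ora x))"
proof -
  have "ptime (enc_q enc_nat) (enc_pair (enc_list enc_nat) (enc_pair (enc_list (enc_f enc_nat)) (enc_list enc_nat)))
    (\<lambda>ora q. (occs q, snd q, fst q))"
    by (rule ptime_occs ptime_intros)+
  from ptime_oracle[OF this] have "ptime (enc_q enc_nat) tree_of_bool positive"
    by (rule ptime_recode) (simp add: positive_def enc_pointed_def enc_pair_def enc_tuple_def enc_fact_conv)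
  from ptime_comp[OF this assms] show ?thesis .
qed

lemma ptime_minimise: "ptime (enc_q enc_nat) (enc_q enc_nat) minimise"
proof -
  let ?s = "\<lambda>ora q f gs. if positive ora (fst q, filter (\<lambda>g. g \<noteq> f) gs)
     then filter (\<lambda>g. g \<noteq> f) gs else gs"
  let ?e = "enc_list (enc_f enc_nat)"
  have flt: "size (?e (filter P gs)) \<le> size (?e gs)" for P gs
    by (induction gs) auto
  have rd: "size (?e (remdups gs)) \<le> size (?e gs)" for gs
    by (induction gs) auto
  have "ptime (enc_q enc_nat) (enc_list (enc_f enc_nat))
     (\<lambda>ora q. foldr (?s ora q) (snd q) (remdups (snd q)))"
  proof (rule ptime_foldr[where b = "\<lambda>n. n" and eb = "enc_f enc_nat"])
    fix ora and q :: "nat list \<times> nat fact list" and ys zs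
    have "size (?e (foldr (?s ora q) ys (remdups (snd q)))) \<le> size (?e (remdups (snd q)))"
    proof (induction ys)
      case (Cons y ys)
      then show ?case using le_trans[OF flt Cons.IH] by simp
    qed simp
    also have "\<dots> \<le> size (enc_q enc_nat q)" using rd[of "snd q"] by (simp add: enc_pair_def)
    finally show "size (?e (foldr (?s ora q) ys (remdups (snd q)))) \<le> size (enc_q enc_nat q)" .
  qed (rule ptime_positive ptime_intros poly_bounded_id)+
  then show ?thesis unfolding minimise_def[abs_def] by (intro ptime_pair) (rule ptime_intros)+
qed

lemma ptime_reduce:
  assumes "ptime ea (enc_q enc_nat) f" shows "ptime ea (enc_q enc_nat) (\<lambda>ora x. reduce ora (f ora x))"
  unfolding reduce_def
  by (rule ptime_rename[OF inj_enc_nat ptime_comp[OF ptime_minimise assms]])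

lemma ptime_label_list:
  assumes "ptime ea (enc_list (enc_f enc_nat)) f" "ptime ea enc_nat g"
  shows "ptime ea (enc_list (enc_list (enc_f enc_nat))) (\<lambda>ora x. label_list (f ora x) (g ora x))"
  by (rule ptime_comp2[OF _ assms, where g = "\<lambda>_. label_list"])
    (unfold label_list_def, (rule ptime_const ptime_intros)+)

text \<open>The bound \<open>n\<close> on the arities is a constant of the program. Recursion on
  \<open>n\<close> takes place outside the language: each \<open>n\<close> gets its own program,
  with a polynomial of its own.\<close>

lemma ptime_label_tuples:
  "ptime (enc_pair (enc_list (enc_f enc_nat)) (enc_list enc_nat)) (enc_list (enc_list enc_le))
    (\<lambda>ora z. label_tuples n (fst z) (snd z))"
proof (induction n)
  case 0
  show ?case unfolding label_tuples.simps by (rule ptime_const)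
next
  case (Suc n)
  have IH: "ptime ea (enc_list (enc_list enc_le)) (\<lambda>ora x. label_tuples n (f ora x) (g ora x))"
    if "ptime ea (enc_list (enc_f enc_nat)) f" "ptime ea (enc_list enc_nat) g" for ea f g
    by (rule ptime_comp2[OF Suc that])
  show ?case unfolding label_tuples.simps
    by (rule IH ptime_label_list ptime_const ptime_intros)+
qed


lemma ptime_label_struct:
  assumes q: "ptime ea (enc_q enc_nat) q"
    and acc: "ptime (enc_pair (enc_pair ea (enc_f enc_nat)) (enc_list enc_le)) tree_of_bool
      (\<lambda>ora z. acc ora (fst (fst z)) (snd (fst z)) (snd z))"
  shows "ptime ea (enc_q enc_le) (\<lambda>ora x. label_struct n (q ora x) (acc ora x))"
proof -
  have q': "ptime (enc_pair ea (enc_f enc_nat)) (enc_q enc_nat) (\<lambda>ora z. q ora (fst z))"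
    by (rule ptime_comp[OF q]) (rule ptime_intros)+
  show ?thesis unfolding label_struct_def
  proof (rule ptime_pair)
    show "ptime ea (enc_list enc_le) (\<lambda>ora x. map (\<lambda>u. (u, [])) (fst (q ora x)))"
      by (rule q ptime_const ptime_intros)+
    have t: "ptime (enc_pair ea (enc_f enc_nat)) (enc_list (enc_list enc_le))
        (\<lambda>ora z. filter (acc ora (fst z) (snd z)) (label_tuples n (snd (q ora (fst z))) (snd (snd z))))"
      by (rule ptime_filter[OF ptime_comp2[OF ptime_label_tuples]])
        (rule acc ptime_snd[OF q'] ptime_intros)+
    have "ptime (enc_pair ea (enc_f enc_nat)) (enc_list (enc_f enc_le))
      (\<lambda>ora z. map (\<lambda>xs. (fst (snd z), xs)) (filter (acc ora (fst z) (snd z))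
        (label_tuples n (snd (q ora (fst z))) (snd (snd z)))))"
      by (rule ptime_map[OF t]) (rule ptime_intros)+
    then show "ptime ea (enc_list (enc_f enc_le)) (\<lambda>ora x. concat (map (\<lambda>f. map (\<lambda>xs. (fst f, xs))
        (filter (acc ora x f) (label_tuples n (snd (q ora x)) (snd f)))) (snd (q ora x))))"
      by (rule ptime_concat[OF ptime_map[OF ptime_snd[OF q]]])
  qed
qed

lemma ptime_tag:
  assumes "ptime ea (enc_list e) f" shows "ptime ea (enc_list (enc_pair enc_nat e)) (\<lambda>ora x. tag (f ora x))"
proof -
  obtain l where l: "\<And>ora c. size (enc_list e (f ora c)) \<le> poly l (size (ea c))"
    using ptime_size[OF assms] by blast
  let ?s = "\<lambda>x ys. (length ys, x) # ys"
  let ?b = "\<lambda>n. n * (n + n + 1 + 1)"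
  have t: "length (foldr ?s ys []) = length ys \<and>
      (\<forall>z \<in> set (foldr ?s ys []). fst z \<le> length ys \<and> snd z \<in> set ys)" for ys :: "'b list"
    by (induction ys) auto
  have "ptime ea (enc_list (enc_pair enc_nat e)) (\<lambda>ora c. foldr ?s (f ora c) [])"
  proof (rule ptime_foldr[OF assms ptime_const, where b = "\<lambda>n. ?b (poly l n)"])
    show "ptime (enc_pair ea (enc_pair e (enc_list (enc_pair enc_nat e)))) (enc_list (enc_pair enc_nat e))
      (\<lambda>ora z. (length (snd (snd z)), fst (snd z)) # snd (snd z))"
      by (rule ptime_intros)+
    fix ora c ys zs assume a: "f ora c = zs @ ys"
    let ?n = "size (enc_list e ys)"
    have n: "?n \<le> poly l (size (ea c))" using l[of ora c] a by (simp add: size_enc_list)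
    have "size (enc_pair enc_nat e z) \<le> ?n + ?n + 1" if "z \<in> set (foldr ?s ys [])" for z
    proof -
      have z: "fst z \<le> length ys" "snd z \<in> set ys" using t[of ys] that by blast+
      have "fst z \<le> ?n" using z(1) length_le_size_enc_list le_trans by blast
      moreover have "size (e (snd z)) \<le> ?n" using z(2) by (rule size_le_size_enc_list)
      ultimately show ?thesis by (simp add: enc_pair_def size_enc_nat)
    qed
    then have "size (enc_list (enc_pair enc_nat e) (foldr ?s ys [])) \<le> length ys * (?n + ?n + 1 + 1)"
      using size_enc_list_le[of "foldr ?s ys []" "enc_pair enc_nat e" "?n + ?n + 1"] t[of ys] by simp
    also have "\<dots> \<le> ?b ?n" by (intro mult_le_mono length_le_size_enc_list le_refl)
    also have "\<dots> \<le> ?b (poly l (size (ea c)))" using n by (intro mult_le_mono add_mono) simp_all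
    finally show "size (enc_list (enc_pair enc_nat e) (foldr ?s ys [])) \<le> ?b (poly l (size (ea c)))" .
  qed (intro poly_bounded_mult poly_bounded_add poly_bounded_const poly_bounded_poly)
  then show ?thesis unfolding tag_def .
qed

lemma ptime_candidates: "ptime (enc_q enc_nat) (enc_list (enc_q enc_nat)) (\<lambda>_. candidates n)"
proof -
  have inj: "inj enc_le" by (rule inj_encs)+
  have m: "ptime (enc_pair (enc_q enc_nat) (enc_f enc_nat)) (enc_q enc_le)
    (\<lambda>ora z. label_struct n (fst z) (\<lambda>g xs. marked (set (fst (fst z))) (snd z) g xs))"
    by (rule ptime_label_struct) (unfold marked_def, (rule ptime_const ptime_intros)+)
  have d: "ptime (enc_pair (enc_pair (enc_q enc_nat) (enc_f enc_nat)) (enc_pair enc_nat enc_nat)) (enc_q enc_le)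
    (\<lambda>ora z. label_struct n (fst (fst z))
      (\<lambda>g xs. doubled_tag (set (fst (fst (fst z)))) (snd (fst z)) (fst (snd z)) g xs))"
    by (rule ptime_label_struct)
      (unfold doubled_tag_def, (rule ptime_tag ptime_const[where eb = "enc_list tree_of_bool"] ptime_intros)+)
  show ?thesis unfolding candidates_def[abs_def]
    by (rule ptime_rename[OF inj m] ptime_rename[OF inj d] ptime_tag ptime_intros)+
qed

lemma ptime_grows: "ptime (enc_pair (enc_q enc_nat) (enc_q enc_nat)) tree_of_bool (\<lambda>_ z. grows (fst z) (snd z))"
proof -
  let ?e = "enc_pair (enc_q enc_nat) (enc_q enc_nat)"
  have f: "ptime ?e (enc_list enc_nat) (\<lambda>ora z. remdups (occs (snd z)))"
    by (rule ptime_occs ptime_intros)+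
  obtain l where l: "\<And>(ora :: tree \<Rightarrow> bool) c. size (enc_list enc_nat (remdups (occs (snd c)))) \<le> poly l (size (?e c))"
    using ptime_size[OF f] by blast
  have tl: "size (enc_list enc_nat (tl xs)) \<le> size (enc_list enc_nat xs)" for xs by (cases xs) simp_all
  have fold: "size (enc_list enc_nat (foldr (\<lambda>_. tl) ys xs)) \<le> size (enc_list enc_nat xs)" for ys :: "nat list" and xs
  proof (induction ys)
    case (Cons y ys)
    then show ?case using le_trans[OF tl] by simp
  qed simp
  have "ptime ?e (enc_list enc_nat)
    (\<lambda>ora z. foldr (\<lambda>_. tl) (remdups (occs (fst z))) (remdups (occs (snd z))))"
  proof (rule ptime_foldr[OF _ f, where b = "poly l" and eb = enc_nat])
    show "ptime ?e (enc_list enc_nat) (\<lambda>ora z. remdups (occs (fst z)))"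
      by (rule ptime_occs ptime_intros)+
    show "ptime (enc_pair ?e (enc_pair enc_nat (enc_list enc_nat))) (enc_list enc_nat) (\<lambda>ora z. tl (snd (snd z)))"
      by (rule ptime_intros)+
    show "size (enc_list enc_nat (foldr (\<lambda>_. tl) ys (remdups (occs (snd c))))) \<le> poly l (size (?e c))"
      for c and ys :: "nat list" using le_trans[OF fold l] .
  qed auto
  then show ?thesis unfolding grows_def by (rule ptime_not_Nil)
qed

lemma ptime_improvements: "ptime (enc_q enc_nat) (enc_list (enc_q enc_nat)) (improvements n)"
  unfolding improvements_def[abs_def]
  by (rule ptime_filter[OF _ ptime_grows] ptime_reduce ptime_positive ptime_candidates ptime_intros)+


text \<open>The running time of the loop is measured by the sizes of the states it passes through, of
  which the input size gives no bound.\<close>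

lemma iterate_program:
  assumes init: "ptime eu es init" and step: "ptime es (enc_list es) step"
  obtains P p where "\<forall>ora Inv \<mu> M s. Inv (init ora x0) \<longrightarrow>
    (\<forall>q. Inv q \<longrightarrow> size (es q) \<le> s \<and> \<mu> q \<le> M) \<longrightarrow>
    (\<forall>q. Inv q \<longrightarrow> step ora q \<noteq> [] \<longrightarrow> Inv (hd (step ora q)) \<and> \<mu> q < (\<mu> (hd (step ora q)) :: nat)) \<longrightarrow>
    (\<exists>q t. Inv q \<and> step ora q = [] \<and> runs ora P (es q) t \<and> t \<le> (M + 2) * poly p s + poly p 0)"
proof -
  have "ptime eu es (\<lambda>ora x. init ora x0)" by (rule ptime_comp[OF init ptime_const])
  then obtain pi where pi: "\<And>fs. \<exists>gs e. \<forall>hs ora x env. \<exists>t \<le> poly pi (size (eu x)).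
     eval ora (fs @ gs @ hs) (eu x # env) e (es (init ora x0)) t"
    unfolding ptime_def by blast
  obtain ps where ps: "\<And>fs. \<exists>gs e. \<forall>hs ora q env. \<exists>t \<le> poly ps (size (es q)).
     eval ora (fs @ gs @ hs) (es q # env) e (enc_list es (step ora q)) t"
    using step unfolding ptime_def by blast
  obtain gs1 e1 where e1: "\<And>hs ora x env. \<exists>t \<le> poly pi (size (eu x)).
     eval ora (gs1 @ hs) (eu x # env) e1 (es (init ora x0)) t"
    using pi[of "[]"] unfolding append_Nil by blast
  obtain gs2 e2 where e2: "\<And>hs ora q env. \<exists>t \<le> poly ps (size (es q)).
     eval ora (gs1 @ gs2 @ hs) (es q # env) e2 (enc_list es (step ora q)) t"
    using ps[of gs1] by blast
  let ?f = "length (gs1 @ gs2)"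
  \<comment> \<open>\<open>Var 0\<close> is the list of successors, \<open>Var 1\<close> the current
    state, which is returned if there is no successor.\<close>
  let ?body = "LetIn e2 (Cond (Var 0) (Call ?f (First (Var 0))) (Var 1))"
  let ?G = "gs1 @ gs2 @ [?body]"
  obtain c where c: "\<And>ora env. eval ora ?G env (quote_tree (eu x0)) (eu x0) c"
    using eval_quote_tree[of "eu x0"] by blast
  let ?P = "(?G, Call ?f (LetIn (quote_tree (eu x0)) e1))"
  \<comment> \<open>The added constant pays for fixed overhead: \<open>poly p 0\<close> covers the
    start, \<open>poly p s\<close> the at most 6 extra steps of each round.\<close>
  define p where "p = ps + [:10 + c + poly pi (size (eu x0)):]"
  have G: "?f < length ?G" "?G ! ?f = ?body" by (simp_all add: nth_append)
  have loop: "\<exists>q' t. Inv q' \<and> step ora q' = [] \<and> eval ora ?G [es q] ?body (es q') t \<and>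
      t \<le> (M + 1 - \<mu> q) * (poly ps s + 6)"
    if Inv: "Inv q"
      and sz: "\<And>q. Inv q \<Longrightarrow> size (es q) \<le> s \<and> \<mu> q \<le> M"
      and prog: "\<And>q. Inv q \<Longrightarrow> step ora q \<noteq> [] \<Longrightarrow> Inv (hd (step ora q)) \<and> \<mu> q < \<mu> (hd (step ora q))"
    for ora Inv and \<mu> :: "'b \<Rightarrow> nat" and M s q
    using Inv
  \<comment> \<open>Each further round raises \<open>\<mu>\<close>, which is bounded by
    \<open>M\<close>, so at most \<open>M + 1 - \<mu> q\<close> rounds remain, including the last
    one.\<close>
  proof (induction "M - \<mu> q" arbitrary: q rule: less_induct)
    case less
    obtain t where t: "t \<le> poly ps (size (es q))"
      "eval ora ?G [es q] e2 (enc_list es (step ora q)) t"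
      using e2[of q ora "[?body]" "[]"] by blast
    have ts: "t \<le> poly ps s" using t(1) poly_nat_mono[of "size (es q)" s ps] sz[OF less.prems] le_trans by blast
    let ?v = "enc_list es (step ora q)"
    have v0: "eval ora ?G [?v, es q] (Var 0) ?v 1" using eval_Var[of 0 "[?v, es q]"] by simp
    have v1: "eval ora ?G [?v, es q] (Var 1) (es q) 1" using eval_Var[of 1 "[?v, es q]"] by simp
    have mu: "\<mu> q \<le> M" using sz[OF less.prems] by blast
    show ?case
    proof (cases "step ora q")
      case Nil
      then have "eval ora ?G [?v, es q] (Cond (Var 0) (Call ?f (First (Var 0))) (Var 1)) (es q) (1 + 1 + 1)"
        using v0 v1 by (intro eval_Cond_false) simp_all
      from eval_LetIn[OF t(2) this]
      have "eval ora ?G [es q] ?body (es q) (t + (1 + 1 + 1) + 1)" .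
      moreover have "t + (1 + 1 + 1) + 1 \<le> 1 * (poly ps s + 6)" using ts by simp
      moreover have "1 * (poly ps s + 6) \<le> (M + 1 - \<mu> q) * (poly ps s + 6)"
        using mu by (intro mult_le_mono1) simp
      ultimately show ?thesis using less.prems Nil le_trans by blast
    next
      case (Cons q1 qs)
      have p1: "Inv q1" "\<mu> q < \<mu> q1" using prog[OF less.prems] Cons by simp_all
      have mu1: "\<mu> q1 \<le> M" using sz[OF p1(1)] by blast
      have "M - \<mu> q1 < M - \<mu> q" using p1(2) mu1 by simp
      then obtain q' u where u: "Inv q'" "step ora q' = []" "eval ora ?G [es q1] ?body (es q') u"
        "u \<le> (M + 1 - \<mu> q1) * (poly ps s + 6)"
        using less.hyps[OF _ p1(1)] by blast
      have "eval ora ?G [?v, es q] (First (Var 0)) (es q1) (1 + 1)"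
        using eval_First[OF v0] Cons by simp
      then have "eval ora ?G [?v, es q] (Call ?f (First (Var 0))) (es q') (1 + 1 + u + 1)"
        by (rule eval_Call[OF G(1)]) (use u(3) G(2) in simp)
      then have "eval ora ?G [?v, es q] (Cond (Var 0) (Call ?f (First (Var 0))) (Var 1)) (es q') (1 + (1 + 1 + u + 1) + 1)"
        by (rule eval_Cond_true[OF v0, rotated]) (simp add: Cons)
      from eval_LetIn[OF t(2) this]
      have "eval ora ?G [es q] ?body (es q') (t + (1 + (1 + 1 + u + 1) + 1) + 1)" .
      moreover have "t + (1 + (1 + 1 + u + 1) + 1) + 1 \<le> (M + 1 - \<mu> q1 + 1) * (poly ps s + 6)"
        using ts u(4) by simp
      moreover have "(M + 1 - \<mu> q1 + 1) * (poly ps s + 6) \<le> (M + 1 - \<mu> q) * (poly ps s + 6)"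
        using mu1 p1(2) by (intro mult_le_mono1) simp
      ultimately show ?thesis using u(1,2) le_trans by blast
    qed
  qed
  show ?thesis
  proof (rule that[of ?P p], intro allI impI)
    fix ora Inv and \<mu> :: "'b \<Rightarrow> nat" and M s
    assume I: "Inv (init ora x0)"
      and sz: "\<forall>q. Inv q \<longrightarrow> size (es q) \<le> s \<and> \<mu> q \<le> M"
      and prog: "\<forall>q. Inv q \<longrightarrow> step ora q \<noteq> [] \<longrightarrow> Inv (hd (step ora q)) \<and> \<mu> q < \<mu> (hd (step ora q))"
    obtain q' t where q': "Inv q'" "step ora q' = []"
      "eval ora ?G [es (init ora x0)] ?body (es q') t"
      "t \<le> (M + 1 - \<mu> (init ora x0)) * (poly ps s + 6)"
      using loop[of Inv, OF I] sz prog by blast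
    obtain u where u: "u \<le> poly pi (size (eu x0))" "eval ora ?G [eu x0] e1 (es (init ora x0)) u"
      using e1[of x0 ora "gs2 @ [?body]" "[]"] by blast
    have "eval ora ?G [] (Call ?f (LetIn (quote_tree (eu x0)) e1)) (es q') (c + u + 1 + t + 1)"
      by (rule eval_Call[OF G(1) eval_LetIn[OF c u(2)]]) (use q'(3) G(2) in simp)
    then have "runs ora ?P (es q') (c + u + 1 + t + 1)" by (simp only: runs_def fst_conv snd_conv)
    moreover have "c + u + 1 + t + 1 \<le> (M + 2) * poly p s + poly p 0"
    proof -
      have "t \<le> (M + 2) * (poly ps s + 6)"
        using q'(4) by (rule le_trans) (intro mult_le_mono1, simp)
      also have "\<dots> \<le> (M + 2) * poly p s" by (intro mult_le_mono2) (simp add: p_def)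
      finally show ?thesis using u(1) by (simp add: p_def)
    qed
    ultimately show "\<exists>q t. Inv q \<and> step ora q = [] \<and> runs ora ?P (es q) t \<and> t \<le> (M + 2) * poly p s + poly p 0"
      using q'(1,2) by blast
  qed
qed


section \<open>Correctness of the learning program\<close>

abbreviation "sem q \<equiv> (fst q, set (snd q))"

definition valid :: "schema \<Rightarrow> nat \<Rightarrow> 'a list \<times> 'a fact list \<Rightarrow> bool" where
  "valid S k q \<longleftrightarrow> length (fst q) = k \<and>
     (\<forall>f \<in> set (snd q). fst f \<in> symbols S \<and> length (snd f) = arity S (fst f))"

lemma set_occs: "set (occs q) = set (fst q) \<union> elems (set (snd q))"
  by (auto simp: occs_def elems_def)

lemma maps_to_mono: "maps_to Q (a, F) \<Longrightarrow> F \<subseteq> F' \<Longrightarrow> maps_to Q (a, F')"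
  unfolding maps_to_def phom_def by fastforce

text \<open>The universe of \<open>canonical q\<close> consists of the variables of the body, so the
  condition on universes follows from the one on facts. Membership can thus be expressed by
  \<open>maps_to\<close>, without universes.\<close>

lemma hom_to_canonical:
  assumes "\<And>f. f \<in> H \<Longrightarrow> set (snd f) \<subseteq> U"
  shows "hom_to (canonical q) (\<lparr>universe = U, facts = H\<rparr>, a) \<longleftrightarrow> maps_to (head q, set (body q)) (a, H)"
proof -
  have "is_hom h (canonical q) (\<lparr>universe = U, facts = H\<rparr>, a) \<longleftrightarrow> phom h (head q, set (body q)) (a, H)" for h
  proof
    assume "is_hom h (canonical q) (\<lparr>universe = U, facts = H\<rparr>, a)"
    then show "phom h (head q, set (body q)) (a, H)"
      by (auto simp: is_hom_def canonical_def phom_def map_fact_def)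
  next
    assume p: "phom h (head q, set (body q)) (a, H)"
    have "h x \<in> U" if "x \<in> set (snd f)" "f \<in> set (body q)" for x f
    proof -
      have "map_fact h f \<in> H" using p that(2) by (auto simp: phom_def)
      then show ?thesis using assms[of "map_fact h f"] that(1) by auto
    qed
    then have "h ` (\<Union>(r, xs)\<in>set (body q). set xs) \<subseteq> U" by fastforce
    then show "is_hom h (canonical q) (\<lparr>universe = U, facts = H\<rparr>, a)"
      using p by (auto simp: is_hom_def canonical_def phom_def map_fact_def)
  qed
  then show ?thesis by (simp add: hom_to_def maps_to_def)
qed

lemma positive_iff:
  assumes v: "valid S k q"
  shows "positive (membership_oracle S k goal) q \<longleftrightarrow> maps_to (head goal, set (body goal)) (sem q)"
proof -
  have sub: "set (snd f) \<subseteq> set (occs q)" if "f \<in> set (snd q)" for f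
    using that by (auto simp: occs_def)
  have "is_pointed S k (\<lparr>universe = set (occs q), facts = set (snd q)\<rparr>, fst q)"
    using v sub by (auto simp: is_pointed_def is_structure_def valid_def occs_def)
  then have "positive (membership_oracle S k goal) q \<longleftrightarrow>
    fst q \<in> answers goal \<lparr>universe = set (occs q), facts = set (snd q)\<rparr>"
    unfolding positive_def by (rule membership_oracle_enc_pointed)
  then show ?thesis using hom_to_canonical[OF sub] by (simp add: answers_def)
qed

lemma idx_nth: "x \<in> set xs \<Longrightarrow> idx xs x < length xs \<and> xs ! idx xs x = x"
  by (induction xs) (auto simp: idx_def)

lemma sem_rename:
  "sem (rename q) = (map (idx (occs q)) (fst q), map_fact (idx (occs q)) ` set (snd q))"
  by (auto simp: rename_def map_fact_def)

lemma map_fact_nth_idx: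
  "f \<in> set (snd q) \<Longrightarrow> map_fact ((!) (occs q)) (map_fact (idx (occs q)) f) = f"
  unfolding map_fact_comp by (rule map_fact_idI) (simp add: idx_nth set_occs elemsI)

lemma map_nth_idx_head: "map ((!) (occs q)) (map (idx (occs q)) (fst q)) = fst q"
  unfolding map_map by (rule map_idI) (simp add: idx_nth set_occs)

lemma phom_rename: "phom (idx (occs q)) (sem q) (sem (rename q))"
  unfolding sem_rename by (simp add: phom_def)

lemma phom_rename_inverse: "phom ((!) (occs q)) (sem (rename q)) (sem q)"
  unfolding sem_rename phom_def fst_conv snd_conv
  using map_nth_idx_head[of q] by (simp add: image_image map_fact_nth_idx)

lemma critical_rename:
  assumes "critical Q (sem q)" shows "critical Q (sem (rename q))"
  unfolding critical_def
proof (intro conjI ballI notI)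
  show "maps_to Q (sem (rename q))"
    using assms phom_rename[of q] maps_to_trans unfolding critical_def maps_to_def by blast
  fix f' assume f': "f' \<in> snd (sem (rename q))"
    and m: "maps_to Q (fst (sem (rename q)), snd (sem (rename q)) - {f'})"
  let ?r = "idx (occs q)" and ?n = "(!) (occs q)"
  obtain f where f: "f \<in> set (snd q)" "f' = map_fact ?r f" using f' unfolding sem_rename by auto
  have "phom ?n (fst (sem (rename q)), snd (sem (rename q)) - {f'}) (fst q, set (snd q) - {f})"
    unfolding phom_def fst_conv snd_conv
  proof (intro conjI subsetI)
    show "map ?n (fst (rename q)) = fst q" using phom_rename_inverse[of q] by (simp add: phom_def)
    fix g assume "g \<in> map_fact ?n ` (set (snd (rename q)) - {f'})"
    then obtain g' where "g' \<in> map_fact ?r ` set (snd q)" "g' \<noteq> f'" "g = map_fact ?n g'"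
      using sem_rename[of q] by auto
    then obtain g0 where g0: "g0 \<in> set (snd q)" "g' = map_fact ?r g0" by blast
    then have "g = g0" using \<open>g = map_fact ?n g'\<close> map_fact_nth_idx by blast
    moreover have "g0 \<noteq> f" using g0(2) f(2) \<open>g' \<noteq> f'\<close> by blast
    ultimately show "g \<in> set (snd q) - {f}" using g0(1) by blast
  qed
  then have "maps_to Q (fst q, set (snd q) - {f})" using m maps_to_trans unfolding maps_to_def by blast
  then show False using assms f(1) unfolding critical_def by simp
qed

lemma valid_rename: "valid S k q \<Longrightarrow> valid S k (rename q)"
  by (auto simp: valid_def rename_def)

lemma length_occs: "length (occs q) = length (fst q) + (\<Sum>f\<leftarrow>snd q. length (snd f))"
  by (simp add: occs_def length_concat comp_def)

lemma length_occs_rename: "length (occs (rename q)) = length (occs q)"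
  unfolding length_occs by (simp add: rename_def comp_def)

lemma occs_rename_less: "u \<in> set (occs (rename q)) \<Longrightarrow> u < length (occs (rename q))"
proof -
  have e: "occs (rename q) = map (idx (occs q)) (occs q)"
    by (simp add: occs_def rename_def map_concat comp_def)
  assume "u \<in> set (occs (rename q))"
  then obtain x where "x \<in> set (occs q)" "u = idx (occs q) x" unfolding e by auto
  then show ?thesis using idx_nth length_occs_rename by metis
qed

lemma distinct_rename: "distinct (snd q) \<Longrightarrow> distinct (snd (rename q))"
proof -
  assume "distinct (snd q)"
  moreover have "inj_on (map_fact (idx (occs q))) (set (snd q))"
    by (rule inj_on_inverseI[where g = "map_fact ((!) (occs q))"]) (rule map_fact_nth_idx)
  moreover have "snd (rename q) = map (map_fact (idx (occs q))) (snd q)"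
    by (simp add: rename_def map_fact_def)
  ultimately show ?thesis by (simp add: distinct_map)
qed

text \<open>One pass suffices: if deleting \<open>f\<close> failed when it was tested, then by
  \<open>mono\<close> it fails for every later, smaller list.\<close>

lemma greedy_deletion:
  assumes P: "\<And>xs. set xs \<subseteq> set ys \<Longrightarrow> P xs = T (set xs)"
    and mono: "\<And>X Y. X \<subseteq> Y \<Longrightarrow> T X \<Longrightarrow> T Y" and "T (set ys)" and "distinct ys"
  defines "r \<equiv> \<lambda>fs. foldr (\<lambda>f gs. if P (filter (\<lambda>g. g \<noteq> f) gs) then filter (\<lambda>g. g \<noteq> f) gs else gs) fs ys"
  shows "set (r fs) \<subseteq> set ys \<and> T (set (r fs)) \<and> distinct (r fs) \<and>
    (\<forall>f \<in> set fs. f \<in> set (r fs) \<longrightarrow> \<not> T (set (r fs) - {f}))"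
proof (induction fs)
  case Nil
  then show ?case using assms(3,4) by (simp add: r_def)
next
  case (Cons f fs)
  let ?R = "r fs"
  let ?R' = "filter (\<lambda>g. g \<noteq> f) ?R"
  have R': "set ?R' = set ?R - {f}" by auto
  have PT: "P ?R' = T (set ?R - {f})" using P[of ?R'] Cons.IH unfolding R' by blast
  have rec: "r (f # fs) = (if P ?R' then ?R' else ?R)" by (simp add: r_def)
  show ?case
  proof (cases "P ?R'")
    case True
    then have e: "r (f # fs) = ?R'" by (simp add: rec)
    have "\<not> T (set ?R - {f} - {g})" if "g \<in> set fs" "g \<in> set ?R" for g
      using Cons.IH that mono[of "set ?R - {f} - {g}" "set ?R - {g}"] by blast
    then show ?thesis unfolding e R' using Cons.IH True PT by auto
  next
    case False
    then have e: "r (f # fs) = ?R" by (simp add: rec)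
    show ?thesis unfolding e using Cons.IH False PT by auto
  qed
qed

section \<open>The loop invariant\<close>

locale learning =
  fixes S :: schema and k :: nat and goal :: cq
  assumes goal: "goal \<in> c_acyclic_cqs S k"
begin

abbreviation "Q \<equiv> (head goal, set (body goal))"
abbreviation "ora \<equiv> membership_oracle S k goal"

text \<open>The map \<open>r\<close> says that the head of \<open>q\<close> identifies no more
  answer variables than the goal; otherwise \<open>q\<close> could not map to the goal. The last
  conjunct bounds the names of elements, which are encoded in unary.\<close>

definition good :: "nat list \<times> nat fact list \<Rightarrow> bool" where
  "good q \<longleftrightarrow> valid S k q \<and> critical Q (sem q) \<and> distinct (snd q) \<and>
     (\<exists>r. map r (fst q) = head goal) \<and> (\<forall>u \<in> set (occs q). u < length (occs q))"

lemma goal_head_elems: "set (head goal) \<subseteq> elems (set (body goal))"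
  using goal unfolding c_acyclic_cqs_def is_cq_def elems_def by fastforce

lemma critical_minimise:
  assumes v: "valid S k q" and p: "maps_to Q (sem q)"
  shows "critical Q (sem (minimise ora q))" "distinct (snd (minimise ora q))"
    "set (snd (minimise ora q)) \<subseteq> set (snd q)" "fst (minimise ora q) = fst q"
proof -
  let ?P = "\<lambda>gs. positive ora (fst q, gs)" and ?T = "\<lambda>X. maps_to Q (fst q, X)"
  have 1: "?P gs = ?T (set gs)" if "set gs \<subseteq> set (remdups (snd q))" for gs
  proof -
    have "valid S k (fst q, gs)" using v that by (auto simp: valid_def)
    from positive_iff[OF this] show ?thesis by simp
  qed
  let ?m = "minimise ora q"
  show m4: "fst ?m = fst q" by (simp add: minimise_def)
  have g: "set (snd ?m) \<subseteq> set (remdups (snd q)) \<and> ?T (set (snd ?m)) \<and> distinct (snd ?m) \<and>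
    (\<forall>f \<in> set (snd q). f \<in> set (snd ?m) \<longrightarrow> \<not> ?T (set (snd ?m) - {f}))"
    unfolding minimise_def snd_conv
  proof (rule greedy_deletion[where P = ?P and T = ?T])
    show "?T Y" if "X \<subseteq> Y" "?T X" for X Y using maps_to_mono that by blast
  qed (use 1 p in simp_all)
  then have m: "set (snd ?m) \<subseteq> set (snd q)" "?T (set (snd ?m))" "distinct (snd ?m)"
    "\<And>f. f \<in> set (snd ?m) \<Longrightarrow> \<not> ?T (set (snd ?m) - {f})"
    unfolding set_remdups by blast+
  show "set (snd ?m) \<subseteq> set (snd q)" "distinct (snd ?m)" using m by blast+
  show "critical Q (sem ?m)" unfolding critical_def fst_conv snd_conv m4 using m by blast
qed

lemma reduce_props:
  assumes v: "valid S k q" and p: "maps_to Q (sem q)" and r: "\<exists>r. map r (fst q) = head goal"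
  shows "good (reduce ora q)" "maps_to (sem (reduce ora q)) (sem q)"
proof -
  let ?m = "minimise ora q"
  note m = critical_minimise[OF v p]
  have vm: "valid S k ?m" using v m(3,4) unfolding valid_def by auto
  obtain r where r: "map r (fst q) = head goal" using assms(3) by (elim exE)
  have "map (r \<circ> (!) (occs ?m)) (fst (rename ?m))
      = map r (map ((!) (occs ?m)) (map (idx (occs ?m)) (fst ?m)))"
    by (simp add: rename_def)
  also have "\<dots> = head goal" unfolding map_nth_idx_head by (simp only: m(4) r)
  finally have "\<exists>r. map r (fst (rename ?m)) = head goal" by blast
  then show "good (reduce ora q)"
    unfolding good_def reduce_def
    by (intro conjI ballI valid_rename[OF vm] critical_rename[OF m(1)] distinct_rename[OF m(2)] occs_rename_less)
  have "phom id (sem ?m) (sem q)"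
    using m(3) unfolding phom_def m(4) by (auto simp: map_fact_def)
  then show "maps_to (sem (reduce ora q)) (sem q)"
    unfolding reduce_def using phom_comp[OF phom_rename_inverse] maps_to_def by blast
qed

lemma good_occs:
  assumes "good q" shows "set (fst q) \<subseteq> elems (set (snd q))" "set (occs q) = elems (set (snd q))"
proof -
  show "set (fst q) \<subseteq> elems (set (snd q))"
    using critical_head_elems[of Q "sem q"] assms goal_head_elems by (simp add: good_def)
  then show "set (occs q) = elems (set (snd q))" unfolding set_occs by blast
qed

lemma grows_iff: "grows q q' \<longleftrightarrow> card (set (occs q)) < card (set (occs q'))"
proof -
  have "foldr (\<lambda>_. tl) ys xs = drop (length ys) xs" for ys xs :: "nat list"
    by (induction ys) (simp_all add: drop_Suc tl_drop)
  then show ?thesis unfolding grows_def by (simp add: length_remdups_card_conv not_le)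
qed

text \<open>If \<open>q\<close> did not map to \<open>c\<close>, it would not map to the critical
  part of \<open>c\<close> either, and that part would have more elements by
  \<open>critical_card_elems_less\<close>. Comparing cardinalities thus certifies a homomorphism
  that is never computed.\<close>

lemma reduce_not_grows:
  assumes q: "good q" and c: "valid S k c" "\<exists>r. map r (fst c) = head goal" "maps_to Q (sem c)"
    and cq: "maps_to (sem c) (sem q)" and "\<not> grows q (reduce ora c)"
  shows "maps_to (sem q) (sem c)"
proof (rule ccontr)
  assume no: "\<not> maps_to (sem q) (sem c)"
  note r = reduce_props[OF c(1,3,2)]
  have "\<not> maps_to (sem q) (sem (reduce ora c))" using no r(2) maps_to_trans by blast
  moreover obtain p where "phom p (sem (reduce ora c)) (sem q)"
    using maps_to_trans[OF r(2) cq] by (auto simp: maps_to_def)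
  ultimately have "card (elems (set (snd q))) < card (elems (set (snd (reduce ora c))))"
    using critical_card_elems_less[of Q "sem q" "sem (reduce ora c)" p] q r(1)
      good_occs(1)[OF q] good_occs(1)[OF r(1)] by (simp add: good_def)
  then show False using assms(6) unfolding grows_iff good_occs(2)[OF q] good_occs(2)[OF r(1)] by simp
qed

end

section \<open>Correctness of the candidates\<close>

lemma set_label_list: "set (label_list fs u) = labels (set fs) u"
  by (auto simp: label_list_def labels_def)

lemma set_label_tuples:
  "length us \<le> n \<Longrightarrow> set (label_tuples n fs us) =
    {xs. map fst xs = us \<and> (\<forall>x \<in> set xs. snd x \<in> labels (set fs) (fst x))}"
proof (induction n arbitrary: us)
  case (Suc n)
  show ?case
  proof (cases us)
    case (Cons u us')
    then have IH: "set (label_tuples n fs us') =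
      {xs. map fst xs = us' \<and> (\<forall>x \<in> set xs. snd x \<in> labels (set fs) (fst x))}"
      using Suc by simp
    have "set (label_tuples (Suc n) fs us) =
      (\<Union>l \<in> labels (set fs) u. (\<lambda>xs. (u, l) # xs) ` set (label_tuples n fs us'))"
      unfolding Cons by (simp add: set_label_list)
    also have "\<dots> = {xs. map fst xs = us \<and> (\<forall>x \<in> set xs. snd x \<in> labels (set fs) (fst x))}"
      unfolding IH Cons by (auto simp: map_eq_Cons_conv image_iff Cons_eq_map_conv)
    finally show ?thesis .
  qed auto
qed auto

text \<open>\<open>acc\<close> and \<open>acc'\<close> have to agree only on copies of actual facts,
  as \<open>doubled_tag\<close> and \<open>doubled\<close> do by
  \<open>doubled_tag_iff\<close>.\<close>

lemma sem_label_struct: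
  assumes n: "\<And>f. f \<in> set (snd q) \<Longrightarrow> length (snd f) \<le> n"
    and acc: "\<And>f xs. f \<in> set (snd q) \<Longrightarrow> map fst xs = snd f \<Longrightarrow> acc f xs = acc' f xs"
  shows "sem (label_struct n q acc) = labelling (fst q) (set (snd q)) acc'"
proof -
  have "set (snd (label_struct n q acc)) = {g. map_fact fst g \<in> set (snd q) \<and>
      (\<forall>x \<in> set (snd g). snd x \<in> labels (set (snd q)) (fst x)) \<and> acc' (map_fact fst g) (snd g)}"
  proof (intro set_eqI iffI)
    fix g assume "g \<in> set (snd (label_struct n q acc))"
    then obtain f xs where f: "f \<in> set (snd q)" "xs \<in> set (label_tuples n (snd q) (snd f))"
      "acc f xs" "g = (fst f, xs)" unfolding label_struct_def by auto
    have xs: "map fst xs = snd f" "\<forall>x \<in> set xs. snd x \<in> labels (set (snd q)) (fst x)"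
      using f(2) unfolding set_label_tuples[OF n[OF f(1)]] by auto
    have "map_fact fst g = f" using f(4) xs(1) by (simp add: map_fact_def)
    then show "g \<in> {g. map_fact fst g \<in> set (snd q) \<and>
      (\<forall>x \<in> set (snd g). snd x \<in> labels (set (snd q)) (fst x)) \<and> acc' (map_fact fst g) (snd g)}"
      using f xs acc[OF f(1) xs(1)] by simp
  next
    fix g assume "g \<in> {g. map_fact fst g \<in> set (snd q) \<and>
      (\<forall>x \<in> set (snd g). snd x \<in> labels (set (snd q)) (fst x)) \<and> acc' (map_fact fst g) (snd g)}"
    then have g: "map_fact fst g \<in> set (snd q)" "\<forall>x \<in> set (snd g). snd x \<in> labels (set (snd q)) (fst x)"
      "acc' (map_fact fst g) (snd g)" by simp_all
    let ?f = "map_fact fst g"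
    have "snd g \<in> set (label_tuples n (snd q) (snd ?f))"
      unfolding set_label_tuples[OF n[OF g(1)]] using g(2) by simp
    moreover have "acc ?f (snd g)" using g(3) acc[OF g(1)] by simp
    moreover have "g = (fst ?f, snd g)" by simp
    ultimately have m: "g \<in> set (map (\<lambda>xs. (fst ?f, xs)) (filter (acc ?f) (label_tuples n (snd q) (snd ?f))))"
      unfolding set_map set_filter by (intro image_eqI[of g _ "snd g"] CollectI conjI)
    show "g \<in> set (snd (label_struct n q acc))"
      unfolding label_struct_def snd_conv set_concat set_map[of _ "snd q"]
      by (rule UN_I[OF imageI[OF g(1)]]) (rule m)
  qed
  then show ?thesis by (simp add: labelling_def label_struct_def)
qed

lemma valid_label_struct:
  assumes "valid S k q" "\<And>f. f \<in> set (snd q) \<Longrightarrow> length (snd f) \<le> n"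
  shows "valid S k (label_struct n q acc)"
  unfolding valid_def
proof (intro conjI ballI)
  show "length (fst (label_struct n q acc)) = k" using assms(1) by (simp add: valid_def label_struct_def)
  fix g assume "g \<in> set (snd (label_struct n q acc))"
  then have "g \<in> snd (labelling (fst q) (set (snd q)) acc)"
    using sem_label_struct[of q n acc acc, OF assms(2)] by (metis snd_conv)
  then have "map_fact fst g \<in> set (snd q)" by (simp add: labelling_def)
  then show "fst g \<in> symbols S" "length (snd g) = arity S (fst g)"
    using assms(1) unfolding valid_def by force+
qed

lemma set_tag: "set (tag xs) = (\<lambda>j. (length xs - Suc j, xs ! j)) ` {..<length xs}"
proof -
  have "length (tag xs) = length xs \<and> (\<forall>j<length xs. tag xs ! j = (length xs - Suc j, xs ! j))"
    by (induction xs) (auto simp: tag_def nth_Cons split: nat.split)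
  moreover have "set (tag xs) = (!) (tag xs) ` {..<length (tag xs)}" by (auto simp: set_conv_nth)
  ultimately show ?thesis by simp
qed

lemma doubled_tag_iff:
  assumes "i0 < length (snd f0)" "map fst xs = snd f"
  shows "doubled_tag D f0 (length (snd f0) - Suc i0) f xs \<longleftrightarrow> doubled D f0 i0 f xs"
proof -
  have l: "length xs = length (snd f)" using assms(2) by (metis length_map)
  \<comment> \<open>Positions matter only if \<open>f = f0\<close>; both lists then have the same
    length, and counting from either end amounts to the same.\<close>
  have p: "(f = f0 \<and> length xs - Suc j = length (snd f0) - Suc i0) = (f = f0 \<and> j = i0)"
    if "j < length xs" for j
    using that assms(1) l by auto
  have u: "set [False, True] = UNIV" by (auto simp: UNIV_bool)
  have "(\<forall>z \<in> set (tag xs). fst (snd z) \<in> D \<or>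
      (snd (snd z) \<noteq> []) = (b \<noteq> (f = f0 \<and> fst z = length (snd f0) - Suc i0))) \<longleftrightarrow>
    (\<forall>j<length xs. fst (xs ! j) \<notin> D \<longrightarrow> (snd (xs ! j) \<noteq> []) = (b \<noteq> (f = f0 \<and> j = i0)))" for b
    unfolding set_tag ball_simps fst_conv snd_conv unfolding Ball_def lessThan_iff
    by (intro all_cong1 imp_cong refl) (simp only: p, blast)
  then show ?thesis unfolding doubled_tag_def doubled_def u bex_UNIV by simp
qed

lemma candidates_correct:
  assumes "\<forall>f \<in> set (snd q). length (snd f) \<le> n"
  shows "f \<in> set (snd q) \<Longrightarrow> \<exists>B. rename B \<in> set (candidates n q) \<and> (\<exists>acc. B = label_struct n q acc) \<and>
      sem B = labelling (fst q) (set (snd q)) (marked (set (fst q)) f)" (is "_ \<Longrightarrow> ?m")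
    and "f \<in> set (snd q) \<Longrightarrow> i < length (snd f) \<Longrightarrow>
      \<exists>B. rename B \<in> set (candidates n q) \<and> (\<exists>acc. B = label_struct n q acc) \<and>
      sem B = labelling (fst q) (set (snd q)) (doubled (set (fst q)) f i)" (is "_ \<Longrightarrow> _ \<Longrightarrow> ?d")
proof -
  note n = bspec[OF assms(1)]
  assume f: "f \<in> set (snd q)"
  let ?acc = "\<lambda>g xs. marked (set (fst q)) f g xs"
  have "rename (label_struct n q ?acc) \<in> set (candidates n q)"
    unfolding candidates_def set_append set_map[of _ "snd q"] using imageI[OF f] by (rule UnI1)
  moreover have "sem (label_struct n q ?acc) = labelling (fst q) (set (snd q)) ?acc"
    by (rule sem_label_struct[OF n refl])
  ultimately show ?m by blast
  assume i: "i < length (snd f)"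
  let ?t = "length (snd f) - Suc i"
  let ?acc = "\<lambda>g xs. doubled_tag (set (fst q)) f ?t g xs"
  have "(?t, snd f ! i) \<in> set (tag (snd f))" unfolding set_tag using i by blast
  then have "rename (label_struct n q ?acc) \<in> set (map (\<lambda>z. rename (label_struct n q
      (\<lambda>g xs. doubled_tag (set (fst q)) f (fst z) g xs))) (tag (snd f)))" (is "_ \<in> set (?F f)")
    unfolding set_map by (intro image_eqI[of _ _ "(?t, snd f ! i)"]) simp_all
  then have "rename (label_struct n q ?acc) \<in> set (candidates n q)"
    unfolding candidates_def set_append set_concat set_map[of _ "snd q"]
    by (intro UnI2) (rule UN_I[OF imageI[OF f]])
  moreover have "sem (label_struct n q ?acc) = labelling (fst q) (set (snd q)) (doubled (set (fst q)) f i)"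
    by (rule sem_label_struct[OF n doubled_tag_iff[OF i]])
  ultimately show ?d by blast
qed

lemma candidates_label_struct:
  "c \<in> set (candidates n q) \<Longrightarrow> \<exists>acc. c = rename (label_struct n q acc)"
  unfolding candidates_def by auto

context learning
begin

text \<open>The projection to \<open>q\<close> composes with \<open>r\<close>, so splitting elements
  never spoils the head.\<close>

lemma label_struct_rename_props:
  assumes q: "good q" and n: "\<And>f. f \<in> set (snd q) \<Longrightarrow> length (snd f) \<le> n"
    and c: "c = rename (label_struct n q acc)"
  shows "valid S k c" "\<exists>r. map r (fst c) = head goal" "maps_to (sem c) (sem q)"
proof -
  let ?B = "label_struct n q acc"
  show "valid S k c" unfolding c
    by (rule valid_rename[OF valid_label_struct[OF _ n]]) (use q in \<open>simp_all add: good_def\<close>)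
  have "sem ?B = labelling (fst q) (set (snd q)) acc" by (rule sem_label_struct[OF n refl])
  then have "phom fst (sem ?B) (sem q)" using phom_labelling_fst by metis
  from phom_comp[OF phom_rename_inverse this] show m: "maps_to (sem c) (sem q)"
    unfolding c maps_to_def by blast
  then obtain p where "map p (fst c) = fst q" unfolding maps_to_def phom_def by auto
  moreover obtain r where "map r (fst q) = head goal" using q unfolding good_def by blast
  ultimately have "map (r \<circ> p) (fst c) = head goal" by (metis map_map)
  then show "\<exists>r. map r (fst c) = head goal" by blast
qed

lemma improvements_progress:
  assumes q: "good q" and n: "\<And>f. f \<in> set (snd q) \<Longrightarrow> length (snd f) \<le> n"
    and q': "q' \<in> set (improvements n ora q)"
  shows "good q' \<and> card (set (occs q)) < card (set (occs q'))"
proof -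
  obtain c where c: "c \<in> set (candidates n q)" "positive ora c" "q' = reduce ora c" "grows q q'"
    using q' unfolding improvements_def by auto
  obtain acc where "c = rename (label_struct n q acc)" using candidates_label_struct[OF c(1)] by blast
  note p = label_struct_rename_props[OF q n this]
  have "maps_to Q (sem c)" using positive_iff[OF p(1)] c(2) by blast
  then show ?thesis using reduce_props(1)[OF p(1) _ p(2)] c(3,4) grows_iff by blast
qed

text \<open>Candidates without a map from \<open>Q\<close> satisfy the premises of
  \<open>no_progress_imp_goal\<close> vacuously. For the others, \<open>reduce_not_grows\<close>
  gives the map from \<open>q\<close>.\<close>

lemma no_improvements:
  assumes q: "good q" and n: "\<And>f. f \<in> set (snd q) \<Longrightarrow> length (snd f) \<le> n"
    and no: "improvements n ora q = []"
  shows "c_acyclic (\<lparr>universe = V, facts = set (snd q)\<rparr>, fst q)" "maps_to (sem q) Q"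
proof -
  have key: "maps_to (sem q) (sem B)"
    if B: "rename B \<in> set (candidates n q)" "\<exists>acc. B = label_struct n q acc" and QB: "maps_to Q (sem B)" for B
  proof -
    obtain acc where "rename B = rename (label_struct n q acc)" using B(2) by blast
    note p = label_struct_rename_props[OF q n this]
    have "maps_to Q (sem (rename B))"
      using QB phom_rename[of B] maps_to_trans unfolding maps_to_def by blast
    moreover from this have "positive ora (rename B)" using positive_iff[OF p(1)] by blast
    then have "reduce ora (rename B) \<in> set (map (reduce ora) (filter (positive ora) (candidates n q)))"
      unfolding set_map set_filter using B(1) by (intro imageI CollectI conjI)
    from bspec[OF no[unfolded improvements_def filter_empty_conv] this]
    have "\<not> grows q (reduce ora (rename B))" .
    ultimately have "maps_to (sem q) (sem (rename B))"
      by (intro reduce_not_grows[OF q p(1,2) _ p(3)])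
    then show ?thesis
      using phom_rename_inverse[of B] maps_to_trans unfolding maps_to_def by blast
  qed
  have n': "\<forall>f \<in> set (snd q). length (snd f) \<le> n" using n by blast
  obtain r where r: "map r (fst q) = head goal" using q unfolding good_def by blast
  have crit: "critical Q (sem q)" using q unfolding good_def by blast
  have ac: "c_acyclic (\<lparr>universe = \<Union>(r, xs)\<in>set (body goal). set xs, facts = set (body goal)\<rparr>, head goal)"
    using goal by (simp add: c_acyclic_cqs_def canonical_def)
  have 1: "maps_to (sem q) (labelling (fst q) (set (snd q)) (marked (set (fst q)) f))"
    if f: "f \<in> set (snd q)" and m: "maps_to Q (labelling (fst q) (set (snd q)) (marked (set (fst q)) f))" for f
  proof -
    obtain B where "rename B \<in> set (candidates n q)" "\<exists>acc. B = label_struct n q acc"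
      "sem B = labelling (fst q) (set (snd q)) (marked (set (fst q)) f)"
      using candidates_correct(1)[OF n' f] by (elim exE conjE) blast
    then show ?thesis using key[of B] m by (simp only:)
  qed
  have 2: "maps_to (sem q) (labelling (fst q) (set (snd q)) (doubled (set (fst q)) f i))"
    if f: "f \<in> set (snd q)" "i < length (snd f)"
      and m: "maps_to Q (labelling (fst q) (set (snd q)) (doubled (set (fst q)) f i))" for f i
  proof -
    obtain B where "rename B \<in> set (candidates n q)" "\<exists>acc. B = label_struct n q acc"
      "sem B = labelling (fst q) (set (snd q)) (doubled (set (fst q)) f i)"
      using candidates_correct(2)[OF n' f] by (elim exE conjE) blast
    then show ?thesis using key[of B] m by (simp only:)
  qed
  note np = no_progress_imp_goal[OF crit finite_set finite_set goal_head_elems ac r 1 2]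
  show "c_acyclic (\<lparr>universe = V, facts = set (snd q)\<rparr>, fst q)" by (rule np(1))
  show "maps_to (sem q) Q" by (rule np(2))
qed

end


section \<open>The starting instance\<close>

definition all_facts :: "schema \<Rightarrow> nat list \<Rightarrow> nat list \<Rightarrow> nat fact list" where
  "all_facts S rs us = concat (map (\<lambda>r. map (\<lambda>xs. (r, xs)) (List.n_lists (arity S r) us)) rs)"

text \<open>All facts over \<open>0, ..., k\<close> are present, and the spare element
  \<open>k\<close> takes the variables outside the head. Only the distinguished tuple varies; tuples
  with more distinct entries come first.\<close>

definition initials :: "schema \<Rightarrow> nat \<Rightarrow> nat list \<Rightarrow> (nat list \<times> nat fact list) list" where
  "initials S k rs = map (\<lambda>b. (b, all_facts S rs [0..<Suc k]))
     (sort_key (\<lambda>b. k - card (set b)) (List.n_lists k [0..<k]))"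

text \<open>The default \<open>([], [])\<close> only makes \<open>hd\<close> total: if
  \<open>rs\<close> lists the symbols, some instance is positive, as the proof of
  \<open>good_initial\<close> shows.\<close>

definition initial :: "schema \<Rightarrow> nat \<Rightarrow> nat list \<Rightarrow> (tree \<Rightarrow> bool) \<Rightarrow> unit \<Rightarrow> nat list \<times> nat fact list" where
  "initial S k rs ora x = reduce ora (if filter (positive ora) (initials S k rs) \<noteq> []
     then hd (filter (positive ora) (initials S k rs)) else ([], []))"

lemma ptime_initial: "ptime (\<lambda>_. Leaf) (enc_q enc_nat) (initial S k rs)"
  unfolding initial_def[abs_def]
  by (rule ptime_reduce, rule ptime_hd, rule ptime_filter[OF ptime_const], rule ptime_positive)
    (rule ptime_snd ptime_id ptime_const)+

text \<open>A tuple with the same equalities as the head of the goal is positive, so the first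
  positive tuple has at least as many distinct entries. As the head maps onto that tuple, the map is
  injective on the head, and its inverse is the required \<open>r\<close>.\<close>

lemma (in learning) good_initial:
  assumes rs: "set rs = symbols S"
  shows "good (initial S k rs ora x)"
proof -
  have cq: "is_cq S k goal" using goal by (simp add: c_acyclic_cqs_def)
  have len: "length (head goal) = k" using cq by (simp add: is_cq_def)
  let ?F = "all_facts S rs [0..<Suc k]"
  have memF: "f \<in> set ?F" if "fst f \<in> symbols S" "length (snd f) = arity S (fst f)"
    "set (snd f) \<subseteq> {0..<Suc k}" for f
  proof -
    have "f = (fst f, snd f)" by simp
    moreover have "snd f \<in> set (List.n_lists (arity S (fst f)) [0..<Suc k])"
      unfolding set_n_lists using that by (simp del: upt_Suc)
    ultimately have "f \<in> set (map (\<lambda>xs. (fst f, xs)) (List.n_lists (arity S (fst f)) [0..<Suc k]))"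
      unfolding set_map by (rule image_eqI)
    then show ?thesis unfolding all_facts_def set_concat set_map[of _ rs] rs
      by (rule UN_I[OF imageI[OF that(1)]])
  qed
  have validF: "valid S k (b, ?F)" if "length b = k" for b
    using that rs unfolding valid_def all_facts_def by (auto simp: set_n_lists)
  let ?b = "map (idx (head goal)) (head goal)"
  have bk: "set ?b \<subseteq> {0..<k}" using idx_nth[of _ "head goal"] len by auto
  have inj: "inj_on (idx (head goal)) (set (head goal))"
    by (rule inj_on_inverseI[where g = "(!) (head goal)"]) (simp add: idx_nth)
  let ?h = "\<lambda>x. if x \<in> set (head goal) then idx (head goal) x else k"
  have "phom ?h Q (?b, set ?F)"
    unfolding phom_def fst_conv snd_conv
  proof (intro conjI subsetI)
    show "map ?h (head goal) = ?b" by simp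
    fix f assume "f \<in> map_fact ?h ` set (body goal)"
    then obtain g where g: "g \<in> set (body goal)" "f = map_fact ?h g" by blast
    have "fst g \<in> symbols S" "length (snd g) = arity S (fst g)"
      using cq g(1) unfolding is_cq_def by auto
    moreover have "?h x \<in> {0..<Suc k}" for x using idx_nth[of x "head goal"] len by auto
    then have "?h ` set (snd g) \<subseteq> {0..<Suc k}" by (rule image_subsetI)
    ultimately show "f \<in> set ?F" unfolding g(2) by (intro memF) (simp_all only: map_fact_simps length_map set_map)
  qed
  then have mb: "maps_to Q (sem (?b, ?F))" unfolding maps_to_def by auto
  let ?I = "initials S k rs"
  have bI: "(?b, ?F) \<in> set ?I"
    unfolding initials_def set_map set_sort set_n_lists using bk len by (intro imageI) simp
  have posb: "positive ora (?b, ?F)" using mb positive_iff[OF validF, of ?b] len by simp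
  let ?P = "filter (positive ora) ?I"
  have bP: "(?b, ?F) \<in> set ?P" using bI posb by simp
  then have ne: "?P \<noteq> []" by (metis empty_iff list.set(1))
  define q where "q = hd ?P"
  have qP: "q \<in> set ?P" unfolding q_def using ne by (rule hd_in_set)
  then obtain b where b: "q = (b, ?F)" "length b = k" "set b \<subseteq> {0..<k}"
    unfolding initials_def by (auto simp: set_n_lists)
  have "sorted (map (\<lambda>q. k - card (set (fst q))) ?I)"
    unfolding initials_def by (simp add: comp_def)
  then have "sorted (map (\<lambda>q. k - card (set (fst q))) ?P)" by (rule sorted_filter)
  then have "k - card (set (fst q)) \<le> k - card (set (fst (?b, ?F)))"
    using bP ne unfolding q_def by (cases ?P) auto
  moreover have "card (set b) \<le> k" using b(2) card_length by metis
  moreover have "card (set ?b) \<le> k" using len card_length[of ?b] by simp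
  ultimately have cb: "card (set ?b) \<le> card (set b)" using b(1) by simp
  have v: "valid S k q" unfolding b(1) by (rule validF[OF b(2)])
  have m: "maps_to Q (sem q)" using qP positive_iff[OF v] by simp
  then obtain h where "map h (head goal) = b" unfolding maps_to_def phom_def b(1) by auto
  then have hb: "h ` set (head goal) = set b" by (metis set_map)
  have "card (set (head goal)) = card (set ?b)" unfolding set_map card_image[OF inj] ..
  then have "card (set (head goal)) \<le> card (h ` set (head goal))" using cb hb by simp
  then have "inj_on h (set (head goal))"
    using card_image_le[of "set (head goal)" h] by (intro eq_card_imp_inj_on) simp_all
  then have "map (inv_into (set (head goal)) h) (map h (head goal)) = head goal"
    unfolding map_map by (intro map_idI) simp
  then have "\<exists>r. map r (fst q) = head goal" using \<open>map h (head goal) = b\<close> b(1) by auto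
  from reduce_props(1)[OF v m this] show ?thesis
    unfolding initial_def q_def using ne by simp
qed

section \<open>Size bounds and conclusion\<close>

lemma enc_q_cq: "enc_cq \<lparr>head = fst q, body = snd q\<rparr> = enc_q enc_nat q"
  by (simp add: enc_cq_def enc_pair_def enc_tuple_def enc_fact_conv)

lemma length_body_le_cq_size: "length (body q) \<le> cq_size q"
proof -
  have "length xs \<le> (\<Sum>(r :: nat, us :: nat list) \<leftarrow> xs. 1 + length us)" for xs by (induction xs) auto
  then show ?thesis unfolding cq_size_def by (rule trans_le_add2)
qed

text \<open>The goal maps onto the facts of \<open>q\<close>, so \<open>q\<close> has at most
  \<open>N\<close> facts. The schema bounds their arities by \<open>n\<close> and their unary symbol
  names by \<open>m\<close>, and elements are below the number of occurrences.\<close>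

lemma (in learning) good_bounds:
  assumes q: "good q" and n: "\<And>r. r \<in> symbols S \<Longrightarrow> r \<le> m \<and> arity S r \<le> n"
    and N: "cq_size goal \<le> N"
  shows "card (set (occs q)) \<le> k + N * n"
    and "size (enc_q enc_nat q) \<le> k * (k + N * n + 1) + N * (m + n * (k + N * n + 1) + 1 + 1) + 1"
proof -
  let ?L = "k + N * n"
  have v: "length (fst q) = k" "\<And>f. f \<in> set (snd q) \<Longrightarrow> fst f \<le> m \<and> length (snd f) \<le> n"
    using q n unfolding good_def valid_def by auto
  have crit: "critical Q (sem q)" using q by (simp add: good_def)
  then obtain h where h: "phom h Q (sem q)" by (auto simp: critical_def maps_to_def)
  have "card (set (snd q)) \<le> card (set (body goal))"
    using critical_image[OF crit h] card_image_le[of "set (body goal)" "map_fact h"] by simp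
  then have len: "length (snd q) \<le> N"
    using q N length_body_le_cq_size[of goal] card_length[of "body goal"] distinct_card[of "snd q"]
    unfolding good_def by linarith
  have "(\<Sum>f\<leftarrow>xs. length (snd f)) \<le> length xs * n" if "set xs \<subseteq> set (snd q)" for xs
    using that v(2) by (induction xs) (auto intro: add_mono)
  then have "(\<Sum>f\<leftarrow>snd q. length (snd f)) \<le> length (snd q) * n" by blast
  also have "\<dots> \<le> N * n" using len by (rule mult_le_mono1)
  finally have L: "length (occs q) \<le> ?L" unfolding length_occs v(1) by simp
  then show "card (set (occs q)) \<le> ?L" using card_length le_trans by blast
  have u: "size (enc_nat u) \<le> ?L" if "u \<in> set (occs q)" for u
    using q that L unfolding good_def size_enc_nat by fastforce
  have "size (enc_list enc_nat (fst q)) \<le> length (fst q) * (?L + 1)"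
    by (rule size_enc_list_le) (simp add: u occs_def)
  then have h: "size (enc_list enc_nat (fst q)) \<le> k * (?L + 1)" unfolding v(1) .
  have "size (enc_f enc_nat f) \<le> m + n * (?L + 1) + 1" if f: "f \<in> set (snd q)" for f
  proof -
    have "size (enc_list enc_nat (snd f)) \<le> length (snd f) * (?L + 1)"
      by (rule size_enc_list_le, rule u) (use f in \<open>auto simp: occs_def\<close>)
    also have "\<dots> \<le> n * (?L + 1)" using v(2)[OF f] by (intro mult_le_mono1) simp
    finally show ?thesis using v(2)[OF f] by (simp add: enc_pair_def size_enc_nat)
  qed
  then have "size (enc_list (enc_f enc_nat) (snd q)) \<le> length (snd q) * (m + n * (?L + 1) + 1 + 1)"
    by (rule size_enc_list_le)
  also have "\<dots> \<le> N * (m + n * (?L + 1) + 1 + 1)" using len by (rule mult_le_mono1)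
  finally show "size (enc_q enc_nat q) \<le> k * (?L + 1) + N * (m + n * (?L + 1) + 1 + 1) + 1"
    using h by (simp add: enc_pair_def)
qed

lemma answers_maps_to:
  assumes "is_structure S A"
  shows "a \<in> answers q A \<longleftrightarrow> maps_to (head q, set (body q)) (a, facts A)"
proof -
  have "set (snd f) \<subseteq> universe A" if "f \<in> facts A" for f
    using assms that unfolding is_structure_def by (cases f) auto
  from hom_to_canonical[OF this, where q = q] show ?thesis unfolding answers_def
    by (cases A) simp
qed

lemma (in learning) learned:
  assumes q: "good q" and n: "\<And>r. r \<in> symbols S \<Longrightarrow> arity S r \<le> n" and no: "improvements n ora q = []"
  shows "\<lparr>head = fst q, body = snd q\<rparr> \<in> c_acyclic_cqs S k"
    and "logically_equivalent S \<lparr>head = fst q, body = snd q\<rparr> goal"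
proof -
  have "length (snd f) \<le> n" if "f \<in> set (snd q)" for f
    using q n that unfolding good_def valid_def by auto
  note ni = no_improvements[OF q this no]
  have "\<forall>(r, xs)\<in>set (snd q). r \<in> symbols S \<and> length xs = arity S r" "length (fst q) = k"
    using q unfolding good_def valid_def by auto
  moreover have "\<forall>x\<in>set (fst q). \<exists>(r, xs)\<in>set (snd q). x \<in> set xs"
    using good_occs(1)[OF q] unfolding elems_def by fastforce
  ultimately show "\<lparr>head = fst q, body = snd q\<rparr> \<in> c_acyclic_cqs S k"
    unfolding c_acyclic_cqs_def is_cq_def canonical_def using ni(1) by simp
  have "maps_to Q (sem q)" using q unfolding good_def critical_def by blast
  then show "logically_equivalent S \<lparr>head = fst q, body = snd q\<rparr> goal"
    unfolding logically_equivalent_def set_eq_iff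
  proof (intro allI impI)
    fix A :: "nat struct" and a assume A: "is_structure S A"
    show "a \<in> answers \<lparr>head = fst q, body = snd q\<rparr> A \<longleftrightarrow> a \<in> answers goal A"
      unfolding answers_maps_to[OF A] cq.simps
      using maps_to_trans[OF ni(2)] maps_to_trans[OF \<open>maps_to Q (sem q)\<close>] by blast
  qed
qed

theorem theorem5p2:
  fixes S :: schema and k :: nat
  assumes "is_schema S"
  shows "efficiently_exactly_learnable S k (c_acyclic_cqs S k)"
proof -
  let ?C = "c_acyclic_cqs S k"
  have fin: "finite (symbols S)" using assms by (simp add: is_schema_def)
  then obtain rs where rs: "set rs = symbols S" using finite_list by blast
  \<comment> \<open>Sums instead of maxima, since these also serve for an empty schema.\<close>
  define m where "m = (\<Sum>r\<in>symbols S. r)"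
  define n where "n = (\<Sum>r\<in>symbols S. arity S r)"
  have mn: "r \<le> m \<and> arity S r \<le> n" if "r \<in> symbols S" for r
    unfolding m_def n_def using member_le_sum[OF that, of id] member_le_sum[OF that, of "arity S"] fin by simp
  obtain P p where P: "\<forall>ora Inv \<mu> M s. Inv (initial S k rs ora ()) \<longrightarrow>
    (\<forall>q. Inv q \<longrightarrow> size (enc_q enc_nat q) \<le> s \<and> \<mu> q \<le> M) \<longrightarrow>
    (\<forall>q. Inv q \<longrightarrow> improvements n ora q \<noteq> [] \<longrightarrow>
      Inv (hd (improvements n ora q)) \<and> \<mu> q < (\<mu> (hd (improvements n ora q)) :: nat)) \<longrightarrow>
    (\<exists>q t. Inv q \<and> improvements n ora q = [] \<and> runs ora P (enc_q enc_nat q) t \<and>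
      t \<le> (M + 2) * poly p s + poly p 0)"
    by (rule iterate_program[OF ptime_initial[of S k rs] ptime_improvements[of n], where ?x0.0 = "()"])
  \<comment> \<open>The bounds of \<open>good_bounds\<close> as functions of the size of the
    goal.\<close>
  let ?M = "\<lambda>N. k + N * n"
  let ?s = "\<lambda>N. k * (k + N * n + 1) + N * (m + n * (k + N * n + 1) + 1 + 1) + 1"
  have "poly_bounded (\<lambda>N. (?M N + 2) * poly p (?s N) + poly p 0)"
    by (intro poly_bounded_add poly_bounded_mult poly_bounded_comp poly_bounded_const poly_bounded_id)
  then obtain b where b: "\<forall>N. (?M N + 2) * poly p (?s N) + poly p 0 \<le> poly b N"
    unfolding poly_bounded_def by (elim exE)
  have "\<exists>q\<in>?C. \<exists>t. runs (membership_oracle S k q_goal) P (enc_cq q) t \<and>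
      logically_equivalent S q q_goal \<and> t \<le> poly b (goal_size S ?C q_goal)"
    if q_goal: "q_goal \<in> ?C" for q_goal
  proof -
    let ?N = "goal_size S ?C q_goal"
    have "\<exists>N. \<exists>g \<in> ?C. logically_equivalent S g q_goal \<and> cq_size g = N"
      using q_goal by (auto simp: logically_equivalent_def)
    from LeastI_ex[OF this]
    obtain g where g: "g \<in> ?C" "logically_equivalent S g q_goal" "cq_size g = ?N"
      unfolding goal_size_def by blast
    \<comment> \<open>The run is analysed for a smallest equivalent query \<open>g\<close> instead
      of \<open>q_goal\<close>, so that \<open>cq_size g\<close> is the goal size.\<close>
    interpret learning S k g by unfold_locales (rule g(1))
    \<comment> \<open>The oracle depends only on the answers of its query on structures, so the
      program cannot tell \<open>g\<close> from \<open>q_goal\<close>.\<close>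
    have ora: "membership_oracle S k q_goal = ora"
      using g(2) unfolding membership_oracle_def logically_equivalent_def is_pointed_def by fastforce
    have "\<exists>q t. good q \<and> improvements n ora q = [] \<and> runs ora P (enc_q enc_nat q) t \<and>
      t \<le> (?M ?N + 2) * poly p (?s ?N) + poly p 0"
    proof (rule P[rule_format, where \<mu> = "\<lambda>q. card (set (occs q))"])
      show "good (initial S k rs ora ())" by (rule good_initial[OF rs])
      show "size (enc_q enc_nat q) \<le> ?s ?N \<and> card (set (occs q)) \<le> ?M ?N" if "good q" for q
        using good_bounds[OF that mn, of ?N] g(3) by simp
      fix q assume q: "good q" and i: "improvements n ora q \<noteq> []"
      have "length (snd f) \<le> n" if "f \<in> set (snd q)" for f
        using q mn that unfolding good_def valid_def by auto
      from improvements_progress[OF q this hd_in_set[OF i]]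
      show "good (hd (improvements n ora q)) \<and>
        card (set (occs q)) < card (set (occs (hd (improvements n ora q))))" .
    qed
    then obtain q t where q: "good q" "improvements n ora q = []" "runs ora P (enc_q enc_nat q) t"
      "t \<le> (?M ?N + 2) * poly p (?s ?N) + poly p 0" by blast
    note l = learned[OF q(1) conjunct2[OF mn] q(2)]
    have "logically_equivalent S \<lparr>head = fst q, body = snd q\<rparr> q_goal"
      using l(2) g(2) unfolding logically_equivalent_def by simp
    moreover have "t \<le> poly b ?N" using q(4) spec[OF b, of ?N] by (rule le_trans)
    ultimately show ?thesis using l(1) q(3) unfolding ora enc_q_cq[symmetric] by blast
  qed
  then show ?thesis unfolding efficiently_exactly_learnable_def by blast
qed

end
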